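(* Let $T>0$, $\varepsilon_*>0$, let $\mathcal{U}\subset\mathbb{R}^3$ be an open set containing $u=0$, and let $U:\mathbb{R}\times\mathcal{U}\times[0,\varepsilon_*]\to\mathbb{R}$ be a $C^\infty$-function satisfying $$U(t+T,u,\varepsilon)=U(t,u,\varepsilon)\qquad\text{for all }(t,u,\varepsilon)\in\mathbb{R}\times\mathcal{U}\times[0,\varepsilon_*].$$ Then, given any integer $l\ge 1$, there exists $\varepsilon_l\in\,]0,\varepsilon_*]$ such that for each $\varepsilon\in\,]0,\varepsilon_l[$ the equation $$\ddot u=-\frac{u}{|u|^3}+\varepsilon\nabla_u U(t,u,\varepsilon)$$ has at least $l$ generalized $T$-periodic solutions lying in $\mathcal{U}$.
   Context: For fixed $\varepsilon$, a generalized $T$-periodic solution of $\ddot u=-\frac{u}{|u|^3}+\varepsilon\nabla_uU(t,u,\varepsilon)$ is a continuous $T$-periodic function $u:\mathbb{R}\to\mathbb{R}^3$ (here with values in $\mathcal{U}$, where the equation is defined) such that: (1) the set $\mathcal{Z}=\{t\in\mathbb{R}: u(t)=0\}$ is discrete; (2) for every open interval $I\subset\mathbb{R}\setminus\mathcal{Z}$ the function $u$ is in $C^\infty(I,\mathbb{R}^3)$ and satisfies the equation on $I$; (3) for every $t_0\in\mathcal{Z}$ the (two-sided) limits $$\lim_{t\to t_0}\frac{u(t)}{|u(t)|},\qquad \lim_{t\to t_0}\Bigl(\frac12|\dot u(t)|^2-\frac1{|u(t)|}\Bigr)$$ exist. Here $|\cdot|$ is the Euclidean norm, and $]a,b[$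 denotes an open interval. *)

theory Defs
  imports "HOL-Analysis.Analysis"
begin

text \<open>
  Derivatives are taken within \<open>S\<close>, so that the notion applies both to open sets and to
  \<open>\<real> \<times> \<U> \<times> [0, \<epsilon>\<^sub>*]\<close> (one-sided derivatives in the last variable at its endpoints).
  On these sets derivatives within \<open>S\<close> are unique, and continuity of all directional
  derivatives \<open>x \<mapsto> f' x v\<close> is continuity of \<open>x \<mapsto> f' x\<close>, the domain being finite-dimensional.
\<close>

primrec Ck_on :: "nat \<Rightarrow> ('a::euclidean_space \<Rightarrow> 'b::real_normed_vector) \<Rightarrow> 'a set \<Rightarrow> bool" where
  "Ck_on 0 f S \<longleftrightarrow> continuous_on S f"
| "Ck_on (Suc k) f S \<longleftrightarrow>
     (\<exists>f'. (\<forall>x\<in>S. (f has_derivative f' x) (at x within S)) \<and> (\<forall>v. Ck_on k (\<lambda>x. f' x v) S))"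

definition Cinfinity_on :: "('a::euclidean_space \<Rightarrow> 'b::real_normed_vector) \<Rightarrow> 'a set \<Rightarrow> bool" where
  "Cinfinity_on f S \<longleftrightarrow> (\<forall>k. Ck_on k f S)"

definition gradient :: "('a::real_inner \<Rightarrow> real) \<Rightarrow> 'a \<Rightarrow> 'a" where
  "gradient f x = (THE D. GDERIV f x :> D)"

lemma gradient_eq: "GDERIV f x :> D \<Longrightarrow> gradient f x = D"
proof -
  assume D: "GDERIV f x :> D"
  have "D' = D" if "GDERIV f x :> D'" for D'
  proof -
    have "(\<lambda>h. inner h D') = (\<lambda>h. inner h D)"
      using that D unfolding gderiv_def by (rule has_derivative_unique)
    then show ?thesis
      by (metis inner_commute vector_eq_rdot)
  qed
  with D show ?thesis
    unfolding gradient_def by blast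
qed

definition generalized_periodic_solution ::
  "real \<Rightarrow> (real^3) set \<Rightarrow> (real \<Rightarrow> real^3 \<Rightarrow> real \<Rightarrow> real) \<Rightarrow> real \<Rightarrow> (real \<Rightarrow> real^3) \<Rightarrow> bool"
  where
  "generalized_periodic_solution T \<U> U \<epsilon> u \<longleftrightarrow>
     continuous_on UNIV u \<and>
     (\<forall>t. u (t + T) = u t) \<and>
     range u \<subseteq> \<U> \<and>
     discrete {t. u t = 0} \<and>
     (\<forall>I. open I \<and> is_interval I \<and> I \<subseteq> - {t. u t = 0} \<longrightarrow>
        Cinfinity_on u I \<and>
        (\<forall>t\<in>I. vector_derivative (\<lambda>s. vector_derivative u (at s)) (at t) =
           - (u t /\<^sub>R norm (u t) ^ 3) + \<epsilon> *\<^sub>R gradient (\<lambda>v. U t v \<epsilon>) (u t))) \<and>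
     (\<forall>t0. u t0 = 0 \<longrightarrow>
        (\<exists>d. ((\<lambda>t. u t /\<^sub>R norm (u t)) \<longlongrightarrow> d) (at t0)) \<and>
        (\<exists>h. ((\<lambda>t. (norm (vector_derivative u (at t)))\<^sup>2 / 2 - 1 / norm (u t)) \<longlongrightarrow> h) (at t0)))"

end

theory Submission
  imports Defs
begin

text \<open>
  The equation is regularized by the Hopf map \<open>h : \<complex>\<^sup>2 \<rightarrow> \<real>\<^sup>3\<close>, \<open>|h(x)| = |x|\<^sup>2\<close>, and the fictitious time
  \<open>s\<close> with \<open>dt\<close> proportional to \<open>|x|\<^sup>2 ds\<close>. Up to a constant and to rescalings of \<open>u\<close> and \<open>t\<close>, the
  action of \<open>u = h(x)\<close> is, for \<open>1\<close>-periodic loops \<open>x\<close> and an initial time \<open>t\<^sub>0\<close>,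
  \<open>a b - J\<^sup>2 + 2 \<omega>\<^sup>2 / b + (\<epsilon> / b) \<integral> P(\<tau>, x) ds\<close> with \<open>a = \<integral> |x'|\<^sup>2\<close>, \<open>b = \<integral> |x|\<^sup>2\<close>, \<open>J = \<integral> \<langle>x', i x\<rangle>\<close>,
  \<open>P(\<tau>, x) = V(\<tau>, h(x)) |x|\<^sup>2\<close> and \<open>\<tau>(s) = t\<^sub>0 + (1 / b) \<integral>\<^sub>0\<^sup>s |x|\<^sup>2\<close>. The term \<open>- J\<^sup>2\<close> comes from
  minimizing over the holonomy of the gauge group \<open>S\<^sup>1\<close>; it makes the gauge momentum of critical points
  vanish identically, so that they project to solutions, and collisions are just zeros of \<open>x\<close>.

  For \<open>\<epsilon> = 0\<close> and \<open>\<omega> = 2 \<pi> n\<close> the loops \<open>(e\<^sup>i\<^sup>\<omega>\<^sup>s A + e\<^sup>-\<^sup>i\<^sup>\<omega>\<^sup>s B) / \<surd>2\<close> with \<open>|A| = |B| = 1\<close> form a compact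
  nondegenerate critical manifold. A contraction solves the equation for small \<open>\<epsilon>\<close> in all directions
  transversal to it, with a solution depending Lipschitz continuously on \<open>(A, B, t\<^sub>0)\<close>, and a maximum of the
  action over this compact parameter set is a genuine critical point. The size of the resulting solution
  tends to \<open>0\<close> as \<open>n \<rightarrow> \<infinity>\<close> but, for fixed \<open>n\<close>, has a lower bound independent of \<open>\<epsilon>\<close>; hence finitely many
  values of \<open>n\<close> give any number of distinct solutions in a given neighbourhood of the origin.
\<close>

section \<open>Calculus of the smoothness classes\<close>

text \<open>The Kepler ellipses of a given period form a manifold that is not compact:
  eccentricities may tend to one, and a maximum of the averaged perturbation may exist only at a
  collision orbit. Among loops in \<open>cc\<close> the ejection-collision orbits are ordinary
  points, and compactness is restored. Gauge orbits and shifts of s stay inside the critical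
  manifold; only the two radii and the nonresonant part of the loop remain to be solved for.

  The contraction yields a solution that is merely Lipschitz in the parameters, so the reduced
  action cannot be differentiated by the chain rule. Instead the action itself is differentiated: at
  a fixed point its derivative sees only the resonant modes of a displacement, and these are
  explicit in A, B and the radii. First-order growth along a curve of parameters then contradicts
  the maximum. Criticality in A and B makes the loop solve the regularized equation; criticality in
  the initial time makes its energy return after one period.\<close>

lemma Ck_on_Suc_imp: "Ck_on (Suc k) f S \<Longrightarrow> Ck_on k f S"
proof (induction k arbitrary: f)
  case 0
  then show ?case
    by (auto intro: has_derivative_continuous_on)
next
  case (Suc k)
  then show ?case
    by (subst Ck_on.simps(2), subst (asm) (2) Ck_on.simps(2)) blast
qed

lemma Ck_on_cong:
  assumes "\<And>x. x \<in> S \<Longrightarrow> f x = g x"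
  shows "Ck_on k f S \<longleftrightarrow> Ck_on k g S"
proof (cases k)
  case 0
  then show ?thesis using assms by (simp cong: continuous_on_cong)
next
  case (Suc n)
  have "(f has_derivative f') (at x within S) \<longleftrightarrow> (g has_derivative f') (at x within S)"
    if "x \<in> S" for f' x
    using that assms by (metis has_derivative_transform)
  with Suc show ?thesis by simp
qed

lemma Ck_on_const: "Ck_on k (\<lambda>x. c) S"
  by (induction k arbitrary: c) (auto intro!: exI[of _ "\<lambda>_ _. 0"])

lemma Ck_on_bounded_linear:
  assumes "bounded_linear L"
  shows "Ck_on k L S"
proof (cases k)
  case 0
  then show ?thesis using assms by (simp add: linear_continuous_on)
next
  case (Suc n)
  then show ?thesis
    using assms bounded_linear_imp_has_derivative[OF assms]
    by (auto intro!: exI[of _ "\<lambda>_. L"] Ck_on_const)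
qed

lemma Ck_on_add: "Ck_on k f S \<Longrightarrow> Ck_on k g S \<Longrightarrow> Ck_on k (\<lambda>x. f x + g x) S"
proof (induction k arbitrary: f g)
  case 0
  then show ?case by (auto intro: continuous_on_add)
next
  case (Suc k)
  obtain f' where "\<And>x. x \<in> S \<Longrightarrow> (f has_derivative f' x) (at x within S)" "\<And>v. Ck_on k (\<lambda>x. f' x v) S"
    using Suc.prems(1) by auto
  moreover obtain g' where "\<And>x. x \<in> S \<Longrightarrow> (g has_derivative g' x) (at x within S)" "\<And>v. Ck_on k (\<lambda>x. g' x v) S"
    using Suc.prems(2) by auto
  ultimately show ?case
    by (auto intro!: exI[of _ "\<lambda>x v. f' x v + g' x v"] has_derivative_add Suc.IH)
qed

lemma Ck_on_sum: "(\<And>i. i \<in> A \<Longrightarrow> Ck_on k (f i) S) \<Longrightarrow> Ck_on k (\<lambda>x. \<Sum>i\<in>A. f i x) S"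
  by (induction A rule: infinite_finite_induct) (auto intro: Ck_on_const Ck_on_add)

lemma Ck_on_bilinear:
  assumes "bounded_bilinear prd"
  shows "Ck_on k f S \<Longrightarrow> Ck_on k g S \<Longrightarrow> Ck_on k (\<lambda>x. prd (f x) (g x)) S"
proof (induction k arbitrary: f g)
  case 0
  then show ?case by (auto intro: bounded_bilinear.continuous_on[OF assms])
next
  case (Suc k)
  obtain f' where f': "\<And>x. x \<in> S \<Longrightarrow> (f has_derivative f' x) (at x within S)" "\<And>v. Ck_on k (\<lambda>x. f' x v) S"
    using Suc.prems(1) by auto
  obtain g' where g': "\<And>x. x \<in> S \<Longrightarrow> (g has_derivative g' x) (at x within S)" "\<And>v. Ck_on k (\<lambda>x. g' x v) S"
    using Suc.prems(2) by auto
  note * = f' g'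
  have "Ck_on k f S" "Ck_on k g S"
    using Suc.prems Ck_on_Suc_imp by blast+
  with * Suc.IH show ?case
    by (auto intro!: exI[of _ "\<lambda>x v. prd (f x) (g' x v) + prd (f' x v) (g x)"]
        bounded_bilinear.FDERIV[OF assms] Ck_on_add)
qed

text \<open>\<open>Ck_on\<close> controls \<open>g' y v\<close> for a fixed direction
  \<open>v\<close> only, while the chain rule produces the moving direction \<open>f' x v\<close>.
  Expanding it in the basis leaves products whose factors have fixed directions, and the induction
  hypothesis applies to them.\<close>

lemma Ck_on_compose:
  fixes f :: "'a::euclidean_space \<Rightarrow> 'b::euclidean_space" and g :: "'b \<Rightarrow> 'c::real_normed_vector"
  shows "Ck_on k g S' \<Longrightarrow> Ck_on k f S \<Longrightarrow> f ` S \<subseteq> S' \<Longrightarrow> Ck_on k (\<lambda>x. g (f x)) S"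
proof (induction k arbitrary: g)
  case 0
  then show ?case by (auto intro: continuous_on_compose2)
next
  case (Suc k)
  obtain f' where f': "\<And>x. x \<in> S \<Longrightarrow> (f has_derivative f' x) (at x within S)" "\<And>v. Ck_on k (\<lambda>x. f' x v) S"
    using Suc.prems(2) by auto
  obtain g' where g': "\<And>x. x \<in> S' \<Longrightarrow> (g has_derivative g' x) (at x within S')" "\<And>v. Ck_on k (\<lambda>x. g' x v) S'"
    using Suc.prems(1) by auto
  note * = f' g'
  have f: "Ck_on k f S"
    using Suc.prems Ck_on_Suc_imp by blast
  let ?d = "\<lambda>x v. \<Sum>b\<in>Basis. (f' x v \<bullet> b) *\<^sub>R g' (f x) b"
  have "((\<lambda>x. g (f x)) has_derivative ?d x) (at x within S)" if x: "x \<in> S" for x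
  proof -
    have fx: "f x \<in> S'" using x Suc.prems(3) by auto
    have "((\<lambda>x. g (f x)) has_derivative (\<lambda>v. g' (f x) (f' x v))) (at x within S)"
      using has_derivative_in_compose2[OF *(3) Suc.prems(3) x *(1)[OF x]] by simp
    moreover have "g' (f x) (f' x v) = ?d x v" for v
    proof -
      interpret bounded_linear "g' (f x)" using *(3)[OF fx] by (rule has_derivative_bounded_linear)
      show ?thesis
        by (subst euclidean_representation[of "f' x v", symmetric]) (simp add: sum scaleR)
    qed
    ultimately show ?thesis by simp
  qed
  moreover have "Ck_on k (\<lambda>x. ?d x v) S" for v
    by (intro Ck_on_sum Ck_on_bilinear[OF bounded_bilinear_scaleR]
        Ck_on_bilinear[OF bounded_bilinear_inner] Ck_on_const *(2) Suc.IH[OF *(4) f Suc.prems(3)])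
  ultimately show ?case
    unfolding Ck_on.simps by (intro exI[of _ ?d]) blast
qed

text \<open>Differentiation only lowers the exponent, so the induction treats all \<open>c\<close>
  at once. The exponent -3/2, applied to the squared norm, will give the Kepler force.\<close>

lemma Ck_on_powr: "Ck_on k (\<lambda>x::real. x powr c) {0<..}"
proof (induction k arbitrary: c)
  case 0
  then show ?case by (auto intro!: continuous_intros)
next
  case (Suc k)
  have "((\<lambda>x. x powr c) has_derivative (\<lambda>v. v * (c * x powr (c - 1)))) (at x within {0<..})"
    if "x > 0" for x
  proof -
    have "(*) (c * x powr (c - 1)) = (\<lambda>v. v * (c * x powr (c - 1)))"
      by (rule ext) (rule mult.commute)
    with has_real_derivative_powr[OF that, of c] show ?thesis
      unfolding has_field_derivative_def by (metis has_derivative_at_withinI)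
  qed
  moreover have "Ck_on k (\<lambda>x::real. v * (c * x powr (c - 1))) {0<..}" for v
    by (intro Ck_on_bilinear[OF bounded_bilinear_mult] Ck_on_const Suc.IH)
  ultimately show ?case
    unfolding Ck_on.simps by (intro exI[of _ "\<lambda>x v. v * (c * x powr (c - 1))"]) auto
qed

lemma Ck_on_has_vector_derivative:
  assumes "\<And>t. t \<in> I \<Longrightarrow> (u has_vector_derivative u1 t) (at t within I)" "Ck_on k u1 I"
  shows "Ck_on (Suc k) u I"
  using assms
  by (auto simp: has_vector_derivative_def intro!: exI[of _ "\<lambda>t v. v *\<^sub>R u1 t"]
      Ck_on_bilinear[OF bounded_bilinear_scaleR] Ck_on_const)

lemma Ck_on_Pair:
  assumes "Ck_on k f S" "Ck_on k g S"
  shows "Ck_on k (\<lambda>x. (f x, g x)) S"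
proof -
  have "Ck_on k (\<lambda>x. (\<lambda>y. (y, 0)) (f x) + (\<lambda>y. (0, y)) (g x)) S"
  proof (intro Ck_on_add)
    show "Ck_on k (\<lambda>x. (f x, 0)) S"
      using assms(1)
    proof (induction k arbitrary: f)
      case (Suc k)
      then obtain f' where "\<And>x. x \<in> S \<Longrightarrow> (f has_derivative f' x) (at x within S)" "\<And>v. Ck_on k (\<lambda>x. f' x v) S"
        by auto
      with Suc.IH show ?case
        by (auto intro!: exI[of _ "\<lambda>x v. (f' x v, 0)"] has_derivative_Pair)
    qed (auto intro: continuous_intros)
    show "Ck_on k (\<lambda>x. (0, g x)) S"
      using assms(2)
    proof (induction k arbitrary: g)
      case (Suc k)
      then obtain f' where "\<And>x. x \<in> S \<Longrightarrow> (g has_derivative f' x) (at x within S)" "\<And>v. Ck_on k (\<lambda>x. f' x v) S"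
        by auto
      with Suc.IH show ?case
        by (auto intro!: exI[of _ "\<lambda>x v. (0, f' x v)"] has_derivative_Pair)
    qed (auto intro: continuous_intros)
  qed
  then show ?thesis by simp
qed

text \<open>Bootstrapping: if \<open>u\<close> and \<open>u1\<close> are of class C^k, so is the
  right-hand side along \<open>u\<close>, and both gain one derivative.\<close>

lemma Cinfinity_on_ode:
  fixes u :: "real \<Rightarrow> 'a::euclidean_space"
  assumes u1: "\<And>t. t \<in> I \<Longrightarrow> (u has_vector_derivative u1 t) (at t within I)"
    and u2: "\<And>t. t \<in> I \<Longrightarrow> (u1 has_vector_derivative F (t, u t)) (at t within I)"
    and F: "Cinfinity_on F S" and S: "\<And>t. t \<in> I \<Longrightarrow> (t, u t) \<in> S"
  shows "Cinfinity_on u I"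
proof -
  have "Ck_on k u I \<and> Ck_on k u1 I" for k
  proof (induction k)
    case 0
    have "continuous_on I u" "continuous_on I u1"
      using u1 u2 has_vector_derivative_continuous unfolding continuous_on_eq_continuous_within by blast+
    then show ?case by simp
  next
    case (Suc k)
    have "Ck_on (Suc k) u I"
      by (rule Ck_on_has_vector_derivative[OF u1 conjunct2[OF Suc]])
    moreover have "Ck_on k (\<lambda>t. F (t, u t)) I"
    proof (rule Ck_on_compose[where g = F and f = "\<lambda>t. (t, u t)"])
      show "Ck_on k F S" using F by (simp add: Cinfinity_on_def)
      show "Ck_on k (\<lambda>t. (t, u t)) I"
        by (intro Ck_on_Pair Ck_on_bounded_linear bounded_linear_ident conjunct1[OF Suc])
      show "(\<lambda>t. (t, u t)) ` I \<subseteq> S" using S by auto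
    qed
    then have "Ck_on (Suc k) u1 I"
      using u2 by (intro Ck_on_has_vector_derivative)
    ultimately show ?case by blast
  qed
  then show ?thesis by (auto simp: Cinfinity_on_def)
qed

section \<open>Function spaces and uniform Lipschitz estimates\<close>

definition clamp01 :: "real \<Rightarrow> real" where "clamp01 x = max 0 (min 1 x)"

lemma clamp01_in [simp]: "0 \<le> clamp01 x" "clamp01 x \<le> 1" and clamp01_id [simp]: "0 \<le> x \<Longrightarrow> x \<le> 1 \<Longrightarrow> clamp01 x = x"
  by (auto simp: clamp01_def)

lemma continuous_on_clamp01: "continuous_on S clamp01"
  unfolding clamp01_def by (intro continuous_intros)

text \<open>Functions on [0,1] are extended by their end values, which preserves the sup norm and
  makes the bounded continuous functions on the line available as a Banach space. A general element
  of that space is arbitrary outside [0,1]; hence identities are mostly transferred by congruence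
  lemmas that look at [0,1] only.\<close>

definition bcont01 :: "(real \<Rightarrow> 'b::metric_space) \<Rightarrow> real \<Rightarrow>\<^sub>C 'b" where
  "bcont01 g = Bcontfun (\<lambda>x. g (clamp01 x))"

lemma bcont01_apply:
  assumes "continuous_on {0..1} g"
  shows "apply_bcontfun (bcont01 g) x = g (clamp01 x)"
proof -
  have "continuous_on UNIV (\<lambda>x. g (clamp01 x))"
    using assms continuous_on_clamp01 by (rule continuous_on_compose2) auto
  moreover have "range (\<lambda>x. g (clamp01 x)) \<subseteq> g ` {0..1}"
    by auto
  then have "bounded (range (\<lambda>x. g (clamp01 x)))"
    using compact_imp_bounded[OF compact_continuous_image[OF assms]] bounded_subset by auto
  ultimately show ?thesis
    unfolding bcont01_def by (subst Bcontfun_inverse) (auto simp: bcontfun_def)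
qed

lemma dist_bcont01_le:
  assumes "continuous_on {0..1} g" "continuous_on {0..1} h" "\<And>x. 0 \<le> x \<Longrightarrow> x \<le> 1 \<Longrightarrow> dist (g x) (h x) \<le> M"
  shows "dist (bcont01 g) (bcont01 h) \<le> M"
  using assms by (intro dist_bound) (simp add: bcont01_apply)

lemma norm_bcont01_le:
  assumes "continuous_on {0..1} g" "\<And>x. 0 \<le> x \<Longrightarrow> x \<le> 1 \<Longrightarrow> norm (g x) \<le> M"
  shows "norm (bcont01 g) \<le> M"
  using assms by (intro norm_bound) (simp add: bcont01_apply)

definition unit_integral :: "(real \<Rightarrow>\<^sub>C 'b::banach) \<Rightarrow> 'b" where
  "unit_integral f = integral {0..1} f"

lemma bcontfun_integrable [simp]: "apply_bcontfun (f :: real \<Rightarrow>\<^sub>C 'b::banach) integrable_on {a..b}"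
  by (intro integrable_continuous_real continuous_on_apply_bcontfun)

lemma bounded_linear_unit_integral: "bounded_linear (unit_integral :: _ \<Rightarrow> 'b::banach)"
proof (rule bounded_linear_intro[where K = 1])
  fix f :: "real \<Rightarrow>\<^sub>C 'b"
  have "norm (integral {0..1} f) \<le> norm f * (1 - 0)"
    by (rule integral_bound) (auto intro: norm_bounded)
  then show "norm (unit_integral f) \<le> norm f * 1" by (simp add: unit_integral_def)
qed (auto simp: unit_integral_def Henstock_Kurzweil_Integration.integral_add)

definition prim :: "(real \<Rightarrow>\<^sub>C 'b::banach) \<Rightarrow> real \<Rightarrow>\<^sub>C 'b" where
  "prim f = bcont01 (\<lambda>s. integral {0..s} f)"

lemma continuous_on_integral_upto:
  "continuous_on {0..1} (\<lambda>s. integral {0..s} (apply_bcontfun (f :: real \<Rightarrow>\<^sub>C 'b::banach)))"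
  by (intro indefinite_integral_continuous_1) simp

lemma prim_apply': "prim f s = integral {0..clamp01 s} f"
  by (simp add: prim_def bcont01_apply[OF continuous_on_integral_upto])

lemma prim_apply: "0 \<le> s \<Longrightarrow> s \<le> 1 \<Longrightarrow> prim f s = integral {0..s} f"
  by (simp add: prim_apply')

lemma prim_has_vector_derivative:
  assumes "s \<in> {0..1}"
  shows "(prim f has_vector_derivative f s) (at s within {0..1})"
  by (rule has_vector_derivative_transform[OF assms _ integral_has_vector_derivative[OF _ assms]])
     (auto simp: prim_apply)

lemma bounded_linear_prim: "bounded_linear (prim :: _ \<Rightarrow> real \<Rightarrow>\<^sub>C 'b::banach)"
proof (rule bounded_linear_intro[where K = 1])
  fix f :: "real \<Rightarrow>\<^sub>C 'b"
  have "norm (integral {0..s} f) \<le> norm f" if "0 \<le> s" "s \<le> 1" for s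
  proof -
    have "norm (integral {0..s} f) \<le> norm f * (s - 0)"
      using that by (intro integral_bound) (auto intro: norm_bounded)
    also have "\<dots> \<le> norm f"
      using that by (simp add: mult_left_le)
    finally show ?thesis .
  qed
  then show "norm (prim f) \<le> norm f * 1"
    unfolding prim_def by (intro norm_bcont01_le continuous_on_integral_upto) auto
qed (auto intro!: bcontfun_eqI simp: prim_apply' Henstock_Kurzweil_Integration.integral_add)

definition lift2 :: "('a::real_normed_vector \<Rightarrow> 'b::real_normed_vector \<Rightarrow> 'c::real_normed_vector) \<Rightarrow>
    (real \<Rightarrow>\<^sub>C 'a) \<Rightarrow> (real \<Rightarrow>\<^sub>C 'b) \<Rightarrow> real \<Rightarrow>\<^sub>C 'c" where
  "lift2 prd f g = bcont01 (\<lambda>s. prd (f s) (g s))"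

lemma lift2_apply:
  assumes "bounded_bilinear prd"
  shows "lift2 prd f g s = prd (f (clamp01 s)) (g (clamp01 s))"
  unfolding lift2_def by (intro bcont01_apply bounded_bilinear.continuous_on[OF assms]) auto

lemma bounded_bilinear_lift2:
  assumes "bounded_bilinear prd"
  shows "bounded_bilinear (lift2 prd)"
proof -
  interpret bounded_bilinear prd by fact
  obtain K where K: "K \<ge> 0" "\<And>a b. norm (prd a b) \<le> norm a * norm b * K"
    using nonneg_bounded by blast
  show ?thesis
  proof
    have "norm (lift2 prd f g) \<le> norm f * norm g * K" for f g
    proof (rule norm_bound)
      fix s
      have "norm (prd (f (clamp01 s)) (g (clamp01 s))) \<le> norm (f (clamp01 s)) * norm (g (clamp01 s)) * K"
        by (rule K)
      also have "\<dots> \<le> norm f * norm g * K"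
        using K(1) by (intro mult_right_mono mult_mono norm_bounded) auto
      finally show "norm (lift2 prd f g s) \<le> norm f * norm g * K"
        by (simp add: lift2_apply[OF assms])
    qed
    then show "\<exists>K. \<forall>f g. norm (lift2 prd f g) \<le> norm f * norm g * K" by blast
  qed (auto intro!: bcontfun_eqI simp: lift2_apply[OF assms] add_left add_right scaleR_left scaleR_right)
qed

lemma bounded_linear_const_bcontfun:
  "bounded_linear (const_bcontfun :: _ \<Rightarrow> real \<Rightarrow>\<^sub>C 'b::real_normed_vector)"
  by (rule bounded_linear_intro[where K = 1])
     (auto intro!: bcontfun_eqI norm_bound)


text \<open>Families \<open>F \<epsilon>\<close> on sets \<open>S d\<close> whose sup norm and Lipschitz constant are, uniformly in
  \<open>\<epsilon>\<close> and \<open>d\<close>, of the orders \<open>m \<epsilon> d\<close> and \<open>k \<epsilon> d\<close>.\<close>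

locale lip_family =
  fixes e1 d0 :: real and S :: "real \<Rightarrow> 'p::metric_space set"
  assumes e1: "0 < e1" "e1 \<le> 1" and d0: "0 < d0" "d0 \<le> 1"
begin

definition ol :: "(real \<Rightarrow> real \<Rightarrow> real) \<Rightarrow> (real \<Rightarrow> real \<Rightarrow> real) \<Rightarrow>
    (real \<Rightarrow> 'p \<Rightarrow> 'b::real_normed_vector) \<Rightarrow> bool" where
  "ol m k F \<longleftrightarrow> (\<exists>C\<ge>0. \<forall>e\<in>{0<..<e1}. \<forall>d\<in>{0<..d0}. \<forall>p\<in>S d.
     norm (F e p) \<le> C * m e d \<and> (\<forall>q\<in>S d. norm (F e p - F e q) \<le> C * k e d * dist p q))"

lemma olI:
  assumes "C \<ge> 0"
    and "\<And>e d p. 0 < e \<Longrightarrow> e < e1 \<Longrightarrow> 0 < d \<Longrightarrow> d \<le> d0 \<Longrightarrow> p \<in> S d \<Longrightarrow> norm (F e p) \<le> C * m e d"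
    and "\<And>e d p q. 0 < e \<Longrightarrow> e < e1 \<Longrightarrow> 0 < d \<Longrightarrow> d \<le> d0 \<Longrightarrow> p \<in> S d \<Longrightarrow> q \<in> S d \<Longrightarrow>
      norm (F e p - F e q) \<le> C * k e d * dist p q"
  shows "ol m k F"
  using assms unfolding ol_def by (intro exI[of _ C]) auto

lemma olE:
  assumes "ol m k F"
  obtains C where "C \<ge> 0"
    "\<And>e d p. 0 < e \<Longrightarrow> e < e1 \<Longrightarrow> 0 < d \<Longrightarrow> d \<le> d0 \<Longrightarrow> p \<in> S d \<Longrightarrow> norm (F e p) \<le> C * m e d"
    "\<And>e d p q. 0 < e \<Longrightarrow> e < e1 \<Longrightarrow> 0 < d \<Longrightarrow> d \<le> d0 \<Longrightarrow> p \<in> S d \<Longrightarrow> q \<in> S d \<Longrightarrow>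
      norm (F e p - F e q) \<le> C * k e d * dist p q"
  using assms unfolding ol_def by (metis greaterThanAtMost_iff greaterThanLessThan_iff)

lemma ol_mono:
  assumes F: "ol m k F" and c: "c \<ge> 0"
    and le: "\<And>e d. 0 < e \<Longrightarrow> e < 1 \<Longrightarrow> 0 < d \<Longrightarrow> d \<le> 1 \<Longrightarrow> m e d \<le> c * m' e d \<and> k e d \<le> c * k' e d"
  shows "ol m' k' F"
proof -
  obtain C where C: "C \<ge> 0"
    "\<And>e d p. 0 < e \<Longrightarrow> e < e1 \<Longrightarrow> 0 < d \<Longrightarrow> d \<le> d0 \<Longrightarrow> p \<in> S d \<Longrightarrow> norm (F e p) \<le> C * m e d"
    "\<And>e d p q. 0 < e \<Longrightarrow> e < e1 \<Longrightarrow> 0 < d \<Longrightarrow> d \<le> d0 \<Longrightarrow> p \<in> S d \<Longrightarrow> q \<in> S d \<Longrightarrow>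
      norm (F e p - F e q) \<le> C * k e d * dist p q"
    using F by (rule olE) blast
  show ?thesis
  proof (rule olI[of "C * c"])
    fix e d p assume *: "0 < e" "e < e1" "0 < d" "d \<le> d0" "p \<in> S d"
    then have "e < 1" "d \<le> 1" using e1 d0 by auto
    note l = le[OF *(1) this(1) *(3) this(2)]
    show "norm (F e p) \<le> C * c * m' e d"
      using C(2)[OF *] mult_left_mono[OF conjunct1[OF l] C(1)] by (simp add: mult.assoc)
    fix q assume "q \<in> S d"
    have "C * k e d * dist p q \<le> C * (c * k' e d) * dist p q"
      using l C(1) by (intro mult_right_mono mult_left_mono) auto
    then show "norm (F e p - F e q) \<le> C * c * k' e d * dist p q"
      using C(3)[OF * \<open>q \<in> S d\<close>] by (simp add: mult.assoc)
  qed (use C(1) c in auto)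
qed

lemma ol_add:
  assumes "ol m k F" "ol m k G"
  shows "ol m k (\<lambda>e p. F e p + G e p)"
proof -
  obtain C where C: "C \<ge> 0"
    "\<And>e d p. 0 < e \<Longrightarrow> e < e1 \<Longrightarrow> 0 < d \<Longrightarrow> d \<le> d0 \<Longrightarrow> p \<in> S d \<Longrightarrow> norm (F e p) \<le> C * m e d"
    "\<And>e d p q. 0 < e \<Longrightarrow> e < e1 \<Longrightarrow> 0 < d \<Longrightarrow> d \<le> d0 \<Longrightarrow> p \<in> S d \<Longrightarrow> q \<in> S d \<Longrightarrow>
      norm (F e p - F e q) \<le> C * k e d * dist p q"
    using assms(1) by (rule olE) blast
  obtain D where D: "D \<ge> 0"
    "\<And>e d p. 0 < e \<Longrightarrow> e < e1 \<Longrightarrow> 0 < d \<Longrightarrow> d \<le> d0 \<Longrightarrow> p \<in> S d \<Longrightarrow> norm (G e p) \<le> D * m e d"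
    "\<And>e d p q. 0 < e \<Longrightarrow> e < e1 \<Longrightarrow> 0 < d \<Longrightarrow> d \<le> d0 \<Longrightarrow> p \<in> S d \<Longrightarrow> q \<in> S d \<Longrightarrow>
      norm (G e p - G e q) \<le> D * k e d * dist p q"
    using assms(2) by (rule olE) blast
  show ?thesis
  proof (rule olI[of "C + D"])
    fix e d p assume *: "0 < e" "e < e1" "0 < d" "d \<le> d0" "p \<in> S d"
    show "norm (F e p + G e p) \<le> (C + D) * m e d"
      using norm_triangle_le[OF add_mono[OF C(2)[OF *] D(2)[OF *]]] by (simp add: distrib_right)
    fix q assume q: "q \<in> S d"
    show "norm (F e p + G e p - (F e q + G e q)) \<le> (C + D) * k e d * dist p q"
      using norm_triangle_le[OF add_mono[OF C(3)[OF * q] D(3)[OF * q]]]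
      by (simp add: distrib_right algebra_simps)
  qed (use C D in auto)
qed

lemma ol_linear:
  assumes L: "bounded_linear L" and "ol m k F"
  shows "ol m k (\<lambda>e p. L (F e p))"
proof -
  interpret bounded_linear L by fact
  obtain C where C: "C \<ge> 0"
    "\<And>e d p. 0 < e \<Longrightarrow> e < e1 \<Longrightarrow> 0 < d \<Longrightarrow> d \<le> d0 \<Longrightarrow> p \<in> S d \<Longrightarrow> norm (F e p) \<le> C * m e d"
    "\<And>e d p q. 0 < e \<Longrightarrow> e < e1 \<Longrightarrow> 0 < d \<Longrightarrow> d \<le> d0 \<Longrightarrow> p \<in> S d \<Longrightarrow> q \<in> S d \<Longrightarrow>
      norm (F e p - F e q) \<le> C * k e d * dist p q"
    using assms(2) by (rule olE) blast
  obtain K where K: "K \<ge> 0" "\<And>x. norm (L x) \<le> norm x * K"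
    using nonneg_bounded by blast
  show ?thesis
  proof (rule olI[of "C * K"])
    fix e d p assume *: "0 < e" "e < e1" "0 < d" "d \<le> d0" "p \<in> S d"
    show "norm (L (F e p)) \<le> C * K * m e d"
      using order_trans[OF K(2) mult_right_mono[OF C(2)[OF *] K(1)]] by (simp add: mult_ac)
    fix q assume q: "q \<in> S d"
    show "norm (L (F e p) - L (F e q)) \<le> C * K * k e d * dist p q"
      using order_trans[OF K(2) mult_right_mono[OF C(3)[OF * q] K(1)]] by (simp add: mult_ac diff)
  qed (use C K in auto)
qed

text \<open>Leibniz rule for pairs of a size and a Lipschitz constant; \<open>c\<close> absorbs the
  comparison of the resulting orders.\<close>

lemma ol_bilinear:
  assumes prd: "bounded_bilinear prd" and F: "ol m1 k1 F" and G: "ol m2 k2 G" and c: "c \<ge> 0"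
    and le: "\<And>e d. 0 < e \<Longrightarrow> e < 1 \<Longrightarrow> 0 < d \<Longrightarrow> d \<le> 1 \<Longrightarrow> m1 e d * m2 e d \<le> c * m e d \<and>
      m1 e d * k2 e d + k1 e d * m2 e d \<le> c * k e d"
  shows "ol m k (\<lambda>e p. prd (F e p) (G e p))"
proof -
  interpret bounded_bilinear prd by fact
  obtain C where C: "C \<ge> 0"
    "\<And>e d p. 0 < e \<Longrightarrow> e < e1 \<Longrightarrow> 0 < d \<Longrightarrow> d \<le> d0 \<Longrightarrow> p \<in> S d \<Longrightarrow> norm (F e p) \<le> C * m1 e d"
    "\<And>e d p q. 0 < e \<Longrightarrow> e < e1 \<Longrightarrow> 0 < d \<Longrightarrow> d \<le> d0 \<Longrightarrow> p \<in> S d \<Longrightarrow> q \<in> S d \<Longrightarrow>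
      norm (F e p - F e q) \<le> C * k1 e d * dist p q"
    using F by (rule olE) blast
  obtain D where D: "D \<ge> 0"
    "\<And>e d p. 0 < e \<Longrightarrow> e < e1 \<Longrightarrow> 0 < d \<Longrightarrow> d \<le> d0 \<Longrightarrow> p \<in> S d \<Longrightarrow> norm (G e p) \<le> D * m2 e d"
    "\<And>e d p q. 0 < e \<Longrightarrow> e < e1 \<Longrightarrow> 0 < d \<Longrightarrow> d \<le> d0 \<Longrightarrow> p \<in> S d \<Longrightarrow> q \<in> S d \<Longrightarrow>
      norm (G e p - G e q) \<le> D * k2 e d * dist p q"
    using G by (rule olE) blast
  obtain K where K: "K \<ge> 0" "\<And>a b. norm (prd a b) \<le> norm a * norm b * K"
    using nonneg_bounded by blast
  have mul: "norm (prd a b) \<le> x * y * K" if "norm a \<le> x" "norm b \<le> y" for a b x y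
  proof -
    have "0 \<le> x" using that(1) norm_ge_zero order_trans by blast
    then have "norm a * norm b * K \<le> x * y * K"
      using that K(1) by (intro mult_right_mono mult_mono) auto
    then show ?thesis using K(2) order_trans by blast
  qed
  show ?thesis
  proof (rule olI[of "C * D * K * c"])
    fix e d p assume *: "0 < e" "e < e1" "0 < d" "d \<le> d0" "p \<in> S d"
    then have "e < 1" "d \<le> 1" using e1 d0 by auto
    note l = le[OF *(1) this(1) *(3) this(2)]
    have "C * D * K * (m1 e d * m2 e d) \<le> C * D * K * (c * m e d)"
      using l C(1) D(1) K(1) by (intro mult_left_mono) auto
    then show "norm (prd (F e p) (G e p)) \<le> C * D * K * c * m e d"
      using mul[OF C(2)[OF *] D(2)[OF *]] by (simp add: mult_ac)
    fix q assume q: "q \<in> S d"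
    note qq = *(1-4) q
    have "prd (F e p) (G e p) - prd (F e q) (G e q) =
        prd (F e p) (G e p - G e q) + prd (F e p - F e q) (G e q)"
      by (simp add: diff_left diff_right)
    also have "norm \<dots> \<le> C * m1 e d * (D * k2 e d * dist p q) * K + C * k1 e d * dist p q * (D * m2 e d) * K"
      by (intro norm_triangle_le add_mono mul C(2)[OF *] D(3)[OF * q] C(3)[OF * q] D(2)[OF qq])
    also have "\<dots> = C * D * K * dist p q * (m1 e d * k2 e d + k1 e d * m2 e d)"
      by (simp add: algebra_simps)
    also have "\<dots> \<le> C * D * K * dist p q * (c * k e d)"
      using l C(1) D(1) K(1) by (intro mult_left_mono) auto
    finally show "norm (prd (F e p) (G e p) - prd (F e q) (G e q)) \<le> C * D * K * c * k e d * dist p q"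
      by (simp add: mult_ac)
  qed (use C D K c in auto)
qed

text \<open>The three orders that occur: bounded, first order, and second order with \<open>\<epsilon>\<close> counted
  as second order.\<close>

abbreviation "bl \<equiv> ol (\<lambda>e d. 1) (\<lambda>e d. 1)"
abbreviation "o1 \<equiv> ol (\<lambda>e d. e + d) (\<lambda>e d. 1)"
abbreviation "sm \<equiv> ol (\<lambda>e d. e + d\<^sup>2) (\<lambda>e d. e + d)"

lemma sm_o1: "sm F \<Longrightarrow> o1 F"
proof (erule ol_mono[of _ _ _ 2])
  fix e d :: real assume *: "0 < e" "e < 1" "0 < d" "d \<le> 1"
  then have "d\<^sup>2 \<le> d" by (simp add: power2_eq_square mult_left_le)
  with * show "e + d\<^sup>2 \<le> 2 * (e + d) \<and> e + d \<le> 2 * 1" by auto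
qed simp

lemma o1_bl: "o1 F \<Longrightarrow> bl F"
  by (erule ol_mono[of _ _ _ 2]) auto

lemma bl_bilinear: "bounded_bilinear prd \<Longrightarrow> bl F \<Longrightarrow> bl G \<Longrightarrow> bl (\<lambda>e p. prd (F e p) (G e p))"
  by (erule ol_bilinear[where c = 2]) auto

lemma o1_bilinear: "bounded_bilinear prd \<Longrightarrow> o1 F \<Longrightarrow> o1 G \<Longrightarrow> sm (\<lambda>e p. prd (F e p) (G e p))"
proof (erule ol_bilinear[where c = 4])
  fix e d :: real assume *: "0 < e" "e < 1" "0 < d" "d \<le> 1"
  have "(e + d) * (e + d) \<le> 2 * e\<^sup>2 + 2 * d\<^sup>2"
    using zero_le_power2[of "e - d"] by (simp add: power2_eq_square algebra_simps)
  also have "e\<^sup>2 \<le> e" using * by (simp add: power2_eq_square mult_left_le)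
  finally have "(e + d) * (e + d) \<le> 2 * e + 2 * d\<^sup>2" by simp
  also have "\<dots> \<le> 4 * (e + d\<^sup>2)" using * by simp
  finally show "(e + d) * (e + d) \<le> 4 * (e + d\<^sup>2) \<and> (e + d) * 1 + 1 * (e + d) \<le> 4 * (e + d)"
    using * by auto
qed auto

lemma sm_bilinear_left: "bounded_bilinear prd \<Longrightarrow> sm F \<Longrightarrow> bl G \<Longrightarrow> sm (\<lambda>e p. prd (F e p) (G e p))"
proof (erule ol_bilinear[where c = 2])
  fix e d :: real assume *: "0 < e" "e < 1" "0 < d" "d \<le> 1"
  then have "d\<^sup>2 \<le> d" by (simp add: power2_eq_square mult_left_le)
  with * show "(e + d\<^sup>2) * 1 \<le> 2 * (e + d\<^sup>2) \<and> (e + d\<^sup>2) * 1 + (e + d) * 1 \<le> 2 * (e + d)" by auto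
qed auto

lemma sm_bilinear_right: "bounded_bilinear prd \<Longrightarrow> bl F \<Longrightarrow> sm G \<Longrightarrow> sm (\<lambda>e p. prd (F e p) (G e p))"
  by (rule sm_bilinear_left[OF bounded_bilinear.flip])

lemma bl_const: "bl (\<lambda>e p. c)"
  by (rule olI[of "norm c"]) auto

lemma sm_eps: "bl F \<Longrightarrow> sm (\<lambda>e p. e *\<^sub>R F e p)"
proof -
  assume "bl F"
  then obtain C where C: "C \<ge> 0"
    "\<And>e d p. 0 < e \<Longrightarrow> e < e1 \<Longrightarrow> 0 < d \<Longrightarrow> d \<le> d0 \<Longrightarrow> p \<in> S d \<Longrightarrow> norm (F e p) \<le> C * 1"
    "\<And>e d p q. 0 < e \<Longrightarrow> e < e1 \<Longrightarrow> 0 < d \<Longrightarrow> d \<le> d0 \<Longrightarrow> p \<in> S d \<Longrightarrow> q \<in> S d \<Longrightarrow>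
      norm (F e p - F e q) \<le> C * 1 * dist p q"
    by (rule olE) blast
  show ?thesis
  proof (rule olI[OF C(1)])
    fix e d p assume *: "0 < e" "e < e1" "0 < d" "d \<le> d0" "p \<in> S d"
    have "e * norm (F e p) \<le> e * C" using C(2)[OF *] * by (intro mult_left_mono) auto
    also have "\<dots> \<le> C * (e + d\<^sup>2)" using C(1) by (simp add: algebra_simps)
    finally show "norm (e *\<^sub>R F e p) \<le> C * (e + d\<^sup>2)" using * by simp
    fix q assume q: "q \<in> S d"
    have "e * norm (F e p - F e q) \<le> e * (C * dist p q)"
      using C(3)[OF * q] * by (intro mult_left_mono) auto
    also have "\<dots> \<le> C * (e + d) * dist p q"
      using C(1) * by (simp add: algebra_simps)
    finally show "norm (e *\<^sub>R F e p - e *\<^sub>R F e q) \<le> C * (e + d) * dist p q"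
      using * by (simp flip: scaleR_diff_right)
  qed
qed

lemma bl_inverse:
  fixes F :: "real \<Rightarrow> 'p \<Rightarrow> real"
  assumes F: "bl F" and m: "m > 0"
    and ge: "\<And>e d p. 0 < e \<Longrightarrow> e < e1 \<Longrightarrow> 0 < d \<Longrightarrow> d \<le> d0 \<Longrightarrow> p \<in> S d \<Longrightarrow> m \<le> F e p"
  shows "bl (\<lambda>e p. inverse (F e p))"
proof -
  obtain C where C: "C \<ge> 0"
    "\<And>e d p q. 0 < e \<Longrightarrow> e < e1 \<Longrightarrow> 0 < d \<Longrightarrow> d \<le> d0 \<Longrightarrow> p \<in> S d \<Longrightarrow> q \<in> S d \<Longrightarrow>
      norm (F e p - F e q) \<le> C * 1 * dist p q"
    using F by (rule olE) blast
  show ?thesis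
  proof (rule olI[of "max (inverse m) (C * inverse m * inverse m)"])
    fix e d p assume *: "0 < e" "e < e1" "0 < d" "d \<le> d0" "p \<in> S d"
    note mp = ge[OF *]
    have l2_inner: "inverse (F e p) \<le> inverse m" "inverse (F e p) > 0" using mp m by (auto intro: le_imp_inverse_le)
    then show "norm (inverse (F e p)) \<le> max (inverse m) (C * inverse m * inverse m) * 1" by auto
    fix q assume q: "q \<in> S d"
    note mq = ge[OF *(1-4) q]
    have iq: "inverse (F e q) \<le> inverse m" "inverse (F e q) > 0" using mq m by (auto intro: le_imp_inverse_le)
    have "\<bar>inverse (F e p) - inverse (F e q)\<bar> = \<bar>F e p - F e q\<bar> * (inverse (F e p) * inverse (F e q))"
      using mp mq m by (simp add: field_simps abs_mult flip: abs_minus_commute)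
    also have "\<dots> \<le> (C * dist p q) * (inverse m * inverse m)"
      using C(2)[OF * q] l2_inner iq C(1) m by (intro mult_mono) auto
    also have "\<dots> = (C * inverse m * inverse m) * dist p q"
      by (simp only: mult_ac)
    also have "\<dots> \<le> max (inverse m) (C * inverse m * inverse m) * 1 * dist p q"
      unfolding mult_1_right by (rule mult_right_mono[OF max.cobounded2 zero_le_dist])
    finally show "norm (inverse (F e p) - inverse (F e q)) \<le> max (inverse m) (C * inverse m * inverse m) * 1 * dist p q"
      by simp
  qed (use m in \<open>simp add: max.coboundedI1\<close>)
qed

text \<open>In the sup norm a superposition operator inherits bound and Lipschitz constant from its
  kernel. The kernel has to obey them on the whole space, because nothing confines the values of
  \<open>F\<close> and \<open>G\<close>.\<close>

lemma bl_nemytskii: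
  fixes g :: "real \<Rightarrow> 'a::real_normed_vector \<Rightarrow> 'b::real_normed_vector \<Rightarrow> 'c::real_normed_vector"
  assumes F: "bl F" and G: "bl G"
    and bd: "\<And>e a b. 0 < e \<Longrightarrow> e < e1 \<Longrightarrow> norm (g e a b) \<le> M"
    and lip: "\<And>e a b a' b'. 0 < e \<Longrightarrow> e < e1 \<Longrightarrow> norm (g e a b - g e a' b') \<le> M * (norm (a - a') + norm (b - b'))"
  shows "bl (\<lambda>e p. bcont01 (\<lambda>s. g e (apply_bcontfun (F e p) s) (apply_bcontfun (G e p) s)))"
proof -
  obtain C where C: "C \<ge> 0"
    "\<And>e d p q. 0 < e \<Longrightarrow> e < e1 \<Longrightarrow> 0 < d \<Longrightarrow> d \<le> d0 \<Longrightarrow> p \<in> S d \<Longrightarrow> q \<in> S d \<Longrightarrow>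
      norm (F e p - F e q) \<le> C * 1 * dist p q"
    using F by (rule olE) blast
  obtain D where D: "D \<ge> 0"
    "\<And>e d p q. 0 < e \<Longrightarrow> e < e1 \<Longrightarrow> 0 < d \<Longrightarrow> d \<le> d0 \<Longrightarrow> p \<in> S d \<Longrightarrow> q \<in> S d \<Longrightarrow>
      norm (G e p - G e q) \<le> D * 1 * dist p q"
    using G by (rule olE) blast
  have M: "M \<ge> 0" using bd[of "e1/2" 0 0] e1 norm_ge_zero[of "g (e1/2) 0 0"] by linarith
  have cont: "continuous_on T (\<lambda>s. g e (apply_bcontfun u s) (apply_bcontfun v s))"
    if e: "0 < e" "e < e1" for e T and u :: "real \<Rightarrow>\<^sub>C 'a" and v :: "real \<Rightarrow>\<^sub>C 'b"
    unfolding continuous_on_def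
  proof
    fix s assume "s \<in> T"
    have uv: "(apply_bcontfun u \<longlongrightarrow> apply_bcontfun u s) (at s within T)" "(apply_bcontfun v \<longlongrightarrow> apply_bcontfun v s) (at s within T)"
      using \<open>s \<in> T\<close> continuous_on_apply_bcontfun[of T] by (auto simp: continuous_on_def)
    show "((\<lambda>s. g e (apply_bcontfun u s) (apply_bcontfun v s)) \<longlongrightarrow> g e (apply_bcontfun u s) (apply_bcontfun v s)) (at s within T)"
    proof (rule Lim_transform_bound[THEN LIM_zero_cancel])
      show "\<forall>\<^sub>F r in at s within T. norm (g e (apply_bcontfun u r) (apply_bcontfun v r) - g e (apply_bcontfun u s) (apply_bcontfun v s))
        \<le> norm (M * (norm (apply_bcontfun u r - apply_bcontfun u s) + norm (apply_bcontfun v r - apply_bcontfun v s)))"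
        using lip[OF e] M by (intro always_eventually) auto
      show "((\<lambda>r. M * (norm (apply_bcontfun u r - apply_bcontfun u s) + norm (apply_bcontfun v r - apply_bcontfun v s))) \<longlongrightarrow> 0) (at s within T)"
        by (rule tendsto_eq_intros uv refl | simp)+
    qed
  qed
  show ?thesis
  proof (rule olI[of "max M (M * (C + D))"])
    fix e d p assume *: "0 < e" "e < e1" "0 < d" "d \<le> d0" "p \<in> S d"
    show "norm (bcont01 (\<lambda>s. g e (F e p s) (G e p s))) \<le> max M (M * (C + D)) * 1"
      using bd[OF *(1,2)] by (intro norm_bcont01_le cont *) (auto intro: max.coboundedI1)
    fix q assume q: "q \<in> S d"
    have "norm (bcont01 (\<lambda>s. g e (F e p s) (G e p s)) - bcont01 (\<lambda>s. g e (F e q s) (G e q s))) \<le> M * (C + D) * dist p q"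
      unfolding dist_norm[symmetric]
    proof (intro dist_bcont01_le cont *)
      fix s
      have "dist (g e (F e p s) (G e p s)) (g e (F e q s) (G e q s)) \<le> M * (norm (F e p s - F e q s) + norm (G e p s - G e q s))"
        using lip[OF *(1,2)] by (simp add: dist_norm)
      also have "\<dots> \<le> M * (C * dist p q + D * dist p q)"
        using C(2)[OF * q] D(2)[OF * q] norm_bounded[of "F e p - F e q" s] norm_bounded[of "G e p - G e q" s]
        by (intro mult_left_mono add_mono M) auto
      finally show "dist (g e (F e p s) (G e p s)) (g e (F e q s) (G e q s)) \<le> M * (C + D) * dist p q"
        by (simp add: algebra_simps)
    qed
    also have "\<dots> \<le> max M (M * (C + D)) * 1 * dist p q"
      by (intro mult_right_mono) auto
    finally show "norm (bcont01 (\<lambda>s. g e (F e p s) (G e p s)) - bcont01 (\<lambda>s. g e (F e q s) (G e q s))) \<le> max M (M * (C + D)) * 1 * dist p q" .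
  qed (use M in auto)
qed

lemma ol_diff: "ol m k F \<Longrightarrow> ol m k G \<Longrightarrow> ol m k (\<lambda>e p. F e p - G e p)"
  using ol_add[of m k F "\<lambda>e p. - G e p"] ol_linear[OF bounded_linear_minus[OF bounded_linear_ident], of m k G]
  by simp

end

section \<open>A contraction principle with parameters\<close>

lemma dist_Pair_le: "dist (a, b) (c, d) \<le> dist a c + dist b d"
  unfolding dist_Pair_Pair by (rule sqrt_sum_squares_le_sum) auto

text \<open>Second order is what a contraction on the ball of radius \<open>d\<close> needs: size
  \<open>C * (e + d^2)\<close> against \<open>d\<close>, Lipschitz constant
  \<open>C * (e + d)\<close> against 1/2. So \<open>d\<close> is fixed first, independently of
  \<open>e\<close>, and \<open>e\<close> is then small against \<open>d\<close>. Two fixed points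
  differ by at most half their own distance plus half the parameter distance, whence the Lipschitz
  constant 1.\<close>

lemma sm_fixed_point:
  fixes F :: "real \<Rightarrow> 'x::{real_normed_vector, complete_space} \<times> 'q::metric_space \<Rightarrow> 'x"
  assumes fam: "lip_family e1 d0"
    and sm: "lip_family.ol e1 d0 (\<lambda>d. cball 0 d \<times> Q) (\<lambda>e d. e + d\<^sup>2) (\<lambda>e d. e + d) F"
  shows "\<exists>e2>0. e2 \<le> e1 \<and> (\<exists>d>0. d \<le> d0 \<and> (\<forall>e. 0 < e \<and> e < e2 \<longrightarrow> (\<exists>y. \<forall>q\<in>Q.
    norm (y q) \<le> d \<and> F e (y q, q) = y q \<and> (\<forall>z. norm z \<le> d \<and> F e (z, q) = z \<longrightarrow> z = y q) \<and>
    (\<forall>q'\<in>Q. dist (y q) (y q') \<le> dist q q'))))"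
proof -
  interpret lip_family e1 d0 "\<lambda>d. cball 0 d \<times> Q" by fact
  obtain C where C: "C \<ge> 0"
    "\<And>e d p. 0 < e \<Longrightarrow> e < e1 \<Longrightarrow> 0 < d \<Longrightarrow> d \<le> d0 \<Longrightarrow> p \<in> cball 0 d \<times> Q \<Longrightarrow> norm (F e p) \<le> C * (e + d\<^sup>2)"
    "\<And>e d p q. 0 < e \<Longrightarrow> e < e1 \<Longrightarrow> 0 < d \<Longrightarrow> d \<le> d0 \<Longrightarrow> p \<in> cball 0 d \<times> Q \<Longrightarrow> q \<in> cball 0 d \<times> Q \<Longrightarrow>
      norm (F e p - F e q) \<le> C * (e + d) * dist p q"
    using sm by (rule olE) blast
  \<comment> \<open>With \<open>C * d \<le> 1/4\<close> and \<open>C * e \<le> d/4\<close> the image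
    has norm at most d/2, and since d <= 1 the Lipschitz constant is at most 1/2. Writing C + 1
    covers the case C = 0.\<close>
  define d where "d = min d0 (1 / (4 * (C + 1)))"
  define e2 where "e2 = min e1 (d / (4 * (C + 1)))"
  have d: "0 < d" "d \<le> d0" and Cd: "C * d \<le> 1 / 4"
  proof -
    show "0 < d" "d \<le> d0" using d0 C(1) by (auto simp: d_def)
    have "C * d \<le> C * (1 / (4 * (C + 1)))" using C(1) by (intro mult_left_mono) (auto simp: d_def)
    also have "\<dots> \<le> 1 / 4" using C(1) by (simp add: field_simps)
    finally show "C * d \<le> 1 / 4" .
  qed
  have e2: "0 < e2" "e2 \<le> e1" and Ce: "C * e \<le> d / 4" if "0 < e" "e < e2" for e
  proof -
    show "0 < e2" "e2 \<le> e1" using e1 d C(1) by (auto simp: e2_def)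
    have "C * e \<le> C * (d / (4 * (C + 1)))" using C(1) that by (intro mult_left_mono) (auto simp: e2_def)
    also have "\<dots> = (d / 4) * (C / (C + 1))" by simp
    also have "\<dots> \<le> d / 4" using C(1) d by (intro mult_left_le) (auto simp: field_simps)
    finally show "C * e \<le> d / 4" .
  qed
  have "0 < e2" using e1 d C(1) by (auto simp: e2_def)
  moreover have "e2 \<le> e1" by (simp add: e2_def)
  moreover have "\<exists>y. \<forall>q\<in>Q. norm (y q) \<le> d \<and> F e (y q, q) = y q \<and> (\<forall>z. norm z \<le> d \<and> F e (z, q) = z \<longrightarrow> z = y q) \<and>
      (\<forall>q'\<in>Q. dist (y q) (y q') \<le> dist q q')" if e: "0 < e" "e < e2" for e
  proof -
    have ee: "e < e1" using e e2(2)[OF e] by simp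
    have lip: "dist (F e (x, q)) (F e (x', q')) \<le> 1 / 2 * (dist x x' + dist q q')"
      if "norm x \<le> d" "norm x' \<le> d" "q \<in> Q" "q' \<in> Q" for x x' q q'
    proof -
      have "norm (F e (x, q) - F e (x', q')) \<le> C * (e + d) * dist (x, q) (x', q')"
        using that by (intro C(3)[OF e(1) ee d]) auto
      also have "\<dots> \<le> 1 / 2 * (dist x x' + dist q q')"
      proof (intro mult_mono dist_Pair_le)
        have "d \<le> 1" using d d0 by simp
        then show "C * (e + d) \<le> 1 / 2" using Cd Ce[OF e] by (simp add: distrib_left)
      qed auto
      finally show ?thesis by (simp add: dist_norm)
    qed
    have "\<exists>!x. x \<in> cball 0 d \<and> F e (x, q) = x" if q: "q \<in> Q" for q
    proof (rule Banach_fix)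
      show "complete (cball (0::'x) d)" by (simp add: complete_eq_closed)
      show "(\<lambda>x. F e (x, q)) ` cball 0 d \<subseteq> cball 0 d"
      proof safe
        fix x :: 'x assume "x \<in> cball 0 d"
        then have "norm (F e (x, q)) \<le> C * (e + d\<^sup>2)"
          using q by (intro C(2)[OF e(1) ee d]) auto
        also have "\<dots> = C * e + (C * d) * d" by (simp add: algebra_simps power2_eq_square)
        also have "\<dots> \<le> d / 4 + 1 / 4 * d"
          using Cd Ce[OF e] d by (intro add_mono mult_right_mono) auto
        also have "\<dots> \<le> d" using d by simp
        finally show "F e (x, q) \<in> cball 0 d" by simp
      qed
      show "dist (F e (x, q)) (F e (x', q)) \<le> 1 / 2 * dist x x'"
        if "x \<in> cball 0 d" "x' \<in> cball 0 d" for x x'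
        using lip[of x x' q q] that q by simp
      show "cball (0::'x) d \<noteq> {}" using d by auto
    qed auto
    then obtain y where y: "\<And>q. q \<in> Q \<Longrightarrow> norm (y q) \<le> d \<and> F e (y q, q) = y q \<and>
        (\<forall>z. norm z \<le> d \<and> F e (z, q) = z \<longrightarrow> z = y q)"
      unfolding mem_cball_0 by metis
    have "dist (y q) (y q') \<le> dist q q'" if "q \<in> Q" "q' \<in> Q" for q q'
      using lip[of "y q" "y q'" q q'] y[OF that(1)] y[OF that(2)] that by simp
    with y show ?thesis by blast
  qed
  ultimately show ?thesis using d by blast
qed

section \<open>Fourier modes on the unit interval\<close>

type_synonym cc = "complex \<times> complex"

text \<open>Complex scalars acting on \<open>cc\<close>, which otherwise serves as a real inner
  product space. The gauge group acts by \<open>cm (cis \<theta>)\<close>, with generator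
  \<open>cm \<i>\<close>.\<close>

definition cm :: "complex \<Rightarrow> cc \<Rightarrow> cc" where
  "cm c x = (c * fst x, c * snd x)"

lemma norm_cm [simp]: "norm (cm c x) = cmod c * norm x"
  by (cases x) (simp add: cm_def norm_Pair norm_mult power_mult_distrib real_sqrt_mult
      flip: distrib_left)

lemma bounded_bilinear_cm: "bounded_bilinear cm"
proof
  show "\<exists>K. \<forall>a b. norm (cm a b) \<le> norm a * norm b * K" by (rule exI[of _ 1]) simp
qed (auto simp: cm_def algebra_simps plus_prod_def scaleR_prod_def)

interpretation cm: bounded_bilinear cm by (rule bounded_bilinear_cm)

declare cm.zero_left [simp] cm.zero_right [simp]

lemma cm_cm [simp]: "cm c (cm d x) = cm (c * d) x"
  and cm_1 [simp]: "cm 1 x = x"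
  and cm_of_real: "cm (of_real r) x = r *\<^sub>R x"
  by (auto simp: cm_def mult_ac scaleR_prod_def scaleR_conv_of_real prod_eq_iff)

lemma inner_cm_left: "inner (cm c x) y = inner x (cm (cnj c) y)"
  by (simp add: cm_def inner_prod_def inner_complex_def algebra_simps)

lemma inner_i_self [simp]: "inner x (cm \<i> x) = 0" "inner (cm \<i> x) x = 0"
  by (simp_all add: cm_def inner_prod_def inner_complex_def algebra_simps)

lemma inner_i_swap: "inner (cm \<i> x) y = - inner x (cm \<i> y)"
  by (simp add: cm_def inner_prod_def inner_complex_def algebra_simps)

lemma bounded_bilinear_linear_compose:
  assumes "bounded_linear L" "bounded_bilinear prd"
  shows "bounded_bilinear (\<lambda>x y. L (prd x y))"
proof -
  interpret L: bounded_linear L by fact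
  interpret bounded_bilinear prd by fact
  obtain KL where KL: "KL \<ge> 0" "\<And>x. norm (L x) \<le> norm x * KL" using L.nonneg_bounded by blast
  obtain KB where KB: "\<And>x y. norm (prd x y) \<le> norm x * norm y * KB" using bounded by blast
  show ?thesis
  proof
    have "norm (L (prd x y)) \<le> norm x * norm y * (KB * KL)" for x y
      using order_trans[OF KL(2) mult_right_mono[OF KB KL(1)]] by (simp add: mult.assoc)
    then show "\<exists>K. \<forall>a b. norm (L (prd a b)) \<le> norm a * norm b * K" by blast
  qed (simp_all add: add_left add_right scaleR_left scaleR_right L.add L.scaleR)
qed

abbreviation mulc :: "(real \<Rightarrow>\<^sub>C complex) \<Rightarrow> (real \<Rightarrow>\<^sub>C cc) \<Rightarrow> real \<Rightarrow>\<^sub>C cc" where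
  "mulc \<equiv> lift2 cm"

lemma mulc_apply: "0 \<le> s \<Longrightarrow> s \<le> 1 \<Longrightarrow> mulc c f s = cm (c s) (f s)"
  by (simp add: lift2_apply[OF bounded_bilinear_cm])

definition cmul :: "complex \<Rightarrow> (real \<Rightarrow>\<^sub>C cc) \<Rightarrow> real \<Rightarrow>\<^sub>C cc" where
  "cmul c f = mulc (const_bcontfun c) f"

lemma cmul_apply: "0 \<le> s \<Longrightarrow> s \<le> 1 \<Longrightarrow> cmul c f s = cm c (f s)"
  by (simp add: cmul_def mulc_apply)

lemma bounded_linear_mulc: "bounded_linear (mulc c)"
  by (rule bounded_bilinear.bounded_linear_right[OF bounded_bilinear_lift2[OF bounded_bilinear_cm]])

lemma bounded_linear_cmul: "bounded_linear (cmul c)"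
  unfolding cmul_def[abs_def] by (rule bounded_linear_mulc)

definition l2_inner :: "(real \<Rightarrow>\<^sub>C 'a::euclidean_space) \<Rightarrow> (real \<Rightarrow>\<^sub>C 'a) \<Rightarrow> real" where
  "l2_inner f g = unit_integral (lift2 inner f g)"

lemma bounded_bilinear_l2_inner: "bounded_bilinear l2_inner"
  unfolding l2_inner_def[abs_def]
  by (rule bounded_bilinear_linear_compose[OF bounded_linear_unit_integral bounded_bilinear_lift2[OF bounded_bilinear_inner]])

lemma l2_inner_eq: "l2_inner (f :: real \<Rightarrow>\<^sub>C 'a::euclidean_space) g = integral {0..1} (\<lambda>s. f s \<bullet> g s)"
  unfolding l2_inner_def unit_integral_def by (rule integral_cong) (simp add: lift2_apply[OF bounded_bilinear_inner])

interpretation l2_inner: bounded_bilinear "l2_inner :: (real \<Rightarrow>\<^sub>C 'a::euclidean_space) \<Rightarrow> _" by (rule bounded_bilinear_l2_inner)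

lemma l2_inner_commute: "l2_inner f g = l2_inner g f"
  by (simp add: l2_inner_eq inner_commute)

lemma l2_inner_cong:
  fixes f g f' g' :: "real \<Rightarrow>\<^sub>C 'a::euclidean_space"
  assumes "\<And>s. 0 \<le> s \<Longrightarrow> s \<le> 1 \<Longrightarrow> f s = f' s" "\<And>s. 0 \<le> s \<Longrightarrow> s \<le> 1 \<Longrightarrow> g s = g' s"
  shows "l2_inner f g = l2_inner f' g'"
  unfolding l2_inner_eq by (rule integral_cong) (simp add: assms)

lemma unit_integral_cong:
  fixes f f' :: "real \<Rightarrow>\<^sub>C 'a::banach"
  assumes "\<And>s. 0 \<le> s \<Longrightarrow> s \<le> 1 \<Longrightarrow> f s = f' s"
  shows "unit_integral f = unit_integral f'"
  unfolding unit_integral_def by (rule integral_cong) (simp add: assms)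

lemma l2_inner_cmul_i: "l2_inner (cmul \<i> f) g = - l2_inner f (cmul \<i> g)"
proof -
  have "l2_inner (cmul \<i> f) g = integral {0..1} (\<lambda>s. - (f s \<bullet> cmul \<i> g s))"
    unfolding l2_inner_eq by (rule integral_cong) (simp add: cmul_apply inner_i_swap)
  then show ?thesis by (simp add: l2_inner_eq)
qed

text \<open>A relation, not an operator: a derivative is determined on [0,1] only, one-sided at the
  ends, while both arguments live on the whole line.\<close>

definition der :: "(real \<Rightarrow>\<^sub>C 'b::real_normed_vector) \<Rightarrow> (real \<Rightarrow>\<^sub>C 'b) \<Rightarrow> bool" where
  "der x x' \<longleftrightarrow> (\<forall>s\<in>{0..1}. (x has_vector_derivative x' s) (at s within {0..1}))"

lemma der_prim: "der (prim f) f"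
  by (auto simp: der_def intro!: prim_has_vector_derivative)

lemma der_cong:
  fixes x y x' y' :: "real \<Rightarrow>\<^sub>C 'a::real_normed_vector"
  assumes "der x x'" "\<And>s. 0 \<le> s \<Longrightarrow> s \<le> 1 \<Longrightarrow> y s = x s" "\<And>s. 0 \<le> s \<Longrightarrow> s \<le> 1 \<Longrightarrow> y' s = x' s"
  shows "der y y'"
  using assms unfolding der_def
  by (metis atLeastAtMost_iff has_vector_derivative_transform)

lemma der_add: "der x x' \<Longrightarrow> der y y' \<Longrightarrow> der (x + y) (x' + y')"
  unfolding der_def by (simp add: plus_bcontfun.rep_eq[abs_def] has_vector_derivative_add)

lemma der_scaleR: "der x x' \<Longrightarrow> der (r *\<^sub>R x) (r *\<^sub>R x')"
  unfolding der_def
  by (simp add: scaleR_bcontfun.rep_eq[abs_def] bounded_linear.has_vector_derivative[OF bounded_linear_scaleR_right])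

lemma der_diff: "der x x' \<Longrightarrow> der y y' \<Longrightarrow> der (x - y) (x' - y')"
  using der_add[of x x' "(-1) *\<^sub>R y" "(-1) *\<^sub>R y'"] der_scaleR[of y y' "-1"] by simp

lemma der_lift2:
  assumes "bounded_bilinear prd" "der x x'" "der y y'"
  shows "der (lift2 prd x y) (lift2 prd x y' + lift2 prd x' y)"
  unfolding der_def
proof safe
  fix s :: real assume s: "s \<in> {0..1}"
  have "((\<lambda>s. prd (x s) (y s)) has_vector_derivative prd (x s) (y' s) + prd (x' s) (y s)) (at s within {0..1})"
    using assms s by (intro bounded_bilinear.has_vector_derivative[OF assms(1)]) (auto simp: der_def)
  then show "(lift2 prd x y has_vector_derivative (lift2 prd x y' + lift2 prd x' y) s) (at s within {0..1})"
    using s by (elim has_vector_derivative_transform[OF s, rotated, THEN has_vector_derivative_eq_rhs])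
      (auto simp: lift2_apply[OF assms(1)])
qed

lemma der_cmul:
  assumes "der x x'"
  shows "der (cmul c x) (cmul c x')"
proof -
  have "der (const_bcontfun c) 0" by (auto simp: der_def)
  from der_lift2[OF bounded_bilinear_cm this assms] show ?thesis
    unfolding cmul_def by (rule der_cong) (auto simp: lift2_apply[OF bounded_bilinear_cm])
qed

lemma unit_integral_der:
  fixes x :: "real \<Rightarrow>\<^sub>C 'a::banach"
  shows "der x x' \<Longrightarrow> unit_integral x' = x 1 - x 0"
  using fundamental_theorem_of_calculus[of 0 1 x x']
  by (auto simp: der_def unit_integral_def integral_unique)

lemma der_by_parts:
  fixes x :: "real \<Rightarrow>\<^sub>C 'a::real_normed_vector" and y :: "real \<Rightarrow>\<^sub>C 'b::real_normed_vector"
    and prd :: "'a \<Rightarrow> 'b \<Rightarrow> 'c::banach"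
  assumes "bounded_bilinear prd" "der x x'" "der y y'"
  shows "unit_integral (lift2 prd x' y) = prd (x 1) (y 1) - prd (x 0) (y 0) - unit_integral (lift2 prd x y')"
  using unit_integral_der[OF der_lift2[OF assms]]
  by (simp add: lift2_apply[OF assms(1)] linear_add[OF bounded_linear.linear[OF bounded_linear_unit_integral]] algebra_simps)

lemma l2_inner_by_parts:
  fixes x y :: "real \<Rightarrow>\<^sub>C 'a::euclidean_space"
  assumes "der x x'" "der y y'" "x 0 = x 1" "y 0 = y 1"
  shows "l2_inner x' y = - l2_inner x y'"
  using der_by_parts[OF bounded_bilinear_inner assms(1,2)] assms(3,4) by (simp add: l2_inner_def)

section \<open>Resonant modes and the oscillator equation\<close>

locale frequency =
  fixes om :: real
  assumes om: "om > 0" "cis om = 1"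
begin

definition ep :: "real \<Rightarrow>\<^sub>C complex" where "ep = bcont01 (\<lambda>s. cis (om * s))"
definition em :: "real \<Rightarrow>\<^sub>C complex" where "em = bcont01 (\<lambda>s. cis (- (om * s)))"

lemma ep_apply: "0 \<le> s \<Longrightarrow> s \<le> 1 \<Longrightarrow> ep s = cis (om * s)"
  and em_apply: "0 \<le> s \<Longrightarrow> s \<le> 1 \<Longrightarrow> em s = cis (- (om * s))"
  unfolding ep_def em_def by (subst bcont01_apply; auto intro!: continuous_intros)+

lemma cis_neg_om: "cis (- om) = 1"
  using om(2) by (metis cis_cnj complex_cnj_one)

lemma cis_prod [simp]: "cis (om * s) * cis (- (om * s)) = 1" "cis (- (om * s)) * cis (om * s) = 1"
  by (simp_all add: cis_mult)

lemma der_ep: "der ep (bcont01 (\<lambda>s. \<i> * of_real om * cis (om * s)))"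
  and der_em: "der em (bcont01 (\<lambda>s. - \<i> * of_real om * cis (- (om * s))))"
proof -
  have "((\<lambda>s. cis (r * s)) has_vector_derivative \<i> * of_real r * cis (r * s)) (at s within {0..1})" for r s
    unfolding has_vector_derivative_def
    by (auto intro!: derivative_eq_intros simp: scaleR_conv_of_real mult_ac)
  note d = this
  have c: "continuous_on {0..1} (\<lambda>s. c * cis (r * s))" for c r by (intro continuous_intros)
  show "der ep (bcont01 (\<lambda>s. \<i> * of_real om * cis (om * s)))"
    unfolding der_def
  proof
    fix s :: real assume s: "s \<in> {0..1}"
    show "(ep has_vector_derivative bcont01 (\<lambda>s. \<i> * of_real om * cis (om * s)) s) (at s within {0..1})"
      by (rule has_vector_derivative_transform[OF s _ has_vector_derivative_eq_rhs[OF d[of om]]])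
         (use s in \<open>auto simp: ep_apply bcont01_apply[OF c]\<close>)
  qed
  show "der em (bcont01 (\<lambda>s. - \<i> * of_real om * cis (- (om * s))))"
    unfolding der_def
  proof
    fix s :: real assume s: "s \<in> {0..1}"
    have "bcont01 (\<lambda>s. - \<i> * of_real om * cis (- (om * s))) s = \<i> * of_real (- om) * cis (- om * s)"
      using s c[of "- \<i> * of_real om" "- om"] by (subst bcont01_apply) auto
    then show "(em has_vector_derivative bcont01 (\<lambda>s. - \<i> * of_real om * cis (- (om * s))) s) (at s within {0..1})"
      using s d[of "- om" s] by (auto simp: em_apply intro: has_vector_derivative_transform[OF s])
  qed
qed

definition Ep :: "cc \<Rightarrow> real \<Rightarrow>\<^sub>C cc" where "Ep A = mulc ep (const_bcontfun A)"
definition Em :: "cc \<Rightarrow> real \<Rightarrow>\<^sub>C cc" where "Em A = mulc em (const_bcontfun A)"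

lemma Ep_apply: "0 \<le> s \<Longrightarrow> s \<le> 1 \<Longrightarrow> Ep A s = cm (cis (om * s)) A"
  and Em_apply: "0 \<le> s \<Longrightarrow> s \<le> 1 \<Longrightarrow> Em A s = cm (cis (- (om * s))) A"
  by (simp_all add: Ep_def Em_def mulc_apply ep_apply em_apply)

lemma bounded_linear_Ep: "bounded_linear Ep"
  and bounded_linear_Em: "bounded_linear Em"
  unfolding Ep_def[abs_def] Em_def[abs_def]
  by (intro bounded_linear_compose[OF bounded_linear_mulc] bounded_linear_const_bcontfun)+

interpretation Ep: bounded_linear Ep by (rule bounded_linear_Ep)
interpretation Em: bounded_linear Em by (rule bounded_linear_Em)

lemma der_Ep: "der (Ep A) (cmul (\<i> * of_real om) (Ep A))"
  and der_Em: "der (Em A) (cmul (- \<i> * of_real om) (Em A))"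
proof -
  have c: "der (const_bcontfun A) 0" by (auto simp: der_def)
  show "der (Ep A) (cmul (\<i> * of_real om) (Ep A))"
    unfolding Ep_def using der_lift2[OF bounded_bilinear_cm der_ep c]
    by (rule der_cong) (auto simp: lift2_apply[OF bounded_bilinear_cm] cmul_apply bcont01_apply continuous_intros ep_apply)
  show "der (Em A) (cmul (- \<i> * of_real om) (Em A))"
    unfolding Em_def using der_lift2[OF bounded_bilinear_cm der_em c]
    by (rule der_cong) (auto simp: lift2_apply[OF bounded_bilinear_cm] cmul_apply bcont01_apply continuous_intros em_apply)
qed

text \<open>Vector-valued Fourier coefficients: \<open>cfp\<close> belongs to the mode
  \<open>Ep\<close>, hence the conjugate kernel \<open>em\<close>, and \<open>cfm\<close> to the
  mode \<open>Em\<close>.\<close>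

definition cfp :: "(real \<Rightarrow>\<^sub>C cc) \<Rightarrow> cc" where "cfp g = unit_integral (mulc em g)"
definition cfm :: "(real \<Rightarrow>\<^sub>C cc) \<Rightarrow> cc" where "cfm g = unit_integral (mulc ep g)"

lemma bounded_linear_cfp: "bounded_linear cfp"
  and bounded_linear_cfm: "bounded_linear cfm"
  unfolding cfp_def[abs_def] cfm_def[abs_def]
  by (intro bounded_linear_compose[OF bounded_linear_unit_integral] bounded_linear_mulc)+

interpretation cfp: bounded_linear cfp by (rule bounded_linear_cfp)
interpretation cfm: bounded_linear cfm by (rule bounded_linear_cfm)

lemma cfp_der:
  fixes x x' :: "real \<Rightarrow>\<^sub>C cc"
  assumes "der x x'" "x 0 = x 1"
  shows "cfp x' = cm (\<i> * of_real om) (cfp x)"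
    and "cfm x' = cm (- \<i> * of_real om) (cfm x)"
proof -
  have L: "bounded_linear (cm c)" for c by (rule cm.bounded_linear_right)
  have *: "unit_integral (mulc (bcont01 (\<lambda>s. c * g s)) x) = cm c (unit_integral (mulc G x))"
    if "continuous_on {0..1} g" "\<And>s. 0 \<le> s \<Longrightarrow> s \<le> 1 \<Longrightarrow> G s = g s" for c g and G :: "real \<Rightarrow>\<^sub>C complex"
  proof -
    have "continuous_on {0..1} (\<lambda>s. c * g s)" using that(1) by (intro continuous_intros)
    then have "unit_integral (mulc (bcont01 (\<lambda>s. c * g s)) x) = integral {0..1} (\<lambda>s. cm c (mulc G x s))"
      unfolding unit_integral_def by (intro integral_cong) (auto simp: mulc_apply bcont01_apply that(2))
    also have "\<dots> = cm c (unit_integral (mulc G x))"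
      unfolding unit_integral_def by (rule integral_linear[OF _ L, unfolded o_def]) simp
    finally show ?thesis .
  qed
  have ends: "em 1 = 1" "em 0 = 1" "ep 1 = 1" "ep 0 = 1"
    by (simp_all add: em_apply ep_apply om(2) cis_neg_om)
  have "unit_integral (mulc (bcont01 (\<lambda>s. - \<i> * of_real om * cis (- (om * s)))) x) = cm (- \<i> * of_real om) (cfp x)"
    unfolding cfp_def by (rule *) (auto intro!: continuous_intros simp: em_apply)
  with der_by_parts[OF bounded_bilinear_cm der_em assms(1)]
  show "cfp x' = cm (\<i> * of_real om) (cfp x)"
    by (simp add: cfp_def assms(2) ends cm.minus_left)
  have "unit_integral (mulc (bcont01 (\<lambda>s. \<i> * of_real om * cis (om * s))) x) = cm (\<i> * of_real om) (cfm x)"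
    unfolding cfm_def by (rule *) (auto intro!: continuous_intros simp: ep_apply)
  with der_by_parts[OF bounded_bilinear_cm der_ep assms(1)]
  show "cfm x' = cm (- \<i> * of_real om) (cfm x)"
    by (simp add: cfm_def assms(2) ends cm.minus_left)
qed

lemma cfp_Ep [simp]: "cfp (Ep A) = A" and cfm_Em [simp]: "cfm (Em A) = A"
proof -
  have "cfp (Ep A) = unit_integral (const_bcontfun A)" "cfm (Em A) = unit_integral (const_bcontfun A)"
    unfolding cfp_def cfm_def
    by (rule unit_integral_cong; simp add: mulc_apply Ep_apply Em_apply ep_apply em_apply)+
  then show "cfp (Ep A) = A" "cfm (Em A) = A" by (simp_all add: unit_integral_def)
qed

lemma cfp_cmul: "cfp (cmul c x) = cm c (cfp x)" and cfm_cmul: "cfm (cmul c x) = cm c (cfm x)"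
proof -
  have L: "bounded_linear (cm c)" by (rule cm.bounded_linear_right)
  have "unit_integral (mulc g (cmul c x)) = cm c (unit_integral (mulc g x))" for g
  proof -
    have "unit_integral (mulc g (cmul c x)) = integral {0..1} (\<lambda>s. cm c (mulc g x s))"
      unfolding unit_integral_def by (intro integral_cong) (auto simp: mulc_apply cmul_apply mult.commute)
    also have "\<dots> = cm c (unit_integral (mulc g x))"
      unfolding unit_integral_def by (rule integral_linear[OF _ L, unfolded o_def]) simp
    finally show ?thesis .
  qed
  then show "cfp (cmul c x) = cm c (cfp x)" "cfm (cmul c x) = cm c (cfm x)"
    by (simp_all add: cfp_def cfm_def)
qed

lemma Ep_ends: "Ep A 0 = A" "Ep A 1 = A" "Em A 0 = A" "Em A 1 = A"
  by (simp_all add: Ep_apply Em_apply om(2) cis_neg_om)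

text \<open>The coefficient of the derivative of \<open>Em A\<close> is computed once from the
  explicit derivative and once by parts; the results differ by a factor -1, so they vanish.\<close>

lemma cfp_Em [simp]: "cfp (Em A) = 0" and cfm_Ep [simp]: "cfm (Ep A) = 0"
proof -
  have c: "(\<i> * of_real om) * 2 \<noteq> (0::complex)" using om by auto
  have "cm (- \<i> * of_real om) (cfp (Em A)) = cm (\<i> * of_real om) (cfp (Em A))"
    using cfp_der(1)[OF der_Em[of A]] Ep_ends by (simp add: cfp_cmul)
  then have "cm (\<i> * of_real om * 2) (cfp (Em A)) = 0"
    by (simp add: cm_def algebra_simps prod_eq_iff)
  with c show "cfp (Em A) = 0" by (metis norm_cm norm_eq_zero mult_eq_0_iff)
  have "cm (\<i> * of_real om) (cfm (Ep A)) = cm (- \<i> * of_real om) (cfm (Ep A))"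
    using cfp_der(2)[OF der_Ep[of A]] Ep_ends by (simp add: cfm_cmul)
  then have "cm (\<i> * of_real om * 2) (cfm (Ep A)) = 0"
    by (simp add: cm_def algebra_simps prod_eq_iff)
  with c show "cfm (Ep A) = 0" by (metis norm_cm norm_eq_zero mult_eq_0_iff)
qed

text \<open>Adjointness of \<open>Ep\<close> with \<open>cfp\<close> and of \<open>Em\<close> with
  \<open>cfm\<close>; it reduces L^2 products with resonant loops to products in C^2.\<close>

lemma l2_inner_Ep: "l2_inner (Ep A) g = inner A (cfp g)" and l2_inner_Em: "l2_inner (Em A) g = inner A (cfm g)"
proof -
  have "l2_inner (Ep A) g = integral {0..1} (\<lambda>s. inner A (mulc em g s))"
    "l2_inner (Em A) g = integral {0..1} (\<lambda>s. inner A (mulc ep g s))"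
    unfolding l2_inner_eq by (rule integral_cong; simp add: Ep_apply Em_apply mulc_apply inner_cm_left cis_cnj em_apply ep_apply)+
  moreover have "integral {0..1} (\<lambda>s. inner A (h s)) = inner A (unit_integral h)" for h :: "real \<Rightarrow>\<^sub>C cc"
    unfolding unit_integral_def by (rule integral_linear[OF _ bounded_linear_inner_right, unfolded o_def]) simp
  ultimately show "l2_inner (Ep A) g = inner A (cfp g)" "l2_inner (Em A) g = inner A (cfm g)"
    by (simp_all add: cfp_def cfm_def)
qed

text \<open>Variation of constants for \<open>w'' + \<omega>\<^sup>2 w = f\<close>, made orthogonal to both modes.\<close>

definition K0 :: "(real \<Rightarrow>\<^sub>C cc) \<Rightarrow> real \<Rightarrow>\<^sub>C cc" where
  "K0 f = cmul (- \<i> / (2 * of_real om)) (mulc ep (prim (mulc em f)) - mulc em (prim (mulc ep f)))"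
definition K0d :: "(real \<Rightarrow>\<^sub>C cc) \<Rightarrow> real \<Rightarrow>\<^sub>C cc" where
  "K0d f = (1/2) *\<^sub>R (mulc ep (prim (mulc em f)) + mulc em (prim (mulc ep f)))"
definition K :: "(real \<Rightarrow>\<^sub>C cc) \<Rightarrow> real \<Rightarrow>\<^sub>C cc" where
  "K f = K0 f - Ep (cfp (K0 f)) - Em (cfm (K0 f))"
definition Kd :: "(real \<Rightarrow>\<^sub>C cc) \<Rightarrow> real \<Rightarrow>\<^sub>C cc" where
  "Kd f = K0d f - cmul (\<i> * of_real om) (Ep (cfp (K0 f))) - cmul (- \<i> * of_real om) (Em (cfm (K0 f)))"

lemma bounded_linear_K0: "bounded_linear K0" and bounded_linear_K0d: "bounded_linear K0d"
  unfolding K0_def[abs_def] K0d_def[abs_def]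
  by (intro bounded_linear_compose[OF bounded_linear_cmul] bounded_linear_compose[OF bounded_linear_mulc]
      bounded_linear_compose[OF bounded_linear_prim] bounded_linear_sub bounded_linear_add bounded_linear_mulc
      bounded_linear_compose[OF bounded_linear_scaleR_right])+

lemma bounded_linear_K: "bounded_linear K" and bounded_linear_Kd: "bounded_linear Kd"
  unfolding K_def[abs_def] Kd_def[abs_def]
  by (intro bounded_linear_compose[OF bounded_linear_cmul] bounded_linear_compose[OF bounded_linear_Ep]
      bounded_linear_compose[OF bounded_linear_Em] bounded_linear_compose[OF bounded_linear_cfp]
      bounded_linear_compose[OF bounded_linear_cfm] bounded_linear_sub bounded_linear_K0 bounded_linear_K0d)+

lemma cf_K [simp]: "cfp (K f) = 0" "cfm (K f) = 0"
  by (simp_all add: K_def cfp.diff cfm.diff)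

lemma der_K0: "der (K0 f) (K0d f)" "der (K0d f) (f - om\<^sup>2 *\<^sub>R K0 f)"
proof -
  note d1 = der_lift2[OF bounded_bilinear_cm der_ep der_prim[of "mulc em f"]]
  note d2 = der_lift2[OF bounded_bilinear_cm der_em der_prim[of "mulc ep f"]]
  have c: "cis (om * s) * (cis (- (om * s)) * z) = z" "cis (- (om * s)) * (cis (om * s) * z) = z" for s z
    by (simp_all flip: mult.assoc)
  have nz: "om \<noteq> 0" using om by simp
  show "der (K0 f) (K0d f)"
    unfolding K0_def using der_cmul[OF der_diff[OF d1 d2], of "- \<i> / (2 * of_real om)"]
    by (rule der_cong)
       (auto simp: K0d_def mulc_apply cmul_apply ep_apply em_apply bcont01_apply continuous_intros cm_def prod_eq_iff
         scaleR_conv_of_real c nz field_simps)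
  show "der (K0d f) (f - om\<^sup>2 *\<^sub>R K0 f)"
    unfolding K0d_def using der_scaleR[OF der_add[OF d1 d2], of "1/2"]
  proof (rule der_cong)
    fix s :: real assume s: "0 \<le> s" "s \<le> 1"
    have "f s - om\<^sup>2 *\<^sub>R cm (- \<i> / (2 * of_real om)) (cm E a - cm e b) =
        (1/2) *\<^sub>R (f s + cm (\<i> * of_real om * E) a + (f s + cm (- \<i> * of_real om * e) b))" for a b E e
      by (auto simp: cm_def prod_eq_iff scaleR_conv_of_real nz power2_eq_square field_simps)
    then show "(f - om\<^sup>2 *\<^sub>R K0 f) s = ((1/2) *\<^sub>R (mulc ep (mulc em f) +
        mulc (bcont01 (\<lambda>s. \<i> * of_real om * cis (om * s))) (prim (mulc em f)) + (mulc em (mulc ep f) +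
        mulc (bcont01 (\<lambda>s. - \<i> * of_real om * cis (- (om * s)))) (prim (mulc ep f))))) s"
      using s by (simp add: K0_def mulc_apply cmul_apply ep_apply em_apply bcont01_apply continuous_intros)
  qed simp
qed

lemma der_K: "der (K f) (Kd f)" "der (Kd f) (f - om\<^sup>2 *\<^sub>R K f)"
proof -
  show "der (K f) (Kd f)"
    unfolding K_def Kd_def by (intro der_diff der_K0 der_Ep der_Em)
  have "der (Kd f) (f - om\<^sup>2 *\<^sub>R K0 f - cmul (\<i> * of_real om) (cmul (\<i> * of_real om) (Ep (cfp (K0 f))))
     - cmul (- \<i> * of_real om) (cmul (- \<i> * of_real om) (Em (cfm (K0 f)))))"
    unfolding Kd_def by (intro der_diff der_K0 der_cmul der_Ep der_Em)
  then show "der (Kd f) (f - om\<^sup>2 *\<^sub>R K f)"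
    by (rule der_cong)
       (auto simp: K_def cmul_apply Ep_apply Em_apply cm_def prod_eq_iff scaleR_conv_of_real
         power2_eq_square algebra_simps)
qed

text \<open>Fredholm alternative: at s = 1 the two primitives in \<open>K0 f\<close> are the
  coefficients of \<open>f\<close>. Since \<open>K\<close> is applied to arbitrary \<open>f\<close>,
  a general point of the ball encodes a loop that need not close up; at a fixed point it does,
  because there \<open>f\<close> lies in the range of \<open>PW\<close>.\<close>

lemma K_periodic:
  assumes "cfp f = 0" "cfm f = 0"
  shows "K f 0 = K f 1" "Kd f 0 = Kd f 1"
proof -
  have p: "prim g 0 = 0" "prim g 1 = unit_integral g" for g :: "real \<Rightarrow>\<^sub>C cc"
    by (simp_all add: prim_apply unit_integral_def)
  have "K0 f 0 = 0" "K0 f 1 = 0" "K0d f 0 = 0" "K0d f 1 = 0"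
    using assms by (simp_all add: K0_def K0d_def cmul_apply mulc_apply p cm.zero_right cfp_def cfm_def)
  then show "K f 0 = K f 1" "Kd f 0 = Kd f 1"
    by (simp_all add: K_def Kd_def cmul_apply Ep_ends)
qed

end

section \<open>The Lyapunov--Schmidt fixed point problem\<close>

type_synonym unk = "(real \<Rightarrow>\<^sub>C cc) \<times> real \<times> real"
type_synonym par = "cc \<times> cc \<times> real"

text \<open>The set \<open>I\<close> will be [0,1], one period of the initial time, over which the
  action is maximized, or [-1,2], which leaves room to move the initial time of a maximum both
  ways.\<close>

definition params :: "real set \<Rightarrow> par set" where
  "params I = sphere 0 1 \<times> sphere 0 1 \<times> I"

text \<open>Bounds and Lipschitz estimates are global, as superposition operators require; the
  derivative is demanded only for |x| < 2, where all loops of the construction stay.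
  \<open>P_gauge\<close> is infinitesimal invariance under the gauge group.\<close>

locale perturbation = frequency +
  fixes e1 M :: real and P Pt :: "real \<Rightarrow> real \<Rightarrow> cc \<Rightarrow> real" and Px :: "real \<Rightarrow> real \<Rightarrow> cc \<Rightarrow> cc"
  assumes e1: "0 < e1" "e1 \<le> 1"
    and P_bound: "\<And>e t x. 0 < e \<Longrightarrow> e < e1 \<Longrightarrow> norm (P e t x) \<le> M"
      "\<And>e t x. 0 < e \<Longrightarrow> e < e1 \<Longrightarrow> norm (Pt e t x) \<le> M"
      "\<And>e t x. 0 < e \<Longrightarrow> e < e1 \<Longrightarrow> norm (Px e t x) \<le> M"
    and P_lip: "\<And>e t x t' x'. 0 < e \<Longrightarrow> e < e1 \<Longrightarrow> norm (P e t x - P e t' x') \<le> M * (norm (t - t') + norm (x - x'))"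
      "\<And>e t x t' x'. 0 < e \<Longrightarrow> e < e1 \<Longrightarrow> norm (Pt e t x - Pt e t' x') \<le> M * (norm (t - t') + norm (x - x'))"
      "\<And>e t x t' x'. 0 < e \<Longrightarrow> e < e1 \<Longrightarrow> norm (Px e t x - Px e t' x') \<le> M * (norm (t - t') + norm (x - x'))"
    and P_periodic: "\<And>e t x. 0 < e \<Longrightarrow> e < e1 \<Longrightarrow> P e (t + 1) x = P e t x"
      "\<And>e t x. 0 < e \<Longrightarrow> e < e1 \<Longrightarrow> Pt e (t + 1) x = Pt e t x"
      "\<And>e t x. 0 < e \<Longrightarrow> e < e1 \<Longrightarrow> Px e (t + 1) x = Px e t x"
    and P_derivative: "\<And>e t x. 0 < e \<Longrightarrow> e < e1 \<Longrightarrow> norm x < 2 \<Longrightarrow>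
      ((\<lambda>(t, x). P e t x) has_derivative (\<lambda>(s, h). Pt e t x * s + inner (Px e t x) h)) (at (t, x))"
    and P_gauge: "\<And>e t x. 0 < e \<Longrightarrow> e < e1 \<Longrightarrow> norm x < 2 \<Longrightarrow> inner (Px e t x) (cm \<i> x) = 0"
begin

text \<open>As \<open>sq\<close> lies between 7/10 and 71/100, changes by 1/20 keep the radii
  between 13/20 and 19/25. Together with |K f| <= 1/20 this bounds the loop by 157/100 < 2 and gives
  b > 1/2.\<close>

definition d0 :: real where "d0 = min (1/20) (1 / (20 * (onorm K + 1)))"

lemma d0: "0 < d0" "d0 \<le> 1" "d0 \<le> 1/20" and K_d0: "norm f \<le> d0 \<Longrightarrow> norm (K f) \<le> 1/20"
proof -
  have o: "onorm K \<ge> 0" by (rule onorm_pos_le[OF bounded_linear_K])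
  then show "0 < d0" "d0 \<le> 1" "d0 \<le> 1/20" by (auto simp: d0_def)
  assume f: "norm f \<le> d0"
  have "norm (K f) \<le> onorm K * norm f" by (rule onorm[OF bounded_linear_K])
  also have "\<dots> \<le> onorm K * (1 / (20 * (onorm K + 1)))"
    using f o by (intro mult_left_mono) (auto simp: d0_def)
  also have "\<dots> \<le> 1/20" using o by (simp add: field_simps)
  finally show "norm (K f) \<le> 1/20" .
qed

sublocale lf: lip_family e1 d0 "\<lambda>d. cball (0::unk) d \<times> params {-1..2}"
  by standard (use e1 d0 in auto)

abbreviation "bl \<equiv> lf.bl"
abbreviation "o1 \<equiv> lf.o1"
abbreviation "sm \<equiv> lf.sm"

abbreviation (input) "pf \<equiv> (\<lambda>p :: unk \<times> par. fst (fst p))"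
abbreviation (input) "r1 \<equiv> (\<lambda>p :: unk \<times> par. fst (snd (fst p)))"
abbreviation (input) "r2 \<equiv> (\<lambda>p :: unk \<times> par. snd (snd (fst p)))"
abbreviation (input) "pA \<equiv> (\<lambda>p :: unk \<times> par. fst (snd p))"
abbreviation (input) "pB \<equiv> (\<lambda>p :: unk \<times> par. fst (snd (snd p)))"
abbreviation (input) "pt \<equiv> (\<lambda>p :: unk \<times> par. snd (snd (snd p)))"

definition sq :: real where "sq = sqrt (1/2)"

lemma sq: "sq * sq = 1/2" "7/10 \<le> sq" "sq \<le> 71/100"
  unfolding sq_def by (simp, rule real_le_rsqrt, simp add: power2_eq_square)
    (rule real_le_lsqrt; simp add: power2_eq_square)

text \<open>
  A point \<open>p = ((f, r\<^sub>1, r\<^sub>2), (A, B, t\<^sub>0))\<close> encodes the loop \<open>xi p = \<rho>\<^sub>1 e\<^sup>i\<^sup>\<omega>\<^sup>s A + \<rho>\<^sub>2 e\<^sup>-\<^sup>i\<^sup>\<omega>\<^sup>s B + K f\<close>; \<open>tt p\<close> is its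
  physical time \<open>\<tau>\<close> and \<open>\<epsilon> qq\<close> the \<open>L\<^sup>2\<close> gradient of the perturbation term. Half the gradient of the
  action, \<open>- b x'' + (a - 2 \<omega>\<^sup>2 / b\<^sup>2) x + 2 J i x' + (\<epsilon> / 2) qq\<close>, is orthogonal to \<open>e\<^sup>i\<^sup>\<omega>\<^sup>s A\<close> and \<open>e\<^sup>-\<^sup>i\<^sup>\<omega>\<^sup>s B\<close> iff
  \<open>b \<omega>\<^sup>2 + a - 2 \<omega>\<^sup>2 / b\<^sup>2 = N1\<close> and \<open>J = N2\<close>. Inserting these two values into the component orthogonal to
  the modes gives \<open>f = Ff\<close>, and solving them for \<open>\<rho>\<^sub>1\<close> and \<open>\<rho>\<^sub>2\<close> gives \<open>\<rho>\<^sub>i\<^sup>2 = 1/2 + h\<^sub>i\<close>, where the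
  equation \<open>b - 1 / b\<^sup>2 = YY\<close> is written as \<open>3 (b - 1) = YY b\<^sup>2 - 3 (b - 1)\<^sup>2 - (b - 1)\<^sup>3\<close>.
\<close>

definition "rho1 p = sq + r1 p"
definition "rho2 p = sq + r2 p"
definition "zz p = rho1 p *\<^sub>R Ep (pA p) + rho2 p *\<^sub>R Em (pB p)"
definition "zd p = rho1 p *\<^sub>R cmul (\<i> * of_real om) (Ep (pA p)) + rho2 p *\<^sub>R cmul (- \<i> * of_real om) (Em (pB p))"
definition "ww p = K (pf p)"
definition "wd p = Kd (pf p)"
definition "xi p = zz p + ww p"
definition "xd p = zd p + wd p"
definition "bw p = l2_inner (ww p) (ww p)"
definition "aw p = l2_inner (wd p) (wd p)"
definition "jw p = l2_inner (wd p) (cmul \<i> (ww p))"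
definition "bb p = l2_inner (xi p) (xi p)"
definition "beta p = (2 * sq) * (r1 p + r2 p) + (r1 p * r1 p + r2 p * r2 p + bw p)"
definition "tt p = const_bcontfun (pt p) + inverse (bb p) *\<^sub>R prim (lift2 inner (xi p) (xi p))"
definition "Pv e p = bcont01 (\<lambda>s. P e (apply_bcontfun (tt p) s) (apply_bcontfun (xi p) s))"
definition "Ptv e p = bcont01 (\<lambda>s. Pt e (apply_bcontfun (tt p) s) (apply_bcontfun (xi p) s))"
definition "Pxv e p = bcont01 (\<lambda>s. Px e (apply_bcontfun (tt p) s) (apply_bcontfun (xi p) s))"
text \<open>Its value at s is the integral of \<open>Ptv\<close> over [s,1], since changing x at s
  moves the clock at all later times. \<open>c1\<close> and \<open>c2\<close> stem from the factors
  1/b inside the clock and in front of the integral of \<open>P\<close>.\<close>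

definition "RR e p = const_bcontfun (unit_integral (Ptv e p)) - prim (Ptv e p)"
definition "c1 e p = l2_inner (Ptv e p) (tt p - const_bcontfun (pt p))"
definition "c2 e p = unit_integral (Pv e p)"
definition "qq e p = inverse (bb p) *\<^sub>R Pxv e p +
  (2 * (inverse (bb p) * inverse (bb p))) *\<^sub>R lift2 scaleR (RR e p - const_bcontfun (c1 e p + c2 e p)) (xi p)"
text \<open>After division by the radii, the components along the modes read
  \<open>N1 - 2 * om * N2 = - (e/2) * g1\<close> and \<open>N1 + 2 * om * N2 = - (e/2) * g2\<close>.
  Adding and subtracting them gives the constants 1/4 and 1/(8 om).\<close>

definition "g1 e p = inner (cfp (qq e p)) (pA p) * inverse (rho1 p)"
definition "g2 e p = inner (cfm (qq e p)) (pB p) * inverse (rho2 p)"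
definition "N1 e p = e *\<^sub>R ((- 1/4) * (g1 e p + g2 e p))"
definition "N2 e p = e *\<^sub>R ((1 / (8 * om)) * (g1 e p - g2 e p))"
definition "PW g = g - Ep (cfp g) - Em (cfm g)"
definition "Ff e p = inverse (bb p) *\<^sub>R
  PW (N1 e p *\<^sub>R ww p + N2 e p *\<^sub>R cmul (2 * \<i>) (wd p) + e *\<^sub>R ((1/2) *\<^sub>R qq e p))"
text \<open>By orthogonality of the modes, \<open>a = om^2 * (b - bw) + aw\<close> and
  \<open>J = om * (rho1^2 - rho2^2) + jw\<close>. So \<open>YY\<close> is the value demanded of b -
  1/b^2 and \<open>dd\<close> that of \<open>rho1^2 - rho2^2\<close>, while \<open>bh\<close> is the
  resulting b - 1.\<close>

definition "YY e p = (1 / (2 * om\<^sup>2)) * (N1 e p - aw p + om\<^sup>2 * bw p)"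
definition "dd e p = (1 / om) * (N2 e p - jw p)"
definition "bh e p = (1/3) * (YY e p * (bb p * bb p) - 3 * (beta p * beta p) - beta p * (beta p * beta p))"
definition "h1 e p = (1/2) * (bh e p - bw p + dd e p)"
definition "h2 e p = (1/2) * (bh e p - bw p - dd e p)"
definition "Psi e p = (Ff e p, (1 / (2 * sq)) * (h1 e p - r1 p * r1 p), (1 / (2 * sq)) * (h2 e p - r2 p * r2 p))"

section \<open>Orders of the terms in the fixed point map\<close>

lemma bounded_linear_PW: "bounded_linear PW"
  unfolding PW_def[abs_def]
  by (intro bounded_linear_sub bounded_linear_ident bounded_linear_compose[OF bounded_linear_Ep]
      bounded_linear_compose[OF bounded_linear_Em] bounded_linear_cfp bounded_linear_cfm)

lemma dom_simps:
  assumes "p \<in> cball (0::unk) d \<times> params I" "d \<le> d0"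
  shows "norm (pf p) \<le> d" "\<bar>r1 p\<bar> \<le> d" "\<bar>r2 p\<bar> \<le> d" "norm (pA p) = 1" "norm (pB p) = 1" "pt p \<in> I"
    "norm (ww p) \<le> 1/20" "13/20 \<le> rho1 p" "rho1 p \<le> 19/25" "13/20 \<le> rho2 p" "rho2 p \<le> 19/25"
proof -
  obtain f a b A B t where p: "p = ((f, a, b), (A, B, t))" by (metis prod.collapse)
  have "norm (f, a, b) \<le> d" using assms by (auto simp: p)
  moreover have "norm f \<le> norm (f, a, b)" "norm (a, b) \<le> norm (f, a, b)" "\<bar>a\<bar> \<le> norm (a, b)" "\<bar>b\<bar> \<le> norm (a, b)"
    using norm_fst_le[of f "(a, b)"] norm_snd_le[of "(a, b)" f] norm_fst_le[of a b] norm_snd_le[of b a] by auto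
  ultimately have *: "norm f \<le> d" "\<bar>a\<bar> \<le> d" "\<bar>b\<bar> \<le> d" by auto
  then show "norm (pf p) \<le> d" "\<bar>r1 p\<bar> \<le> d" "\<bar>r2 p\<bar> \<le> d" by (auto simp: p)
  show "norm (pA p) = 1" "norm (pB p) = 1" "pt p \<in> I" using assms by (auto simp: p params_def)
  show "norm (ww p) \<le> 1/20" using *(1) assms(2) K_d0[of f] by (simp add: ww_def p)
  show "13/20 \<le> rho1 p" "rho1 p \<le> 19/25" "13/20 \<le> rho2 p" "rho2 p \<le> 19/25"
    using * sq(2,3) assms(2) d0(3) by (auto simp: rho1_def rho2_def p abs_le_iff)
qed

lemma norm_Ep_le: "norm (Ep A) \<le> norm A" and norm_Em_le: "norm (Em A) \<le> norm A"
  unfolding Ep_def Em_def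
  by (rule norm_bound; simp add: lift2_apply[OF bounded_bilinear_cm] ep_apply em_apply)+

lemma xi_bound:
  assumes "p \<in> cball (0::unk) d \<times> params I" "d \<le> d0"
  shows "norm (xi p) \<le> 8/5"
proof -
  note D = dom_simps[OF assms]
  have "norm (xi p) \<le> norm (rho1 p *\<^sub>R Ep (pA p)) + norm (rho2 p *\<^sub>R Em (pB p)) + norm (ww p)"
    unfolding xi_def zz_def by (intro norm_triangle_le add_mono norm_triangle_ineq order_refl)
  also have "\<dots> \<le> 19/25 * 1 + 19/25 * 1 + 1/20"
  proof (intro add_mono D(7))
    show "norm (rho1 p *\<^sub>R Ep (pA p)) \<le> 19/25 * 1" "norm (rho2 p *\<^sub>R Em (pB p)) \<le> 19/25 * 1"
      unfolding norm_scaleR using D(4,5,8-) norm_Ep_le[of "pA p"] norm_Em_le[of "pB p"]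
      by (intro mult_mono; simp add: abs_le_iff)+
  qed
  finally show ?thesis by simp
qed

lemma zz_perp: "cfp g = 0 \<Longrightarrow> cfm g = 0 \<Longrightarrow> l2_inner (zz p) g = 0"
  by (simp add: zz_def l2_inner.add_left l2_inner.scaleR_left l2_inner_Ep l2_inner_Em)

lemma bb_eq:
  assumes "norm (pA p) = 1" "norm (pB p) = 1"
  shows "bb p = rho1 p * rho1 p + rho2 p * rho2 p + bw p"
proof -
  have "l2_inner (zz p) (zz p) = rho1 p * rho1 p + rho2 p * rho2 p"
    using assms by (simp add: zz_def l2_inner.add_left l2_inner.add_right l2_inner.scaleR_left l2_inner.scaleR_right l2_inner_Ep l2_inner_Em
        flip: power2_norm_eq_inner)
  moreover have "l2_inner (zz p) (ww p) = 0" by (rule zz_perp) (simp_all add: ww_def)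
  ultimately show ?thesis
    using l2_inner_commute[of "ww p" "zz p"] by (simp add: bb_def xi_def l2_inner.add_left l2_inner.add_right bw_def)
qed

lemma bb_beta:
  assumes "norm (pA p) = 1" "norm (pB p) = 1"
  shows "bb p = 1 + beta p"
  using sq(1) by (simp add: bb_eq[OF assms] beta_def rho1_def rho2_def algebra_simps)

lemma bw_nonneg: "bw p \<ge> 0"
  unfolding bw_def l2_inner_eq by (rule integral_nonneg) (auto intro!: integrable_continuous_real continuous_intros)

lemma bb_ge:
  assumes "p \<in> cball (0::unk) d \<times> params I" "d \<le> d0"
  shows "1/2 \<le> bb p"
proof -
  note D = dom_simps[OF assms]
  have "13/20 * (13/20) \<le> rho1 p * rho1 p" "13/20 * (13/20) \<le> rho2 p * rho2 p"
    using D(8,10) by (intro mult_mono; simp)+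
  with bw_nonneg[of p] show ?thesis using D by (simp add: bb_eq)
qed

lemma bounded_linear_fst_comp: "bounded_linear L \<Longrightarrow> bounded_linear (\<lambda>x. fst (L x))"
  and bounded_linear_snd_comp: "bounded_linear L \<Longrightarrow> bounded_linear (\<lambda>x. snd (L x))"
  by (rule bounded_linear_compose[OF bounded_linear_fst] bounded_linear_compose[OF bounded_linear_snd]; assumption)+

text \<open>The factor 2 in the bound accommodates the initial time, which ranges over
  [-1,2].\<close>

lemma linear_ol:
  fixes L :: "unk \<times> par \<Rightarrow> 'b::real_normed_vector"
  assumes "bounded_linear L" and nn: "\<And>e d. 0 < e \<Longrightarrow> 0 < d \<Longrightarrow> 0 \<le> m e d"
    and bd: "\<And>e d p. 0 < e \<Longrightarrow> 0 < d \<Longrightarrow> d \<le> d0 \<Longrightarrow> p \<in> cball 0 d \<times> params {-1..2} \<Longrightarrow> norm (L p) \<le> 2 * m e d"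
  shows "lf.ol m (\<lambda>e d. 1) (\<lambda>e. L)"
proof -
  interpret bounded_linear L by fact
  obtain C where C: "C \<ge> 0" "\<And>x. norm (L x) \<le> norm x * C" using nonneg_bounded by blast
  show ?thesis
  proof (rule lf.olI[of "max 2 C"])
    fix e d p q assume *: "0 < e" "e < e1" "0 < d" "d \<le> d0" "p \<in> cball (0::unk) d \<times> params {-1..2}"
    have "2 * m e d \<le> max 2 C * m e d" by (rule mult_right_mono[OF max.cobounded1 nn[OF *(1,3)]])
    with bd[OF *(1,3,4,5)] show "norm (L p) \<le> max 2 C * m e d" by linarith
    have "norm (L (p - q)) \<le> norm (p - q) * C" by (rule C)
    also have "\<dots> \<le> norm (p - q) * max 2 C" by (rule mult_left_mono) auto
    finally show "norm (L p - L q) \<le> max 2 C * 1 * dist p q"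
      by (simp add: diff dist_norm mult.commute)
  qed auto
qed

text \<open>Parameters are merely bounded, unknowns are small on the ball of radius d; this split is
  the source of the later orders.\<close>

lemma proj_lip:
  "bl (\<lambda>e p. pA p)" "bl (\<lambda>e p. pB p)" "bl (\<lambda>e p. pt p)"
  "o1 (\<lambda>e p. pf p)" "o1 (\<lambda>e p. r1 p)" "o1 (\<lambda>e p. r2 p)"
proof -
  note L = bounded_linear_ident[THEN bounded_linear_fst_comp] bounded_linear_ident[THEN bounded_linear_snd_comp]
  note L' = L[THEN bounded_linear_fst_comp] L[THEN bounded_linear_snd_comp]
  note L'' = L'[THEN bounded_linear_snd_comp] L'[THEN bounded_linear_fst_comp]
  show "bl (\<lambda>e p. pA p)" "bl (\<lambda>e p. pB p)"
    by (rule linear_ol; (rule L' L'')?; use dom_simps(4,5) in force)+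
  show "bl (\<lambda>e p. pt p)"
  proof (rule linear_ol)
    show "norm (pt p) \<le> 2 * 1" if "d \<le> d0" "p \<in> cball 0 d \<times> params {-1..2}" for d p
      using dom_simps(6)[OF that(2,1)] by (simp add: abs_le_iff)
  qed (rule L'' | simp)+
  show "o1 (\<lambda>e p. pf p)"
  proof (rule linear_ol)
    show "norm (pf p) \<le> 2 * (e + d)" if "0 < e" "0 < d" "d \<le> d0" "p \<in> cball 0 d \<times> params {-1..2}" for e d p
      using dom_simps(1)[OF that(4,3)] that by simp
  qed (rule L' | simp)+
  show "o1 (\<lambda>e p. r1 p)"
  proof (rule linear_ol)
    show "norm (r1 p) \<le> 2 * (e + d)" if "0 < e" "0 < d" "d \<le> d0" "p \<in> cball 0 d \<times> params {-1..2}" for e d p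
      using dom_simps(2)[OF that(4,3)] that by simp
  qed (rule L'' | simp)+
  show "o1 (\<lambda>e p. r2 p)"
  proof (rule linear_ol)
    show "norm (r2 p) \<le> 2 * (e + d)" if "0 < e" "0 < d" "d \<le> d0" "p \<in> cball 0 d \<times> params {-1..2}" for e d p
      using dom_simps(3)[OF that(4,3)] that by simp
  qed (rule L'' | simp)+
qed

lemmas bl_mult = lf.bl_bilinear[OF bounded_bilinear_mult]
lemmas bl_scaleR = lf.bl_bilinear[OF bounded_bilinear_scaleR]
lemmas bl_inner = lf.bl_bilinear[OF bounded_bilinear_inner]
lemmas cmult_ol = lf.ol_linear[OF bounded_linear_mult_right]

lemma rho_bl: "bl (\<lambda>e. rho1)" "bl (\<lambda>e. rho2)"
  unfolding rho1_def rho2_def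
  by (intro lf.ol_add lf.bl_const lf.o1_bl proj_lip)+

lemma rho_inverse_bl: "bl (\<lambda>e p. inverse (rho1 p))" "bl (\<lambda>e p. inverse (rho2 p))"
  by (rule lf.bl_inverse[OF rho_bl(1), of "13/20"] lf.bl_inverse[OF rho_bl(2), of "13/20"]; use dom_simps in force)+

lemma ww_o1: "o1 (\<lambda>e. ww)" "o1 (\<lambda>e. wd)"
  unfolding ww_def wd_def
  by (intro lf.ol_linear[OF bounded_linear_K] lf.ol_linear[OF bounded_linear_Kd] proj_lip)+

lemma xi_bl: "bl (\<lambda>e. xi)"
  unfolding xi_def zz_def
  by (intro lf.ol_add bl_scaleR rho_bl lf.ol_linear[OF bounded_linear_Ep] lf.ol_linear[OF bounded_linear_Em]
      proj_lip lf.o1_bl[OF ww_o1(1)])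

lemma xd_bl: "bl (\<lambda>e. xd)"
  unfolding xd_def zd_def
  by (intro lf.ol_add bl_scaleR rho_bl lf.ol_linear[OF bounded_linear_Ep] lf.ol_linear[OF bounded_linear_Em]
      lf.ol_linear[OF bounded_linear_cmul] proj_lip lf.o1_bl[OF ww_o1(2)])

lemma w_sm: "sm (\<lambda>e. bw)" "sm (\<lambda>e. aw)" "sm (\<lambda>e. jw)"
  unfolding bw_def aw_def jw_def
  by (intro lf.o1_bilinear[OF bounded_bilinear_l2_inner] ww_o1 lf.ol_linear[OF bounded_linear_cmul])+

lemma r_sm: "sm (\<lambda>e p. r1 p * r1 p)" "sm (\<lambda>e p. r2 p * r2 p)"
  by (intro lf.o1_bilinear[OF bounded_bilinear_mult] proj_lip)+

lemma beta_o1: "o1 (\<lambda>e. beta)"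
  unfolding beta_def
  by (rule lf.ol_add[OF cmult_ol[OF lf.ol_add] lf.sm_o1[OF lf.ol_add[OF lf.ol_add]]]; intro proj_lip r_sm w_sm)

lemma bb_bl: "bl (\<lambda>e. bb)"
  unfolding bb_def by (intro lf.bl_bilinear[OF bounded_bilinear_l2_inner] xi_bl)

lemma bb_inverse_bl: "bl (\<lambda>e p. inverse (bb p))"
  by (rule lf.bl_inverse[OF bb_bl, of "1/2"]) (use bb_ge in auto)

lemma tt_bl: "bl (\<lambda>e. tt)"
  unfolding tt_def
  by (intro lf.ol_add lf.ol_linear[OF bounded_linear_const_bcontfun] proj_lip bl_scaleR bb_inverse_bl
      lf.ol_linear[OF bounded_linear_prim] lf.bl_bilinear[OF bounded_bilinear_lift2[OF bounded_bilinear_inner]] xi_bl)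

lemma Pv_bl: "bl Pv" "bl Ptv" "bl Pxv"
  unfolding Pv_def[abs_def] Ptv_def[abs_def] Pxv_def[abs_def]
  by (rule lf.bl_nemytskii[OF tt_bl xi_bl P_bound(1) P_lip(1)] lf.bl_nemytskii[OF tt_bl xi_bl P_bound(2) P_lip(2)]
      lf.bl_nemytskii[OF tt_bl xi_bl P_bound(3) P_lip(3)]; assumption)+

lemma c_bl: "bl c1" "bl c2"
  unfolding c1_def[abs_def] c2_def[abs_def]
  by (intro lf.bl_bilinear[OF bounded_bilinear_l2_inner] Pv_bl lf.ol_diff tt_bl lf.ol_linear[OF bounded_linear_const_bcontfun]
      proj_lip lf.ol_linear[OF bounded_linear_unit_integral])+

lemma qq_bl: "bl qq"
  unfolding qq_def[abs_def] RR_def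
  by (intro lf.ol_add bl_scaleR bb_inverse_bl Pv_bl cmult_ol bl_mult lf.bl_bilinear[OF bounded_bilinear_lift2[OF bounded_bilinear_scaleR]]
      xi_bl lf.ol_diff lf.ol_linear[OF bounded_linear_const_bcontfun] lf.ol_linear[OF bounded_linear_unit_integral]
      lf.ol_linear[OF bounded_linear_prim] c_bl)

lemma g_bl: "bl g1" "bl g2"
  unfolding g1_def[abs_def] g2_def[abs_def]
  by (intro bl_mult bl_inner lf.ol_linear[OF bounded_linear_cfp] lf.ol_linear[OF bounded_linear_cfm] qq_bl proj_lip
      rho_inverse_bl)+

lemma N_sm: "sm N1" "sm N2"
  unfolding N1_def[abs_def] N2_def[abs_def]
  by (intro lf.sm_eps cmult_ol lf.ol_add lf.ol_diff g_bl)+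

lemma Ff_sm: "sm Ff"
  unfolding Ff_def[abs_def]
  by (intro lf.sm_bilinear_right[OF bounded_bilinear_scaleR] bb_inverse_bl lf.ol_linear[OF bounded_linear_PW] lf.ol_add
      lf.sm_bilinear_left[OF bounded_bilinear_scaleR] N_sm lf.o1_bl ww_o1 lf.ol_linear[OF bounded_linear_cmul]
      lf.sm_eps lf.ol_linear[OF bounded_linear_scaleR_right] qq_bl)

lemma YY_sm: "sm YY" and dd_sm: "sm dd"
  unfolding YY_def[abs_def] dd_def[abs_def]
  by (intro cmult_ol lf.ol_add lf.ol_diff N_sm w_sm)+

lemma bh_sm: "sm bh"
  unfolding bh_def[abs_def]
  by (intro cmult_ol lf.ol_diff lf.sm_bilinear_left[OF bounded_bilinear_mult YY_sm] bl_mult bb_bl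
      lf.o1_bilinear[OF bounded_bilinear_mult] beta_o1 lf.sm_bilinear_right[OF bounded_bilinear_mult lf.o1_bl[OF beta_o1]])

text \<open>Every term carries a factor e or is at least quadratic in the unknowns, because the
  linear terms 3 (b - 1) and \<open>2 * sq * r\<close> have been solved for. That this is possible
  expresses the nondegeneracy of the critical manifold.\<close>

lemma Psi_sm: "sm Psi"
proof -
  have h: "sm h1" "sm h2"
    unfolding h1_def[abs_def] h2_def[abs_def]
    by (intro cmult_ol lf.ol_diff lf.ol_add bh_sm dd_sm w_sm)+
  have L: "bounded_linear (\<lambda>x::real \<Rightarrow>\<^sub>C cc. (x, 0::real, 0::real))" "bounded_linear (\<lambda>x::real. (0::real \<Rightarrow>\<^sub>C cc, x, 0::real))"
    "bounded_linear (\<lambda>x::real. (0::real \<Rightarrow>\<^sub>C cc, 0::real, x))"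
    by (intro bounded_linear_Pair bounded_linear_ident bounded_linear_zero)+
  have "sm (\<lambda>e p. (Ff e p, 0, 0) + (0, (1 / (2 * sq)) * (h1 e p - r1 p * r1 p), 0) +
      (0, 0, (1 / (2 * sq)) * (h2 e p - r2 p * r2 p)))"
    by (intro lf.ol_add lf.ol_linear[OF L(1)] lf.ol_linear[OF L(2)] lf.ol_linear[OF L(3)] Ff_sm cmult_ol lf.ol_diff h r_sm)
  then show ?thesis by (simp add: Psi_def[abs_def])
qed

lemma fixed_point:
  "\<exists>e2>0. e2 \<le> e1 \<and> (\<exists>d>0. d \<le> d0 \<and> (\<forall>e. 0 < e \<and> e < e2 \<longrightarrow> (\<exists>y. \<forall>q\<in>params {-1..2}.
    norm (y q) \<le> d \<and> Psi e (y q, q) = y q \<and> (\<forall>z. norm z \<le> d \<and> Psi e (z, q) = z \<longrightarrow> z = y q) \<and>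
    (\<forall>q'\<in>params {-1..2}. dist (y q) (y q') \<le> dist q q'))))"
  by (rule sm_fixed_point[OF lf.lip_family_axioms Psi_sm])

end

section \<open>The regularized action functional\<close>

lemma has_derivative_quadratic:
  fixes f :: "'a::real_normed_vector \<Rightarrow> 'b::real_normed_vector"
  assumes D: "bounded_linear D" and r: "r > 0"
    and le: "\<And>y. norm (y - x) < r \<Longrightarrow> norm (f y - f x - D (y - x)) \<le> C * (norm (y - x))\<^sup>2"
  shows "(f has_derivative D) (at x)"
  unfolding has_derivative_at_alt
proof (intro conjI D allI impI)
  fix e :: real assume e: "e > 0"
  let ?d = "min r (e / (\<bar>C\<bar> + 1))"
  have "norm (f y - f x - D (y - x)) \<le> e * norm (y - x)" if "norm (y - x) < ?d" for y
  proof -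
    have "norm (f y - f x - D (y - x)) \<le> C * (norm (y - x))\<^sup>2" using that le by simp
    also have "\<dots> \<le> (\<bar>C\<bar> + 1) * (norm (y - x))\<^sup>2" by (intro mult_right_mono) auto
    also have "\<dots> = ((\<bar>C\<bar> + 1) * norm (y - x)) * norm (y - x)" by (simp add: power2_eq_square)
    also have "\<dots> \<le> e * norm (y - x)"
      using that by (intro mult_right_mono) (auto simp: field_simps)
    finally show ?thesis .
  qed
  with e r show "\<exists>d>0. \<forall>y. norm (y - x) < d \<longrightarrow> norm (f y - f x - D (y - x)) \<le> e * norm (y - x)"
    by (intro exI[of _ ?d]) auto
qed

context perturbation
begin

section \<open>Differentiability of the action in the sup norm\<close>

definition NP :: "real \<Rightarrow> (real \<Rightarrow>\<^sub>C real) \<times> (real \<Rightarrow>\<^sub>C cc) \<Rightarrow> real" where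
  "NP e z = unit_integral (bcont01 (\<lambda>s. P e (apply_bcontfun (fst z) s) (apply_bcontfun (snd z) s)))"

lemma lip_continuous:
  fixes g :: "real \<Rightarrow> cc \<Rightarrow> 'b::real_normed_vector"
  assumes "\<And>t x t' x'. norm (g t x - g t' x') \<le> M * (norm (t - t') + norm (x - x'))"
  shows "continuous_on UNIV (\<lambda>(t, x). g t x)"
proof (rule continuous_on_subset[OF lipschitz_on_continuous_on])
  have "M \<ge> 0" using order_trans[OF norm_ge_zero assms[of 0 0 1 0]] by simp
  then show "(2 * M)-lipschitz_on UNIV (\<lambda>(t, x). g t x)"
  proof (intro lipschitz_onI)
    fix z z' :: "real \<times> cc"
    have "norm (fst z - fst z') \<le> dist z z'" "norm (snd z - snd z') \<le> dist z z'"
      using dist_fst_le[of z z'] dist_snd_le[of z z'] by (simp_all add: dist_norm)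
    then have "M * (norm (fst z - fst z') + norm (snd z - snd z')) \<le> M * (dist z z' + dist z z')"
      using \<open>M \<ge> 0\<close> by (intro mult_left_mono add_mono) auto
    with assms[of "fst z" "snd z" "fst z'" "snd z'"]
    show "dist (case z of (t, x) \<Rightarrow> g t x) (case z' of (t, x) \<Rightarrow> g t x) \<le> 2 * M * dist z z'"
      by (simp add: dist_norm case_prod_beta)
  qed simp
qed simp

lemma cont_comp:
  fixes g :: "real \<Rightarrow> cc \<Rightarrow> 'b::real_normed_vector" and u :: "real \<Rightarrow>\<^sub>C real" and v :: "real \<Rightarrow>\<^sub>C cc"
  assumes "\<And>t x t' x'. norm (g t x - g t' x') \<le> M * (norm (t - t') + norm (x - x'))"
  shows "continuous_on A (\<lambda>s. g (u s) (v s))"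
proof -
  have "continuous_on A ((\<lambda>(t, x). g t x) \<circ> (\<lambda>s. (u s, v s)))"
    by (intro continuous_on_compose continuous_on_Pair continuous_on_apply_bcontfun
        continuous_on_subset[OF lip_continuous[OF assms]]) auto
  then show ?thesis by (simp add: o_def)
qed

lemmas P_cont = cont_comp[OF P_lip(1)] cont_comp[OF P_lip(2)] cont_comp[OF P_lip(3)]

text \<open>Mean value theorem along the segment, which stays in the convex ball |x| < 2; the
  Lipschitz gradient makes the remainder quadratic.\<close>

lemma P_taylor:
  assumes e: "0 < e" "e < e1" and x: "norm x < 2" "norm x' < 2"
  shows "\<bar>P e t' x' - P e t x - (Pt e t x * (t' - t) + inner (Px e t x) (x' - x))\<bar> \<le> M * (\<bar>t' - t\<bar> + norm (x' - x))\<^sup>2"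
proof -
  define g where "g s = P e (t + s * (t' - t)) (x + s *\<^sub>R (x' - x))" for s
  define g' where "g' s = Pt e (t + s * (t' - t)) (x + s *\<^sub>R (x' - x)) * (t' - t) +
    inner (Px e (t + s * (t' - t)) (x + s *\<^sub>R (x' - x))) (x' - x)" for s
  have seg: "norm (x + s *\<^sub>R (x' - x)) < 2" if "0 \<le> s" "s \<le> 1" for s
  proof -
    have "(1 - s) *\<^sub>R x + s *\<^sub>R x' \<in> ball 0 2"
      using that x by (intro convexD[OF convex_ball]) auto
    then show ?thesis by (simp add: algebra_simps)
  qed
  have "DERIV g s :> g' s" if "0 \<le> s" "s \<le> 1" for s
  proof -
    have "((\<lambda>r. (t + r * (t' - t), x + r *\<^sub>R (x' - x))) has_derivative (\<lambda>r. (r * (t' - t), r *\<^sub>R (x' - x)))) (at s)"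
      by (auto intro!: derivative_eq_intros)
    from has_derivative_compose[OF this, of "\<lambda>(t, x). P e t x"] P_derivative[OF e seg[OF that], of "t + s * (t' - t)"]
    have "((\<lambda>s. P e (t + s * (t' - t)) (x + s *\<^sub>R (x' - x))) has_derivative (\<lambda>r. g' s * r)) (at s)"
      by (fastforce simp: g'_def algebra_simps)
    then show ?thesis
      unfolding g_def[abs_def] has_field_derivative_def .
  qed
  then obtain s where s: "0 < s" "s < 1" "g 1 - g 0 = (1 - 0) * g' s"
    using MVT2[of 0 1 g g'] by auto
  let ?D = "\<bar>t' - t\<bar> + norm (x' - x)"
  have M: "M \<ge> 0" using P_bound(2)[OF e, of 0 0] norm_ge_zero[of "Pt e 0 0"] by linarith
  have near: "M * (norm (t + s * (t' - t) - t) + norm (x + s *\<^sub>R (x' - x) - x)) \<le> M * ?D"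
  proof (rule mult_left_mono[OF _ M])
    have "s * \<bar>t' - t\<bar> \<le> 1 * \<bar>t' - t\<bar>" "s * norm (x' - x) \<le> 1 * norm (x' - x)"
      using s by (intro mult_right_mono; simp)+
    then show "norm (t + s * (t' - t) - t) + norm (x + s *\<^sub>R (x' - x) - x) \<le> ?D"
      using s by (simp add: abs_mult)
  qed
  have "P e t' x' - P e t x - (Pt e t x * (t' - t) + inner (Px e t x) (x' - x)) = 
    (Pt e (t + s * (t' - t)) (x + s *\<^sub>R (x' - x)) - Pt e t x) * (t' - t) +
    inner (Px e (t + s * (t' - t)) (x + s *\<^sub>R (x' - x)) - Px e t x) (x' - x)"
    using s(3) by (simp add: g_def g'_def algebra_simps inner_diff_left)
  also have "\<bar>\<dots>\<bar> \<le> (M * ?D) * \<bar>t' - t\<bar> + (M * ?D) * norm (x' - x)"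
  proof (intro abs_triangle_ineq[THEN order_trans] add_mono)
    show "\<bar>(Pt e (t + s * (t' - t)) (x + s *\<^sub>R (x' - x)) - Pt e t x) * (t' - t)\<bar> \<le> (M * ?D) * \<bar>t' - t\<bar>"
      unfolding abs_mult using order_trans[OF P_lip(2)[OF e] near] by (intro mult_right_mono) auto
    show "\<bar>inner (Px e (t + s * (t' - t)) (x + s *\<^sub>R (x' - x)) - Px e t x) (x' - x)\<bar> \<le> (M * ?D) * norm (x' - x)"
      using order_trans[OF P_lip(3)[OF e] near]
      by (intro order_trans[OF Cauchy_Schwarz_ineq2] mult_right_mono) auto
  qed
  also have "\<dots> = M * ?D\<^sup>2" by (simp add: power2_eq_square algebra_simps)
  finally show ?thesis .
qed

text \<open>The quadratic remainder is uniform in s and survives integration. The radius 2 - |x|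
  keeps the competitor inside the ball where \<open>P\<close> has its derivative.\<close>

lemma NP_derivative:
  fixes t :: "real \<Rightarrow>\<^sub>C real" and x :: "real \<Rightarrow>\<^sub>C cc"
  assumes e: "0 < e" "e < e1" and x: "norm x < 2"
  shows "(NP e has_derivative (\<lambda>h. unit_integral (lift2 (*) (bcont01 (\<lambda>s. Pt e (t s) (x s))) (fst h)) +
    l2_inner (bcont01 (\<lambda>s. Px e (t s) (x s))) (snd h))) (at (t, x))" (is "(_ has_derivative ?D) _")
proof (rule has_derivative_quadratic)
  show "bounded_linear ?D"
    by (intro bounded_linear_add bounded_linear_compose[OF bounded_linear_unit_integral]
        bounded_linear_compose[OF bounded_bilinear.bounded_linear_right[OF bounded_bilinear_lift2[OF bounded_bilinear_mult]]]
        bounded_linear_compose[OF l2_inner.bounded_linear_right] bounded_linear_fst bounded_linear_snd)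
  show "2 - norm x > 0" using x by simp
  fix z :: "(real \<Rightarrow>\<^sub>C real) \<times> (real \<Rightarrow>\<^sub>C cc)"
  obtain t' x' where z: "z = (t', x')" by force
  let ?n = "norm (z - (t, x))"
  assume n: "?n < 2 - norm x"
  have dt: "norm (t' - t) \<le> ?n" and dx: "norm (x' - x) \<le> ?n"
    using norm_fst_le[of "t' - t" "x' - x"] norm_snd_le[of "x' - x" "t' - t"] by (auto simp: z)
  then have x': "norm x' < 2" using n norm_triangle_sub[of x' x] by simp
  let ?i = "\<lambda>s. P e (t' s) (x' s) - P e (t s) (x s) - (Pt e (t s) (x s) * (t' s - t s) + inner (Px e (t s) (x s)) (x' s - x s))"
  note I = integrable_continuous_real[where 'a = real]
  have "NP e z - NP e (t, x) - ?D (z - (t, x)) = integral {0..1} (\<lambda>s. P e (t' s) (x' s)) - integral {0..1} (\<lambda>s. P e (t s) (x s))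
     - (integral {0..1} (\<lambda>s. Pt e (t s) (x s) * (t' s - t s)) + integral {0..1} (\<lambda>s. inner (Px e (t s) (x s)) (x' s - x s)))"
    unfolding NP_def z unit_integral_def l2_inner_eq
    by (intro arg_cong2[of _ _ _ _ "(-)"] arg_cong2[of _ _ _ _ "(+)"] integral_cong)
       (simp_all add: bcont01_apply P_cont e lift2_apply[OF bounded_bilinear_mult])
  also have "\<dots> = integral {0..1} ?i"
    by (subst Henstock_Kurzweil_Integration.integral_diff Henstock_Kurzweil_Integration.integral_add;
        (intro I continuous_intros P_cont e continuous_on_apply_bcontfun)?)+ (rule refl)
  also have "norm \<dots> \<le> M * (?n + ?n)\<^sup>2 * (1 - 0)"
  proof (rule integral_bound)
    show "continuous_on {0..1} ?i"
      by (intro continuous_intros P_cont e continuous_on_apply_bcontfun)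
    fix s :: real
    have M: "M \<ge> 0" using P_bound(2)[OF e, of 0 0] norm_ge_zero[of "Pt e 0 0"] by linarith
    have b: "\<bar>t' s - t s\<bar> \<le> ?n" "norm (x' s - x s) \<le> ?n" "norm (x s) < 2" "norm (x' s) < 2"
      using norm_bounded[of "t' - t" s] norm_bounded[of "x' - x" s] norm_bounded[of x s] norm_bounded[of x' s] dt dx x x'
      by auto
    have "norm (?i s) \<le> M * (\<bar>t' s - t s\<bar> + norm (x' s - x s))\<^sup>2"
      using P_taylor[OF e b(3,4)] by simp
    also have "\<dots> \<le> M * (?n + ?n)\<^sup>2"
      using b by (intro mult_left_mono[OF _ M] power_mono add_mono) auto
    finally show "norm (?i s) \<le> M * (?n + ?n)\<^sup>2" .
  qed simp
  finally show "norm (NP e z - NP e (t, x) - ?D (z - (t, x))) \<le> (4 * M) * ?n\<^sup>2"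
    by (simp add: power2_eq_square)
qed

definition TT :: "(real \<Rightarrow>\<^sub>C cc) \<times> (real \<Rightarrow>\<^sub>C cc) \<times> real \<Rightarrow> real \<Rightarrow>\<^sub>C real" where
  "TT z = const_bcontfun (snd (snd z)) + inverse (l2_inner (fst z) (fst z)) *\<^sub>R prim (lift2 inner (fst z) (fst z))"

text \<open>The loop and its velocity are independent arguments, so that two sup norms take the
  place of a C^1 norm. Their relation returns when the derivative is evaluated on pairs with
  \<open>der h k\<close>.\<close>

definition Fn :: "real \<Rightarrow> (real \<Rightarrow>\<^sub>C cc) \<times> (real \<Rightarrow>\<^sub>C cc) \<times> real \<Rightarrow> real" where
  "Fn e z = l2_inner (fst (snd z)) (fst (snd z)) * l2_inner (fst z) (fst z)
     - l2_inner (fst (snd z)) (cmul \<i> (fst z)) * l2_inner (fst (snd z)) (cmul \<i> (fst z))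
     + 2 * om\<^sup>2 * inverse (l2_inner (fst z) (fst z))
     + e * (inverse (l2_inner (fst z) (fst z)) * NP e (TT z, fst z))"

lemma Fn_derivative:
  fixes x y :: "real \<Rightarrow>\<^sub>C cc" and \<tau> :: "real \<Rightarrow>\<^sub>C real"
  assumes e: "0 < e" "e < e1" and x: "norm x < 2" and b: "l2_inner x x = b" "b \<noteq> 0"
    and a: "l2_inner y y = a" and J: "l2_inner y (cmul \<i> x) = J" and \<tau>: "TT (x, y, t) = \<tau>"
  shows "\<exists>D. (Fn e has_derivative D) (at (x, y, t)) \<and> (\<forall>h k s. D (h, k, s) =
     2 * l2_inner y k * b + a * (2 * l2_inner x h) - 2 * J * (l2_inner k (cmul \<i> x) + l2_inner y (cmul \<i> h))
     - 2 * om\<^sup>2 * (2 * l2_inner x h * (inverse b * inverse b))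
     + e * (inverse b * (unit_integral (lift2 (*) (bcont01 (\<lambda>r. Pt e (\<tau> r) (x r)))
          (const_bcontfun s - (2 * l2_inner x h * (inverse b * inverse b)) *\<^sub>R prim (lift2 inner x x)
            + (2 * inverse b) *\<^sub>R prim (lift2 inner x h))) + l2_inner (bcont01 (\<lambda>r. Px e (\<tau> r) (x r))) h)
        - 2 * l2_inner x h * (inverse b * inverse b) * NP e (\<tau>, x)))"
proof -
  let ?z = "(x, y, t)"
  note li = bounded_bilinear_lift2[OF bounded_bilinear_inner]
  interpret li: bounded_bilinear "lift2 inner :: (real \<Rightarrow>\<^sub>C cc) \<Rightarrow> _" by (rule li)
  have li_comm: "lift2 inner u v = lift2 inner v u" for u v :: "real \<Rightarrow>\<^sub>C cc"
    by (rule bcontfun_eqI) (simp add: lift2_apply[OF bounded_bilinear_inner] inner_commute)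
  have b': "((\<lambda>z. l2_inner (fst z) (fst z)) has_derivative (\<lambda>h. 2 * l2_inner x (fst h))) (at ?z)"
    by (rule has_derivative_eq_rhs[OF l2_inner.FDERIV[OF has_derivative_fst[OF has_derivative_ident] has_derivative_fst[OF has_derivative_ident]]])
       (auto simp: l2_inner_commute[of _ x])
  have a': "((\<lambda>z. l2_inner (fst (snd z)) (fst (snd z))) has_derivative (\<lambda>h. 2 * l2_inner y (fst (snd h)))) (at ?z)"
    by (rule has_derivative_eq_rhs[OF l2_inner.FDERIV[OF has_derivative_fst[OF has_derivative_snd[OF has_derivative_ident]] has_derivative_fst[OF has_derivative_snd[OF has_derivative_ident]]]])
       (auto simp: l2_inner_commute[of _ y])
  have J': "((\<lambda>z. l2_inner (fst (snd z)) (cmul \<i> (fst z))) has_derivative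
      (\<lambda>h. l2_inner (fst (snd h)) (cmul \<i> x) + l2_inner y (cmul \<i> (fst h)))) (at ?z)"
    by (rule has_derivative_eq_rhs[OF l2_inner.FDERIV[OF has_derivative_fst[OF has_derivative_snd[OF has_derivative_ident]]
         bounded_linear.has_derivative[OF bounded_linear_cmul has_derivative_fst[OF has_derivative_ident]]]])
       auto
  have i': "((\<lambda>z. inverse (l2_inner (fst z) (fst z))) has_derivative (\<lambda>h. - (2 * l2_inner x (fst h) * (inverse b * inverse b)))) (at ?z)"
    by (rule has_derivative_eq_rhs[OF Deriv.has_derivative_inverse[OF _ b']]) (use b in auto)
  have p': "((\<lambda>z. prim (lift2 inner (fst z) (fst z))) has_derivative (\<lambda>h. 2 *\<^sub>R prim (lift2 inner x (fst h)))) (at ?z)"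
    by (rule has_derivative_eq_rhs[OF bounded_linear.has_derivative[OF bounded_linear_prim li.FDERIV[OF has_derivative_fst[OF has_derivative_ident] has_derivative_fst[OF has_derivative_ident]]]])
       (simp add: li_comm[of _ x] linear_add[OF bounded_linear.linear[OF bounded_linear_prim]] scaleR_2)
  have t': "(TT has_derivative (\<lambda>h. const_bcontfun (snd (snd h)) - (2 * l2_inner x (fst h) * (inverse b * inverse b)) *\<^sub>R prim (lift2 inner x x)
            + (2 * inverse b) *\<^sub>R prim (lift2 inner x (fst h)))) (at ?z)"
    unfolding TT_def[abs_def]
    by (rule has_derivative_eq_rhs[OF has_derivative_add[OF bounded_linear.has_derivative[OF bounded_linear_const_bcontfun
            has_derivative_snd[OF has_derivative_snd[OF has_derivative_ident]]] has_derivative_scaleR[OF i' p']]])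
       (auto simp: b algebra_simps)
  have N': "((\<lambda>z. NP e (TT z, fst z)) has_derivative
      (\<lambda>h. unit_integral (lift2 (*) (bcont01 (\<lambda>r. Pt e (\<tau> r) (x r))) (const_bcontfun (snd (snd h))
         - (2 * l2_inner x (fst h) * (inverse b * inverse b)) *\<^sub>R prim (lift2 inner x x)
            + (2 * inverse b) *\<^sub>R prim (lift2 inner x (fst h)))) + l2_inner (bcont01 (\<lambda>r. Px e (\<tau> r) (x r))) (fst h))) (at ?z)"
  proof -
    have "(NP e has_derivative (\<lambda>h. unit_integral (lift2 (*) (bcont01 (\<lambda>s. Pt e (\<tau> s) (x s))) (fst h)) +
        l2_inner (bcont01 (\<lambda>s. Px e (\<tau> s) (x s))) (snd h))) (at (TT ?z, fst ?z))"
      using NP_derivative[OF e x, of \<tau>] by (simp add: \<tau>)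
    from has_derivative_compose[OF has_derivative_Pair[OF t' has_derivative_fst[OF has_derivative_ident]] this]
    show ?thesis by simp
  qed
  show ?thesis
    unfolding Fn_def[abs_def]
    by (intro exI conjI allI, rule has_derivative_add[OF has_derivative_add[OF has_derivative_diff[OF has_derivative_mult[OF a' b']
          has_derivative_mult[OF J' J']] has_derivative_mult_right[OF i']] has_derivative_mult_right[OF has_derivative_mult[OF i' N']]])
       (simp add: a b J \<tau> algebra_simps)
qed

end

section \<open>Critical points on the manifold of Kepler orbits\<close>

context perturbation
begin

lemma cmul_Ep: "cmul c (Ep A) = Ep (cm c A)" and cmul_Em: "cmul c (Em A) = Em (cm c A)"
  unfolding cmul_def Ep_def Em_def ep_def em_def
  by (rule bcontfun_eqI; simp add: lift2_apply[OF bounded_bilinear_cm] bcont01_apply continuous_intros mult.commute)+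

definition "aa p = l2_inner (xd p) (xd p)"
definition "JJ p = l2_inner (xd p) (cmul \<i> (xi p))"
definition "xdd p = pf p - om\<^sup>2 *\<^sub>R xi p"
definition "GG e p = (- bb p) *\<^sub>R xdd p + (aa p - 2 * om\<^sup>2 * (inverse (bb p) * inverse (bb p))) *\<^sub>R xi p
  + JJ p *\<^sub>R cmul (2 * \<i>) (xd p) + e *\<^sub>R ((1/2) *\<^sub>R qq e p)"
definition "E1 e p = (rho1 p * (N1 e p - 2 * om * N2 e p)) *\<^sub>R pA p + (e / 2) *\<^sub>R cfp (qq e p)"
definition "E2 e p = (rho2 p * (N1 e p + 2 * om * N2 e p)) *\<^sub>R pB p + (e / 2) *\<^sub>R cfm (qq e p)"

text \<open>At a fixed point \<open>GG\<close> is half the gradient of the action; \<open>E1\<close> and \<open>E2\<close> are what remains of it, its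
  components along the two modes.\<close>

lemma der_zz: "der (zz p) (zd p)"
  unfolding zz_def zd_def by (intro der_add der_scaleR der_Ep der_Em)

lemma der_xi: "der (xi p) (xd p)"
  unfolding xi_def xd_def ww_def wd_def by (intro der_add der_zz der_K)

lemma der_xd: "der (xd p) (xdd p)"
proof -
  have "der (zd p) (rho1 p *\<^sub>R cmul (\<i> * of_real om) (cmul (\<i> * of_real om) (Ep (pA p))) +
      rho2 p *\<^sub>R cmul (- \<i> * of_real om) (cmul (- \<i> * of_real om) (Em (pB p))))"
    unfolding zd_def by (intro der_add der_scaleR der_cmul der_Ep der_Em)
  then have "der (zd p) (- om\<^sup>2 *\<^sub>R zz p)"
    by (rule der_cong)
      (auto simp: zz_def cmul_apply Ep_apply Em_apply cm_def prod_eq_iff scaleR_conv_of_real power2_eq_square algebra_simps)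
  from der_add[OF this der_K(2)[of "pf p"]] show ?thesis
    by (simp add: xd_def xdd_def xi_def wd_def ww_def algebra_simps)
qed

lemma zd_eq: "zd p = rho1 p *\<^sub>R Ep (cm (\<i> * of_real om) (pA p)) + rho2 p *\<^sub>R Em (cm (- \<i> * of_real om) (pB p))"
  by (simp add: zd_def cmul_Ep cmul_Em)

lemma cf_PW: "cfp (PW g) = 0" "cfm (PW g) = 0"
proof -
  interpret cp: bounded_linear cfp by (rule bounded_linear_cfp)
  interpret cn: bounded_linear cfm by (rule bounded_linear_cfm)
  show "cfp (PW g) = 0" "cfm (PW g) = 0" by (simp_all add: PW_def cp.diff cn.diff)
qed

lemma PW_id: "cfp g = 0 \<Longrightarrow> cfm g = 0 \<Longrightarrow> PW g = g"
  using linear_0[OF bounded_linear.linear[OF bounded_linear_Ep]] linear_0[OF bounded_linear.linear[OF bounded_linear_Em]]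
  by (simp add: PW_def)

lemma c1_eq: "c1 e p = inverse (bb p) * unit_integral (lift2 (*) (Ptv e p) (prim (lift2 inner (xi p) (xi p))))"
proof -
  interpret m: bounded_bilinear "lift2 (*) :: (real \<Rightarrow>\<^sub>C real) \<Rightarrow> _"
    by (rule bounded_bilinear_lift2[OF bounded_bilinear_mult])
  interpret ci: bounded_linear "unit_integral :: (real \<Rightarrow>\<^sub>C real) \<Rightarrow> real" by (rule bounded_linear_unit_integral)
  have "c1 e p = unit_integral (lift2 (*) (Ptv e p) (inverse (bb p) *\<^sub>R prim (lift2 inner (xi p) (xi p))))"
    unfolding c1_def l2_inner_def
    by (rule arg_cong[where f = unit_integral], rule bcontfun_eqI)
       (simp add: lift2_apply[OF bounded_bilinear_mult] lift2_apply[OF bounded_bilinear_inner] tt_def)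
  then show ?thesis by (simp add: m.scaleR_right ci.scaleR)
qed

text \<open>Integration by parts turns the delayed effect of \<open>h\<close> on the clock into
  multiplication of \<open>xi p\<close> by \<open>RR e p\<close>, that is, into an L^2
  gradient.\<close>

lemma RR_by_parts:
  "unit_integral (lift2 (*) (Ptv e p) (prim (lift2 inner (xi p) h))) = l2_inner (lift2 scaleR (RR e p) (xi p)) h"
proof -
  interpret ci: bounded_linear "unit_integral :: (real \<Rightarrow>\<^sub>C real) \<Rightarrow> real" by (rule bounded_linear_unit_integral)
  let ?Q = "Ptv e p"
  have "unit_integral (lift2 (*) ?Q (prim (lift2 inner (xi p) h))) =
      unit_integral ?Q * l2_inner (xi p) h - unit_integral (lift2 (*) (prim ?Q) (lift2 inner (xi p) h))"
    using der_by_parts[OF bounded_bilinear_mult der_prim[of ?Q] der_prim[of "lift2 inner (xi p) h"]]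
    by (simp add: prim_apply l2_inner_def unit_integral_def)
  moreover have "l2_inner (lift2 scaleR (RR e p) (xi p)) h = unit_integral (unit_integral ?Q *\<^sub>R lift2 inner (xi p) h - lift2 (*) (prim ?Q) (lift2 inner (xi p) h))"
    unfolding l2_inner_def
    by (rule unit_integral_cong)
       (simp add: lift2_apply[OF bounded_bilinear_mult] lift2_apply[OF bounded_bilinear_inner]
         lift2_apply[OF bounded_bilinear_scaleR] RR_def algebra_simps)
  ultimately show ?thesis by (simp add: ci.diff ci.scaleR l2_inner_def)
qed

section \<open>Identities at a fixed point\<close>

context
  fixes e d :: real and p I
  assumes e: "0 < e" "e < e1" and p: "p \<in> cball (0::unk) d \<times> params I" "d \<le> d0"
    and fix_point: "Psi e p = fst p"
begin

lemma fp_f: "pf p = Ff e p" and fp_r: "2 * sq * r1 p + r1 p * r1 p = h1 e p" "2 * sq * r2 p + r2 p * r2 p = h2 e p"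
  using fix_point sq by (auto simp: Psi_def prod_eq_iff field_simps)

text \<open>\<open>Ff\<close> is a multiple of a value of \<open>PW\<close>; this makes the loop of
  a fixed point close up.\<close>

lemma fp_cf: "cfp (pf p) = 0" "cfm (pf p) = 0"
  unfolding fp_f Ff_def
  using linear_scale[OF bounded_linear.linear[OF bounded_linear_cfp]] linear_scale[OF bounded_linear.linear[OF bounded_linear_cfm]]
  by (simp_all add: cf_PW)

lemma fp_periodic: "xi p 0 = xi p 1" "xd p 0 = xd p 1"
  using K_periodic[OF fp_cf]
  by (simp_all add: xi_def xd_def zz_def zd_eq ww_def wd_def Ep_ends)

lemma fp_cf_w: "cfp (ww p) = 0" "cfm (ww p) = 0" "cfp (wd p) = 0" "cfm (wd p) = 0"
  using cfp_der[OF der_K(1)[of "pf p"] K_periodic(1)[OF fp_cf]] by (simp_all add: ww_def wd_def)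

lemma norm_par: "pA p \<bullet> pA p = 1" "pB p \<bullet> pB p = 1"
  using dom_simps(4,5)[OF p] by (simp_all flip: power2_norm_eq_inner)

lemma fp_aa: "aa p = om\<^sup>2 * (rho1 p * rho1 p + rho2 p * rho2 p) + aw p"
proof -
  have "l2_inner (zd p) (zd p) = om\<^sup>2 * (rho1 p * rho1 p + rho2 p * rho2 p)"
    by (simp add: zd_eq l2_inner.add_left l2_inner.add_right l2_inner.scaleR_left l2_inner.scaleR_right l2_inner_Ep l2_inner_Em inner_cm_left
        norm_par power2_eq_square cm.minus_left algebra_simps linear_add[OF bounded_linear.linear[OF bounded_linear_cfp]]
        linear_scale[OF bounded_linear.linear[OF bounded_linear_cfp]] linear_add[OF bounded_linear.linear[OF bounded_linear_cfm]]
        linear_scale[OF bounded_linear.linear[OF bounded_linear_cfm]] cm_of_real flip: of_real_mult)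
  moreover have "l2_inner (zd p) (wd p) = 0"
    by (simp add: zd_eq l2_inner.add_left l2_inner.scaleR_left l2_inner_Ep l2_inner_Em fp_cf_w)
  ultimately show ?thesis
    using l2_inner_commute[of "wd p" "zd p"] by (simp add: aa_def xd_def l2_inner.add_left l2_inner.add_right aw_def)
qed

lemma fp_JJ: "JJ p = om * (rho1 p * rho1 p - rho2 p * rho2 p) + jw p"
proof -
  have iz: "cmul \<i> (zz p) = rho1 p *\<^sub>R Ep (cm \<i> (pA p)) + rho2 p *\<^sub>R Em (cm \<i> (pB p))"
    using linear_add[OF bounded_linear.linear[OF bounded_linear_cmul]] linear_scale[OF bounded_linear.linear[OF bounded_linear_cmul]]
    by (simp add: zz_def cmul_Ep cmul_Em)
  have "l2_inner (zd p) (cmul \<i> (zz p)) = om * (rho1 p * rho1 p - rho2 p * rho2 p)"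
    unfolding iz
    by (simp add: zd_eq l2_inner.add_left l2_inner.add_right l2_inner.scaleR_left l2_inner.scaleR_right l2_inner_Ep l2_inner_Em inner_cm_left
        norm_par power2_eq_square cm.minus_left algebra_simps cm_of_real)
  moreover have "l2_inner (zd p) (cmul \<i> (ww p)) = 0"
    by (simp add: zd_eq l2_inner.add_left l2_inner.scaleR_left l2_inner_Ep l2_inner_Em cfp_cmul cfm_cmul fp_cf_w)
  moreover have "l2_inner (wd p) (cmul \<i> (zz p)) = 0"
    unfolding iz by (simp add: l2_inner_commute[of "wd p"] l2_inner.add_left l2_inner.scaleR_left l2_inner_Ep l2_inner_Em fp_cf_w)
  moreover have "cmul \<i> (xi p) = cmul \<i> (zz p) + cmul \<i> (ww p)"
    using linear_add[OF bounded_linear.linear[OF bounded_linear_cmul]] by (simp add: xi_def)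
  ultimately show ?thesis
    by (simp add: JJ_def xd_def l2_inner.add_left l2_inner.add_right jw_def)
qed

text \<open>Runs the algebra behind \<open>bh\<close> and \<open>dd\<close> backwards: the radii of
  the fixed point realize exactly the prescribed \<open>N1\<close> and \<open>N2\<close>.\<close>

lemma fp_scalars:
  "JJ p = N2 e p"
  "bb p * om\<^sup>2 + aa p - 2 * om\<^sup>2 * (inverse (bb p) * inverse (bb p)) = N1 e p"
proof -
  have n: "norm (pA p) = 1" "norm (pB p) = 1" using dom_simps[OF p] by auto
  have rr: "rho1 p * rho1 p = 1/2 + h1 e p" "rho2 p * rho2 p = 1/2 + h2 e p"
    using fp_r sq(1) by (auto simp: rho1_def rho2_def algebra_simps)
  have om0: "om \<noteq> 0" using om by simp
  have "rho1 p * rho1 p - rho2 p * rho2 p = dd e p" using rr by (simp add: h1_def h2_def field_simps)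
  then show "JJ p = N2 e p" using om0 by (simp add: fp_JJ dd_def)
  have b: "bb p = 1 + beta p" by (rule bb_beta[OF n])
  have "bb p = 1 + bh e p" using rr by (simp add: bb_eq[OF n] h1_def h2_def field_simps)
  then have "beta p = bh e p" using b by simp
  then have "3 * beta p = YY e p * (bb p * bb p) - 3 * (beta p * beta p) - beta p * (beta p * beta p)"
    by (simp add: bh_def)
  then have 1: "bb p * (bb p * bb p) - 1 = YY e p * (bb p * bb p)"
    unfolding b by (simp add: algebra_simps)
  have b0: "bb p \<noteq> 0" using bb_ge[OF p] by simp
  have "bb p - inverse (bb p) * inverse (bb p) = (bb p * (bb p * bb p) - 1) * (inverse (bb p) * inverse (bb p))"
    using b0 by (simp add: field_simps)
  also have "\<dots> = YY e p" unfolding 1 using b0 by (simp add: field_simps)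
  finally have Y: "bb p - inverse (bb p) * inverse (bb p) = YY e p" .
  have "2 * om\<^sup>2 * YY e p = N1 e p - aw p + om\<^sup>2 * bw p" using om0 by (simp add: YY_def)
  moreover have "aa p = om\<^sup>2 * (bb p - bw p) + aw p" by (simp add: fp_aa bb_eq[OF n])
  ultimately show "bb p * om\<^sup>2 + aa p - 2 * om\<^sup>2 * (inverse (bb p) * inverse (bb p)) = N1 e p"
    unfolding Y[symmetric] by (simp add: algebra_simps)
qed

lemma fp_GG: "GG e p = Ep (E1 e p) + Em (E2 e p)"
proof -
  interpret Ep: bounded_linear Ep by (rule bounded_linear_Ep)
  interpret Em: bounded_linear Em by (rule bounded_linear_Em)
  interpret cp: bounded_linear cfp by (rule bounded_linear_cfp)
  interpret cn: bounded_linear cfm by (rule bounded_linear_cfm)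
  interpret cu: bounded_linear "cmul c" for c by (rule bounded_linear_cmul)
  interpret PW: bounded_linear PW by (rule bounded_linear_PW)
  have b0: "bb p \<noteq> 0" using bb_ge[OF p] by simp
  have "bb p *\<^sub>R pf p = PW (N1 e p *\<^sub>R ww p + N2 e p *\<^sub>R cmul (2 * \<i>) (wd p) + e *\<^sub>R ((1/2) *\<^sub>R qq e p))"
    by (subst fp_f) (simp add: Ff_def b0)
  also have "\<dots> = N1 e p *\<^sub>R ww p + N2 e p *\<^sub>R cmul (2 * \<i>) (wd p) + (e/2) *\<^sub>R PW (qq e p)"
    by (simp add: PW.add PW.scaleR PW_id fp_cf_w cfp_cmul cfm_cmul)
  finally have f: "bb p *\<^sub>R pf p = N1 e p *\<^sub>R ww p + N2 e p *\<^sub>R cmul (2 * \<i>) (wd p)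
     + (e/2) *\<^sub>R (qq e p - Ep (cfp (qq e p)) - Em (cfm (qq e p)))"
    by (simp add: PW_def)
  have "GG e p = - (bb p *\<^sub>R pf p) + (bb p * om\<^sup>2 + aa p - 2 * om\<^sup>2 * (inverse (bb p) * inverse (bb p))) *\<^sub>R xi p
      + JJ p *\<^sub>R cmul (2 * \<i>) (xd p) + (e / 2) *\<^sub>R qq e p"
    by (simp add: GG_def xdd_def algebra_simps)
  also have "\<dots> = N1 e p *\<^sub>R zz p + N2 e p *\<^sub>R cmul (2 * \<i>) (zd p) + (e/2) *\<^sub>R (Ep (cfp (qq e p)) + Em (cfm (qq e p)))"
    unfolding f fp_scalars by (simp add: xi_def xd_def cu.add algebra_simps)
  \<comment> \<open>The modes rotate in opposite senses, so 2 i d/ds acts on them as -2 om and +2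
    om; hence the opposite signs of \<open>N2\<close> in \<open>E1\<close> and
    \<open>E2\<close>.\<close>
  also have "cmul (2 * \<i>) (zd p) = (- 2 * om) *\<^sub>R (rho1 p *\<^sub>R Ep (pA p) - rho2 p *\<^sub>R Em (pB p))"
  proof -
    have "cm (2 * \<i>) (cm (\<i> * of_real om) A) = (- 2 * om) *\<^sub>R A" "cm (2 * \<i>) (cm (- \<i> * of_real om) A) = (2 * om) *\<^sub>R A" for A
      by (auto simp: cm_def prod_eq_iff scaleR_conv_of_real)
    then show ?thesis
      by (simp add: zd_eq cu.add cu.scaleR cmul_Ep cmul_Em Ep.scaleR Em.scaleR Ep.neg Em.neg algebra_simps)
  qed
  also have "N1 e p *\<^sub>R zz p + N2 e p *\<^sub>R ((- 2 * om) *\<^sub>R (rho1 p *\<^sub>R Ep (pA p) - rho2 p *\<^sub>R Em (pB p)))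
      + (e/2) *\<^sub>R (Ep (cfp (qq e p)) + Em (cfm (qq e p))) = Ep (E1 e p) + Em (E2 e p)"
    by (simp add: zz_def E1_def E2_def Ep.add Em.add Ep.diff Em.diff Ep.scaleR Em.scaleR algebra_simps)
  finally show ?thesis .
qed

text \<open>\<open>N1\<close> and \<open>N2\<close> are defined so as to make this hold.
  \<open>E1\<close> and \<open>E2\<close> thereby are tangent to the unit spheres at A and B, so the
  parameters can be moved in their directions.\<close>

lemma fp_E: "E1 e p \<bullet> pA p = 0" "E2 e p \<bullet> pB p = 0"
proof -
  have r: "rho1 p \<noteq> 0" "rho2 p \<noteq> 0" using dom_simps[OF p] by auto
  have om0: "om \<noteq> 0" using om by simp
  have "N1 e p - 2 * om * N2 e p = - (e / 2) * g1 e p" "N1 e p + 2 * om * N2 e p = - (e / 2) * g2 e p"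
    using om0 by (simp_all add: N1_def N2_def field_simps)
  moreover have "rho1 p * g1 e p = cfp (qq e p) \<bullet> pA p" "rho2 p * g2 e p = cfm (qq e p) \<bullet> pB p"
    using r by (simp_all add: g1_def g2_def)
  ultimately have "rho1 p * (N1 e p - 2 * om * N2 e p) = - (e / 2) * (cfp (qq e p) \<bullet> pA p)"
    "rho2 p * (N1 e p + 2 * om * N2 e p) = - (e / 2) * (cfm (qq e p) \<bullet> pB p)"
    by (metis mult.left_commute)+
  then show "E1 e p \<bullet> pA p = 0" "E2 e p \<bullet> pB p = 0"
    by (simp_all add: E1_def E2_def inner_add_left inner_diff_left norm_par)
qed

text \<open>For periodic \<open>h\<close> with derivative \<open>k\<close>, integration by parts
  gives twice the L^2 product of \<open>GG e p\<close> with \<open>h\<close>, and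
  \<open>GG e p\<close> has resonant modes only. The response of \<open>f\<close> to the parameters
  is thus invisible to first order, which replaces a derivative of the fixed point.\<close>

lemma fp_derivative:
  "\<exists>D. (Fn e has_derivative D) (at (xi p, xd p, pt p)) \<and> (\<forall>h k s. der h k \<longrightarrow> h 0 = h 1 \<longrightarrow>
     D (h, k, s) = 2 * (E1 e p \<bullet> cfp h + E2 e p \<bullet> cfm h) + e * (inverse (bb p) * (s * unit_integral (Ptv e p))))"
proof -
  have x: "norm (xi p) < 2" using xi_bound[OF p] by simp
  have b: "bb p \<noteq> 0" using bb_ge[OF p] by simp
  have T: "TT (xi p, xd p, pt p) = tt p" by (simp add: TT_def tt_def bb_def)
  obtain D where D: "(Fn e has_derivative D) (at (xi p, xd p, pt p))"
    and Deq: "\<And>h k s. D (h, k, s) =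
     2 * l2_inner (xd p) k * bb p + aa p * (2 * l2_inner (xi p) h) - 2 * JJ p * (l2_inner k (cmul \<i> (xi p)) + l2_inner (xd p) (cmul \<i> h))
     - 2 * om\<^sup>2 * (2 * l2_inner (xi p) h * (inverse (bb p) * inverse (bb p)))
     + e * (inverse (bb p) * (unit_integral (lift2 (*) (Ptv e p)
          (const_bcontfun s - (2 * l2_inner (xi p) h * (inverse (bb p) * inverse (bb p))) *\<^sub>R prim (lift2 inner (xi p) (xi p))
            + (2 * inverse (bb p)) *\<^sub>R prim (lift2 inner (xi p) h))) + l2_inner (Pxv e p) h)
        - 2 * l2_inner (xi p) h * (inverse (bb p) * inverse (bb p)) * c2 e p)"
    using Fn_derivative[OF e x bb_def[symmetric] b aa_def[symmetric] JJ_def[symmetric] T]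
    unfolding Ptv_def[symmetric] Pxv_def[symmetric]
    by (auto simp: c2_def Pv_def NP_def)
  have "D (h, k, s) = 2 * (E1 e p \<bullet> cfp h + E2 e p \<bullet> cfm h) + e * (inverse (bb p) * (s * unit_integral (Ptv e p)))"
    if hk: "der h k" "h 0 = h 1" for h k s
  proof -
    let ?B = "inverse (bb p)" and ?X = "l2_inner (xi p) h"
    have 1: "l2_inner (xd p) k = - l2_inner (xdd p) h"
      using l2_inner_by_parts[OF der_xd hk(1) fp_periodic(2) hk(2)] by simp
    have "l2_inner k (cmul \<i> (xi p)) = - l2_inner h (cmul \<i> (xd p))"
      using fp_periodic(1) by (intro l2_inner_by_parts[OF hk(1) der_cmul[OF der_xi] hk(2)]) (simp add: cmul_apply)
    moreover have "l2_inner (xd p) (cmul \<i> h) = - l2_inner (cmul \<i> (xd p)) h"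
      by (simp add: l2_inner_cmul_i)
    ultimately have 2: "l2_inner k (cmul \<i> (xi p)) + l2_inner (xd p) (cmul \<i> h) = - l2_inner (cmul (2 * \<i>) (xd p)) h"
    proof -
      have "l2_inner (cmul (2 * \<i>) (xd p)) h = l2_inner (2 *\<^sub>R cmul \<i> (xd p)) h"
        by (rule l2_inner_cong) (auto simp: cmul_apply cm_def prod_eq_iff scaleR_conv_of_real)
      then show ?thesis
        using \<open>l2_inner k (cmul \<i> (xi p)) = _\<close> \<open>l2_inner (xd p) (cmul \<i> h) = _\<close> l2_inner_commute[of h "cmul \<i> (xd p)"]
        by (simp add: l2_inner.scaleR_left)
    qed
    interpret m: bounded_bilinear "lift2 (*) :: (real \<Rightarrow>\<^sub>C real) \<Rightarrow> _"
      by (rule bounded_bilinear_lift2[OF bounded_bilinear_mult])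
    interpret ci: bounded_linear "unit_integral :: (real \<Rightarrow>\<^sub>C real) \<Rightarrow> real" by (rule bounded_linear_unit_integral)
    let ?Q = "Ptv e p"
    have s: "unit_integral (lift2 (*) ?Q (const_bcontfun s)) = s * unit_integral ?Q"
    proof -
      have "unit_integral (lift2 (*) ?Q (const_bcontfun s)) = unit_integral (s *\<^sub>R ?Q)"
        by (rule unit_integral_cong) (simp add: lift2_apply[OF bounded_bilinear_mult])
      then show ?thesis by (simp add: ci.scaleR)
    qed
    note c = c1_eq[of e p, symmetric] and r = RR_by_parts[of e p h]
    have q: "l2_inner (qq e p) h = ?B * l2_inner (Pxv e p) h + 2 * (?B * ?B) * (l2_inner (lift2 scaleR (RR e p) (xi p)) h - (c1 e p + c2 e p) * ?X)"
    proof -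
      have "lift2 scaleR (RR e p - const_bcontfun c) (xi p) = lift2 scaleR (RR e p) (xi p) - lift2 scaleR (const_bcontfun c) (xi p)" for c
        by (rule bounded_bilinear.diff_left[OF bounded_bilinear_lift2[OF bounded_bilinear_scaleR]])
      moreover have "l2_inner (lift2 scaleR (const_bcontfun c) (xi p)) h = l2_inner (c *\<^sub>R xi p) h" for c
        by (rule l2_inner_cong) (simp_all add: lift2_apply[OF bounded_bilinear_scaleR])
      ultimately show ?thesis
        by (simp add: qq_def l2_inner.add_left l2_inner.scaleR_left l2_inner.diff_left)
    qed
    have I: "unit_integral (lift2 (*) ?Q (const_bcontfun s - (2 * ?X * (?B * ?B)) *\<^sub>R prim (lift2 inner (xi p) (xi p))
            + (2 * ?B) *\<^sub>R prim (lift2 inner (xi p) h))) =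
         s * unit_integral ?Q - 2 * ?X * ?B * c1 e p + 2 * ?B * l2_inner (lift2 scaleR (RR e p) (xi p)) h"
      by (simp add: m.add_right m.diff_right m.scaleR_right ci.add ci.diff ci.scaleR s r c[symmetric])
    have "2 * l2_inner (GG e p) h = - 2 * bb p * l2_inner (xdd p) h + 2 * (aa p - 2 * om\<^sup>2 * (?B * ?B)) * ?X
        + 2 * JJ p * l2_inner (cmul (2 * \<i>) (xd p)) h + e * l2_inner (qq e p) h"
      unfolding GG_def by (simp only: l2_inner.add_left l2_inner.scaleR_left) (simp add: algebra_simps)
    then have "D (h, k, s) = 2 * l2_inner (GG e p) h + e * (?B * (s * unit_integral ?Q))"
      unfolding Deq 1 2 I q by (simp add: algebra_simps)
    then show ?thesis
      by (simp add: fp_GG l2_inner.add_left l2_inner_Ep l2_inner_Em)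
  qed
  with D show ?thesis by blast
qed

end

lemma cf_xi: "cfp (xi p) = rho1 p *\<^sub>R pA p" "cfm (xi p) = rho2 p *\<^sub>R pB p"
  unfolding xi_def zz_def ww_def
  by (simp_all add: linear_add[OF bounded_linear.linear[OF bounded_linear_cfp]] linear_add[OF bounded_linear.linear[OF bounded_linear_cfm]]
      linear_scale[OF bounded_linear.linear[OF bounded_linear_cfp]] linear_scale[OF bounded_linear.linear[OF bounded_linear_cfm]])

text \<open>A unit shift of the initial time adds 1 to the clock, which the periodicity of
  \<open>P\<close> does not notice. With uniqueness of the fixed point, the reduced action becomes
  periodic in the initial time.\<close>

lemma shift:
  fixes z :: unk and A B :: cc and t :: real
  assumes e: "0 < e" "e < e1"
  defines "p \<equiv> (z, A, B, t)" and "p' \<equiv> (z, A, B, t + 1)"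
  shows "xi p' = xi p" "xd p' = xd p" "Psi e p' = Psi e p" "Fn e (xi p', xd p', t + 1) = Fn e (xi p, xd p, t)"
proof -
  have 1: "rho1 p' = rho1 p" "rho2 p' = rho2 p" "ww p' = ww p" "wd p' = wd p"
    by (simp_all add: p_def p'_def rho1_def rho2_def ww_def wd_def)
  show 2: "xi p' = xi p" "xd p' = xd p"
    using 1 by (simp_all add: xi_def xd_def zz_def zd_def p_def p'_def)
  have 3: "bb p' = bb p" "beta p' = beta p" "bw p' = bw p" "aw p' = aw p" "jw p' = jw p"
    using 1 2 by (simp_all add: bb_def bw_def aw_def jw_def beta_def) (simp_all add: p_def p'_def)
  have 4: "tt p' s = tt p s + 1" for s
    using 2 3 by (simp add: tt_def) (simp add: p_def p'_def)
  have 5: "Pv e p' = Pv e p" "Ptv e p' = Ptv e p" "Pxv e p' = Pxv e p"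
    using 2 by (simp_all add: Pv_def Ptv_def Pxv_def 4 P_periodic e)
  have 6: "tt p' - const_bcontfun (pt p') = tt p - const_bcontfun (pt p)"
    using 2 3 by (simp add: tt_def)
  have 7: "qq e p' = qq e p" "RR e p' = RR e p"
    using 2 3 5 6 by (simp_all add: qq_def RR_def c1_def c2_def)
  have 8: "N1 e p' = N1 e p" "N2 e p' = N2 e p"
    using 1 7 by (simp_all add: N1_def N2_def g1_def g2_def) (simp_all add: p_def p'_def)
  show "Psi e p' = Psi e p"
    using 1 3 7 8 by (simp add: Psi_def Ff_def h1_def h2_def bh_def YY_def dd_def) (simp add: p_def p'_def)
  have "TT (xi p, xd p, t + 1) s = TT (xi p, xd p, t) s + 1" for s
    by (simp add: TT_def)
  then have "NP e (TT (xi p, xd p, t + 1), xi p) = NP e (TT (xi p, xd p, t), xi p)"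
    by (simp add: NP_def P_periodic e)
  then show "Fn e (xi p', xd p', t + 1) = Fn e (xi p, xd p, t)"
    using 2 by (simp add: Fn_def)
qed

section \<open>Maximization over the parameters\<close>

context
  fixes e d :: real and y :: "par \<Rightarrow> unk"
  assumes e: "0 < e" "e < e1" and d: "0 < d" "d \<le> d0"
    and y: "\<forall>q\<in>params {-1..2}. norm (y q) \<le> d \<and> Psi e (y q, q) = y q \<and>
      (\<forall>z. norm z \<le> d \<and> Psi e (z, q) = z \<longrightarrow> z = y q) \<and> (\<forall>q'\<in>params {-1..2}. dist (y q) (y q') \<le> dist q q')"
begin

definition "st q = (xi (y q, q), xd (y q, q), snd (snd q))"

lemma in_dom: "q \<in> params {-1..2} \<Longrightarrow> (y q, q) \<in> cball 0 d \<times> params {-1..2}"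
  using y by auto

lemma st_lipschitz: "\<exists>C\<ge>0. \<forall>q\<in>params {-1..2}. \<forall>q'\<in>params {-1..2}. norm (st q - st q') \<le> C * dist q q'"
proof -
  obtain C where C: "C \<ge> 0"
    "\<And>e d p q. 0 < e \<Longrightarrow> e < e1 \<Longrightarrow> 0 < d \<Longrightarrow> d \<le> d0 \<Longrightarrow> p \<in> cball 0 d \<times> params {-1..2} \<Longrightarrow> q \<in> cball 0 d \<times> params {-1..2} \<Longrightarrow>
      norm (xi p - xi q) \<le> C * 1 * dist p q"
    using xi_bl by (rule lf.olE) blast
  obtain D where D: "D \<ge> 0"
    "\<And>e d p q. 0 < e \<Longrightarrow> e < e1 \<Longrightarrow> 0 < d \<Longrightarrow> d \<le> d0 \<Longrightarrow> p \<in> cball 0 d \<times> params {-1..2} \<Longrightarrow> q \<in> cball 0 d \<times> params {-1..2} \<Longrightarrow>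
      norm (xd p - xd q) \<le> D * 1 * dist p q"
    using xd_bl by (rule lf.olE) blast
  have "norm (st q - st q') \<le> (C * 2 + D * 2 + 1) * dist q q'" if q: "q \<in> params {-1..2}" "q' \<in> params {-1..2}" for q q'
  proof -
    have "dist (y q, q) (y q', q') \<le> dist (y q) (y q') + dist q q'" by (rule dist_Pair_le)
    also have "\<dots> \<le> 2 * dist q q'" using y q by auto
    finally have dd: "dist (y q, q) (y q', q') \<le> 2 * dist q q'" .
    have "dist (snd (snd q)) (snd (snd q')) \<le> dist q q'"
      by (rule order_trans[OF dist_snd_le dist_snd_le])
    then have t: "norm (snd (snd q) - snd (snd q')) \<le> 1 * dist q q'" by (simp add: dist_norm)
    have x: "norm (xi (y q, q) - xi (y q', q')) \<le> C * 2 * dist q q'"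
      using order_trans[OF C(2)[OF e d in_dom[OF q(1)] in_dom[OF q(2)]] mult_left_mono[OF dd]] C(1) by (simp add: mult_ac)
    have x': "norm (xd (y q, q) - xd (y q', q')) \<le> D * 2 * dist q q'"
      using order_trans[OF D(2)[OF e d in_dom[OF q(1)] in_dom[OF q(2)]] mult_left_mono[OF dd]] D(1) by (simp add: mult_ac)
    have "norm (st q - st q') \<le> norm (xi (y q, q) - xi (y q', q')) +
        (norm (xd (y q, q) - xd (y q', q')) + norm (snd (snd q) - snd (snd q')))"
      unfolding st_def diff_Pair by (intro order_trans[OF norm_Pair_le] add_left_mono norm_Pair_le)
    also have "\<dots> \<le> C * 2 * dist q q' + (D * 2 * dist q q' + 1 * dist q q')"
      by (intro add_mono x x' t)
    finally show ?thesis by (simp add: algebra_simps)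
  qed
  then show ?thesis using C(1) D(1) by (intro exI[of _ "C * 2 + D * 2 + 1"]) auto
qed

lemma fp_at: "q \<in> params {-1..2} \<Longrightarrow> Psi e (y q, q) = fst (y q, q)"
  using y by simp

text \<open>Stands in for differentiability of the reduced action. The action is differentiable at
  \<open>st q\<close>, and \<open>st\<close> moves by O(s) along \<open>\<gamma>\<close>; a
  derivative of at least c s outweighs the o(s) remainder and contradicts the maximum.\<close>

lemma no_ascent:
  assumes q: "q \<in> params {-1..2}" and max: "\<And>q'. q' \<in> params {-1..2} \<Longrightarrow> Fn e (st q') \<le> Fn e (st q)"
    and \<gamma>: "\<And>s. 0 < s \<Longrightarrow> s < 1 \<Longrightarrow> \<gamma> s \<in> params {-1..2}" "\<And>s. 0 < s \<Longrightarrow> s < 1 \<Longrightarrow> dist (\<gamma> s) q \<le> L * s"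
    and c: "c > 0" and asc: "\<And>s. 0 < s \<Longrightarrow> s < 1 \<Longrightarrow> c * s \<le>
      2 * (E1 e (y q, q) \<bullet> cfp (xi (y (\<gamma> s), \<gamma> s) - xi (y q, q)) + E2 e (y q, q) \<bullet> cfm (xi (y (\<gamma> s), \<gamma> s) - xi (y q, q)))
      + e * (inverse (bb (y q, q)) * ((snd (snd (\<gamma> s)) - snd (snd q)) * unit_integral (Ptv e (y q, q))))"
  shows False
proof -
  obtain C where C: "C \<ge> 0" "\<And>q q'. q \<in> params {-1..2} \<Longrightarrow> q' \<in> params {-1..2} \<Longrightarrow> norm (st q - st q') \<le> C * dist q q'"
    using st_lipschitz by blast
  have L: "L \<ge> 0" using order_trans[OF zero_le_dist \<gamma>(2)[of "1/2"]] by simp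
  obtain D where D: "(Fn e has_derivative D) (at (st q))"
    and Deq: "\<And>h k s. der h k \<Longrightarrow> h 0 = h 1 \<Longrightarrow> D (h, k, s) = 2 * (E1 e (y q, q) \<bullet> cfp h + E2 e (y q, q) \<bullet> cfm h)
       + e * (inverse (bb (y q, q)) * (s * unit_integral (Ptv e (y q, q))))"
    using fp_derivative[OF e in_dom[OF q] d(2) fp_at[OF q]] unfolding st_def by auto
  \<comment> \<open>Chosen so that the remainder along the curve, at most
    \<open>\<eta> * (C * L * s)\<close>, stays below c s / 2; adding 1 avoids a zero
    denominator.\<close>
  define \<eta> where "\<eta> = c / (2 * (C * L + 1))"
  have CL: "C * L \<ge> 0" using C(1) L by simp
  have \<eta>: "\<eta> > 0" using c CL by (simp add: \<eta>_def)
  obtain r where r: "r > 0" "\<And>z. norm (z - st q) < r \<Longrightarrow> norm (Fn e z - Fn e (st q) - D (z - st q)) \<le> \<eta> * norm (z - st q)"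
    using D \<eta> unfolding has_derivative_at_alt by blast
  define s where "s = min (1/2) (r / (2 * (C * L + 1)))"
  have s: "0 < s" "s < 1" using r CL by (auto simp: s_def)
  have n: "norm (st (\<gamma> s) - st q) \<le> C * L * s"
    using order_trans[OF C(2)[OF \<gamma>(1)[OF s] q] mult_left_mono[OF \<gamma>(2)[OF s] C(1)]] by (simp add: mult.assoc)
  also have "\<dots> \<le> (C * L + 1) * (r / (2 * (C * L + 1)))"
    using CL s by (intro mult_mono) (auto simp: s_def)
  also have "\<dots> = r / 2" using CL by (simp add: field_simps)
  also have "\<dots> < r" using r by simp
  finally have "norm (Fn e (st (\<gamma> s)) - Fn e (st q) - D (st (\<gamma> s) - st q)) \<le> \<eta> * norm (st (\<gamma> s) - st q)"
    by (rule r(2))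
  also have "\<dots> \<le> \<eta> * (C * L * s)" using n \<eta> by (intro mult_left_mono) auto
  also have "\<dots> = c * s * ((C * L) / (2 * (C * L + 1)))" by (simp add: \<eta>_def)
  also have "\<dots> \<le> c * s * (1/2)" using c s CL by (intro mult_left_mono) (auto simp: field_simps)
  finally have 1: "D (st (\<gamma> s) - st q) - Fn e (st (\<gamma> s)) + Fn e (st q) \<le> c * s / 2"
    unfolding real_norm_def by linarith
  have "c * s \<le> D (st (\<gamma> s) - st q)"
  proof -
    have per: "xi (y (\<gamma> s), \<gamma> s) 0 = xi (y (\<gamma> s), \<gamma> s) 1" "xi (y q, q) 0 = xi (y q, q) 1"
      using fp_periodic(1)[OF e in_dom[OF q] d(2) fp_at[OF q]]
        fp_periodic(1)[OF e in_dom[OF \<gamma>(1)[OF s]] d(2) fp_at[OF \<gamma>(1)[OF s]]] by auto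
    show ?thesis
      unfolding st_def diff_Pair
      by (subst Deq) (use per asc[OF s] in \<open>auto intro: der_diff der_xi\<close>)
  qed
  moreover have "c * s > 0" using c s by simp
  ultimately show False using 1 max[OF \<gamma>(1)[OF s]] by linarith
qed

text \<open>The maximum over one period of the initial time is a maximum over [-1,2] by periodicity,
  so the ends of [0,1] are not boundary points. A nonzero \<open>E1\<close>, \<open>E2\<close> or
  mean of \<open>Ptv\<close> would then be a direction of ascent.\<close>

lemma critical_point:
  "\<exists>q\<in>params {0..1}. E1 e (y q, q) = 0 \<and> E2 e (y q, q) = 0 \<and> unit_integral (Ptv e (y q, q)) = 0"
proof -
  obtain C where C: "C \<ge> 0" "\<And>q q'. q \<in> params {-1..2} \<Longrightarrow> q' \<in> params {-1..2} \<Longrightarrow> norm (st q - st q') \<le> C * dist q q'"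
    using st_lipschitz by blast
  have sub: "params {0..1} \<subseteq> params {-1..2}" by (auto simp: params_def)
  have st: "continuous_on (params {0..1}) st"
  proof (rule lipschitz_on_continuous_on[of C], rule lipschitz_onI[OF _ C(1)])
    show "dist (st q) (st q') \<le> C * dist q q'" if "q \<in> params {0..1}" "q' \<in> params {0..1}" for q q'
      unfolding dist_norm[of "st q"] using that sub by (intro C(2)) auto
  qed
  have "continuous_on (st ` params {0..1}) (Fn e)"
  proof (rule continuous_at_imp_continuous_on, rule ballI)
    fix z assume "z \<in> st ` params {0..1}"
    then obtain q where z: "z = st q" and q: "q \<in> params {-1..2}" using sub by blast
    obtain D where "(Fn e has_derivative D) (at (st q))"
      using fp_derivative[OF e in_dom[OF q] d(2) fp_at[OF q]] unfolding st_def by auto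
    then show "isCont (Fn e) z" unfolding z by (rule has_derivative_continuous)
  qed
  then have "continuous_on (params {0..1}) (\<lambda>q. Fn e (st q))"
    using st by (rule continuous_on_compose2) auto
  moreover have "compact (params {0..1})"
    unfolding params_def by (intro compact_Times compact_sphere compact_Icc)
  moreover have "((1, 0), (1, 0), 0) \<in> params {0..1}" by (simp add: params_def norm_Pair)
  ultimately obtain q where q0: "q \<in> params {0..1}" and max0: "\<And>q'. q' \<in> params {0..1} \<Longrightarrow> Fn e (st q') \<le> Fn e (st q)"
    using continuous_attains_sup[of "params {0..1}" "\<lambda>q. Fn e (st q)"] by blast
  \<comment> \<open>The fixed point for t also solves the equation for t + 1 in the same ball, so
    uniqueness identifies the two.\<close>
  have shift1: "Fn e (st (A, B, t + 1)) = Fn e (st (A, B, t))"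
    if "(A, B, t) \<in> params {-1..2}" "(A, B, t + 1) \<in> params {-1..2}" for A B t
  proof -
    have "Psi e (y (A, B, t), (A, B, t + 1)) = y (A, B, t)" "norm (y (A, B, t)) \<le> d"
      using shift(3)[OF e, of "y (A, B, t)" A B t] y that(1) by auto
    then have "y (A, B, t) = y (A, B, t + 1)" using y that(2) by blast
    then show ?thesis using shift(4)[OF e, of "y (A, B, t)" A B t] by (simp add: st_def)
  qed
  have max: "Fn e (st q') \<le> Fn e (st q)" if q': "q' \<in> params {-1..2}" for q'
  proof -
    obtain A B t where [simp]: "q' = (A, B, t)" by (metis prod.collapse)
    consider "t < 0" | "0 \<le> t" "t \<le> 1" | "1 < t" by linarith
    then show ?thesis
    proof cases
      case 1
      then show ?thesis using shift1[of A B t] max0[of "(A, B, t + 1)"] q' by (auto simp: params_def)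
    next
      case 2
      then show ?thesis using max0[of q'] q' by (auto simp: params_def)
    next
      case 3
      then show ?thesis using shift1[of A B "t - 1"] max0[of "(A, B, t - 1)"] q' by (auto simp: params_def)
    qed
  qed
  have q: "q \<in> params {-1..2}" using q0 sub by blast
  obtain A B t where qq: "q = (A, B, t)" by (metis prod.collapse)
  have ABt: "norm A = 1" "norm B = 1" "0 \<le> t" "t \<le> 1" using q0 by (auto simp: qq params_def)
  let ?p = "(y q, q)"
  note perp = fp_E[OF e in_dom[OF q] d(2) fp_at[OF q]]
  \<comment> \<open>Rational parametrization of the great circle from A towards V: it stays exactly
    on the sphere and leaves A with speed 2.\<close>
  have rot: "norm (((1 - s\<^sup>2) / (1 + s\<^sup>2)) *\<^sub>R A + ((2 * s) / (1 + s\<^sup>2)) *\<^sub>R V) = 1"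
      "norm (((1 - s\<^sup>2) / (1 + s\<^sup>2)) *\<^sub>R A + ((2 * s) / (1 + s\<^sup>2)) *\<^sub>R V - A) \<le> 4 * s"
    if AV: "norm A = 1" "norm V = 1" "V \<bullet> A = 0" and s: "0 < s" "s < 1" for A V :: cc and s
  proof -
    have p: "1 + s\<^sup>2 > 0" by (simp add: add_pos_nonneg)
    have i: "A \<bullet> A = 1" "V \<bullet> V = 1" "A \<bullet> V = 0" using AV by (auto simp: inner_commute[of A] simp flip: power2_norm_eq_inner)
    have "(norm (((1 - s\<^sup>2) / (1 + s\<^sup>2)) *\<^sub>R A + ((2 * s) / (1 + s\<^sup>2)) *\<^sub>R V))\<^sup>2 = ((1 - s\<^sup>2) / (1 + s\<^sup>2))\<^sup>2 + ((2 * s) / (1 + s\<^sup>2))\<^sup>2"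
      unfolding power2_norm_eq_inner by (simp add: inner_add_left inner_add_right i AV(3) power2_eq_square)
    also have "\<dots> = 1\<^sup>2"
    proof -
      have "(1 - s\<^sup>2)\<^sup>2 + (2 * s)\<^sup>2 = (1 + s\<^sup>2)\<^sup>2" by (simp add: power2_eq_square algebra_simps)
      then show ?thesis using p by (simp add: power_divide flip: add_divide_distrib)
    qed
    finally show "norm (((1 - s\<^sup>2) / (1 + s\<^sup>2)) *\<^sub>R A + ((2 * s) / (1 + s\<^sup>2)) *\<^sub>R V) = 1"
      by (rule power2_eq_imp_eq) auto
    have lin: "c *\<^sub>R A + W - A = (c - 1) *\<^sub>R A + W" for c W by (simp add: algebra_simps)
    have "(1 - s\<^sup>2) / (1 + s\<^sup>2) - 1 = - (2 * s\<^sup>2) / (1 + s\<^sup>2)" using p by (simp add: field_simps)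
    then have "((1 - s\<^sup>2) / (1 + s\<^sup>2)) *\<^sub>R A + ((2 * s) / (1 + s\<^sup>2)) *\<^sub>R V - A =
        (- (2 * s\<^sup>2) / (1 + s\<^sup>2)) *\<^sub>R A + ((2 * s) / (1 + s\<^sup>2)) *\<^sub>R V"
      using lin[of "(1 - s\<^sup>2) / (1 + s\<^sup>2)" "((2 * s) / (1 + s\<^sup>2)) *\<^sub>R V"] by metis
    also have "norm \<dots> \<le> (2 * s\<^sup>2) / (1 + s\<^sup>2) + (2 * s) / (1 + s\<^sup>2)"
      using p s AV by (intro norm_triangle_le add_mono) auto
    also have "\<dots> \<le> 2 * s\<^sup>2 + 2 * s"
    proof (intro add_mono)
      show "(2 * s\<^sup>2) / (1 + s\<^sup>2) \<le> 2 * s\<^sup>2" "(2 * s) / (1 + s\<^sup>2) \<le> 2 * s"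
        using s p by (simp_all add: divide_le_eq mult_ge1_I)
    qed
    also have "s\<^sup>2 \<le> s" using s by (simp add: power2_eq_square mult_left_le)
    finally show "norm (((1 - s\<^sup>2) / (1 + s\<^sup>2)) *\<^sub>R A + ((2 * s) / (1 + s\<^sup>2)) *\<^sub>R V - A) \<le> 4 * s" by simp
  qed
  \<comment> \<open>Since \<open>E1\<close> is orthogonal to A, its product with the change of
    \<open>cfp (xi p)\<close> is the new radius times 2 s / (1 + s^2) times |E1|; the change of the
    radius itself drops out. A radius of at least 1/2 yields the slope |E1|. The same holds for
    \<open>E2\<close> and B.\<close>
  have asc: "n * s \<le> 2 * (\<rho> * (((2 * s) / (1 + s\<^sup>2)) * n))" if "13/20 \<le> \<rho>" "0 < s" "s < 1" "n \<ge> 0" for \<rho> n s :: real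
  proof -
    have "s\<^sup>2 \<le> 1" using that by (simp add: power2_eq_square mult_le_one)
    then have "s \<le> (2 * s) / (1 + s\<^sup>2)" using that by (simp add: pos_le_divide_eq add_pos_nonneg) (simp add: algebra_simps mult_left_le)?
    then have 1: "s * n \<le> ((2 * s) / (1 + s\<^sup>2)) * n" using that(4) by (rule mult_right_mono)
    also have "0 \<le> ((2 * s) / (1 + s\<^sup>2)) * n" using that by (auto intro!: mult_nonneg_nonneg divide_nonneg_nonneg)
    then have "((2 * s) / (1 + s\<^sup>2)) * n * 1 \<le> ((2 * s) / (1 + s\<^sup>2)) * n * (2 * \<rho>)" using that by (intro mult_left_mono) auto
    finally show ?thesis by (simp add: mult_ac)
  qed
  have "E1 e ?p = 0"
  proof (rule ccontr)
    assume nz: "E1 e ?p \<noteq> 0"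
    define V where "V = E1 e ?p /\<^sub>R norm (E1 e ?p)"
    have V: "norm V = 1" "V \<bullet> A = 0" using nz perp(1) by (auto simp: qq V_def)
    let ?g = "\<lambda>s. (((1 - s\<^sup>2) / (1 + s\<^sup>2)) *\<^sub>R A + ((2 * s) / (1 + s\<^sup>2)) *\<^sub>R V, B, t)"
    note R = rot[OF ABt(1) V]
    have gin: "?g s \<in> params {-1..2}" if "0 < s" "s < 1" for s using R(1)[OF that] ABt by (auto simp: params_def)
    show False
    proof (rule no_ascent[OF q max, of ?g 4 "norm (E1 e ?p)"])
      fix s :: real assume s: "0 < s" "s < 1"
      show "?g s \<in> params {-1..2}" by (rule gin[OF s])
      show "dist (?g s) q \<le> 4 * s"
        unfolding qq using R(2)[OF s] by (intro order_trans[OF dist_Pair_le]) (simp add: dist_norm)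
      have "E1 e ?p \<bullet> A = 0" "E2 e ?p \<bullet> B = 0" using perp by (auto simp: qq)
      moreover have "E1 e ?p \<bullet> V = norm (E1 e ?p)" using nz by (simp add: V_def dot_square_norm power2_eq_square)
      ultimately show "norm (E1 e ?p) * s \<le> 2 * (E1 e ?p \<bullet> cfp (xi (y (?g s), ?g s) - xi ?p) + E2 e ?p \<bullet> cfm (xi (y (?g s), ?g s) - xi ?p))
         + e * (inverse (bb ?p) * ((snd (snd (?g s)) - snd (snd q)) * unit_integral (Ptv e ?p)))"
        using asc[OF dom_simps(8)[OF in_dom[OF gin[OF s]] d(2)] s norm_ge_zero]
        by (simp add: linear_diff[OF bounded_linear.linear[OF bounded_linear_cfp]] linear_diff[OF bounded_linear.linear[OF bounded_linear_cfm]]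
          cf_xi inner_diff_right inner_add_right del: times_divide_eq_left times_divide_eq_right) (simp add: qq)?
    qed (use nz in auto)
  qed
  moreover have "E2 e ?p = 0"
  proof (rule ccontr)
    assume nz: "E2 e ?p \<noteq> 0"
    define V where "V = E2 e ?p /\<^sub>R norm (E2 e ?p)"
    have V: "norm V = 1" "V \<bullet> B = 0" using nz perp(2) by (auto simp: qq V_def)
    let ?g = "\<lambda>s. (A, ((1 - s\<^sup>2) / (1 + s\<^sup>2)) *\<^sub>R B + ((2 * s) / (1 + s\<^sup>2)) *\<^sub>R V, t)"
    note R = rot[OF ABt(2) V]
    have gin: "?g s \<in> params {-1..2}" if "0 < s" "s < 1" for s using R(1)[OF that] ABt by (auto simp: params_def)
    show False
    proof (rule no_ascent[OF q max, of ?g 4 "norm (E2 e ?p)"])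
      fix s :: real assume s: "0 < s" "s < 1"
      show "?g s \<in> params {-1..2}" by (rule gin[OF s])
      show "dist (?g s) q \<le> 4 * s"
        unfolding qq using R(2)[OF s] by (intro order_trans[OF dist_Pair_le] order_trans[OF add_left_mono[OF dist_Pair_le]]) (simp add: dist_norm)
      have "E1 e ?p \<bullet> A = 0" "E2 e ?p \<bullet> B = 0" using perp by (auto simp: qq)
      moreover have "E2 e ?p \<bullet> V = norm (E2 e ?p)" using nz by (simp add: V_def dot_square_norm power2_eq_square)
      ultimately show "norm (E2 e ?p) * s \<le> 2 * (E1 e ?p \<bullet> cfp (xi (y (?g s), ?g s) - xi ?p) + E2 e ?p \<bullet> cfm (xi (y (?g s), ?g s) - xi ?p))
         + e * (inverse (bb ?p) * ((snd (snd (?g s)) - snd (snd q)) * unit_integral (Ptv e ?p)))"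
        using asc[OF dom_simps(10)[OF in_dom[OF gin[OF s]] d(2)] s norm_ge_zero]
        by (simp add: linear_diff[OF bounded_linear.linear[OF bounded_linear_cfp]] linear_diff[OF bounded_linear.linear[OF bounded_linear_cfm]]
          cf_xi inner_diff_right inner_add_right del: times_divide_eq_left times_divide_eq_right) (simp add: qq)?
    qed (use nz in auto)
  qed
  moreover have "unit_integral (Ptv e ?p) = 0"
  proof (rule ccontr)
    assume nz: "unit_integral (Ptv e ?p) \<noteq> 0"
    have b: "inverse (bb ?p) > 0" using bb_ge[OF in_dom[OF q] d(2)] by simp
    let ?g = "\<lambda>s. (A, B, t + sgn (unit_integral (Ptv e ?p)) * s)"
    have gin: "?g s \<in> params {-1..2}" if "0 < s" "s < 1" for s
      using ABt that by (auto simp: params_def sgn_if)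
    show False
    proof (rule no_ascent[OF q max, of ?g 1 "e * (inverse (bb ?p) * \<bar>unit_integral (Ptv e ?p)\<bar>)"])
      fix s :: real assume s: "0 < s" "s < 1"
      show "?g s \<in> params {-1..2}" by (rule gin[OF s])
      show "dist (?g s) q \<le> 1 * s"
        unfolding qq using s by (simp add: dist_Pair_Pair dist_norm abs_mult abs_sgn_eq)
      have "E1 e ?p \<bullet> A = 0" "E2 e ?p \<bullet> B = 0" using perp by (auto simp: qq)
      then have z: "E1 e ?p \<bullet> cfp (xi (y (?g s), ?g s) - xi ?p) = 0" "E2 e ?p \<bullet> cfm (xi (y (?g s), ?g s) - xi ?p) = 0"
        by (simp_all add: linear_diff[OF bounded_linear.linear[OF bounded_linear_cfp]] linear_diff[OF bounded_linear.linear[OF bounded_linear_cfm]]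
          cf_xi inner_diff_right) (simp_all add: qq)
      have "(snd (snd (?g s)) - snd (snd q)) * unit_integral (Ptv e ?p) = \<bar>unit_integral (Ptv e ?p)\<bar> * s"
        by (cases "unit_integral (Ptv e ?p) > 0") (use nz in \<open>auto simp: qq\<close>)
      then show "e * (inverse (bb ?p) * \<bar>unit_integral (Ptv e ?p)\<bar>) * s \<le>
         2 * (E1 e ?p \<bullet> cfp (xi (y (?g s), ?g s) - xi ?p) + E2 e ?p \<bullet> cfm (xi (y (?g s), ?g s) - xi ?p))
         + e * (inverse (bb ?p) * ((snd (snd (?g s)) - snd (snd q)) * unit_integral (Ptv e ?p)))"
        unfolding z by simp
    qed (use nz b e in auto)
  qed
  ultimately show ?thesis using q0 by blast
qed

end

lemma periodic_orbit:
  "\<exists>e2>0. e2 \<le> e1 \<and> (\<forall>e. 0 < e \<and> e < e2 \<longrightarrow> (\<exists>p. norm (xi p) < 2 \<and> 1/2 \<le> bb p \<and>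
    xi p 0 = xi p 1 \<and> xd p 0 = xd p 1 \<and> unit_integral (Ptv e p) = 0 \<and> GG e p = 0))"
proof -
  obtain e2 d where e2: "e2 > 0" "e2 \<le> e1" and d: "d > 0" "d \<le> d0"
    and y: "\<And>e. 0 < e \<Longrightarrow> e < e2 \<Longrightarrow> \<exists>y. \<forall>q\<in>params {-1..2}.
    norm (y q) \<le> d \<and> Psi e (y q, q) = y q \<and> (\<forall>z. norm z \<le> d \<and> Psi e (z, q) = z \<longrightarrow> z = y q) \<and>
    (\<forall>q'\<in>params {-1..2}. dist (y q) (y q') \<le> dist q q')"
    using fixed_point by blast
  have "\<exists>p. norm (xi p) < 2 \<and> 1/2 \<le> bb p \<and>
    xi p 0 = xi p 1 \<and> xd p 0 = xd p 1 \<and> unit_integral (Ptv e p) = 0 \<and> GG e p = 0" if e: "0 < e" "e < e2" for e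
  proof -
    have ee: "0 < e" "e < e1" using e e2 by auto
    obtain y where y: "\<forall>q\<in>params {-1..2}.
    norm (y q) \<le> d \<and> Psi e (y q, q) = y q \<and> (\<forall>z. norm z \<le> d \<and> Psi e (z, q) = z \<longrightarrow> z = y q) \<and>
    (\<forall>q'\<in>params {-1..2}. dist (y q) (y q') \<le> dist q q')"
      using y[OF e] by blast
    obtain q where q: "q \<in> params {0..1}" and c: "E1 e (y q, q) = 0" "E2 e (y q, q) = 0" "unit_integral (Ptv e (y q, q)) = 0"
      using critical_point[OF ee d y] by blast
    have q: "q \<in> params {-1..2}" using q by (auto simp: params_def)
    then have p: "(y q, q) \<in> cball 0 d \<times> params {-1..2}" "Psi e (y q, q) = fst (y q, q)"
      using y by auto
    have "GG e (y q, q) = 0"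
      using fp_GG[OF ee p(1) d(2) p(2)] c
        linear_0[OF bounded_linear.linear[OF bounded_linear_Ep]] linear_0[OF bounded_linear.linear[OF bounded_linear_Em]] by simp
    then show ?thesis
      using fp_periodic[OF ee p(1) d(2) p(2)] c(3) xi_bound[OF p(1) d(2)] bb_ge[OF p(1) d(2)]
      by (intro exI[of _ "(y q, q)"]) auto
  qed
  with e2 show ?thesis by blast
qed

end

section \<open>Periodic extension and conservation laws\<close>

text \<open>On each [k, k+1] the extension is a translate of \<open>g\<close>, at the right end
  thanks to \<open>g 0 = g 1\<close>; at an integer the two one-sided derivatives agree by
  \<open>g' 0 = g' 1\<close>.\<close>

lemma periodic_extension_derivative:
  fixes g g' :: "real \<Rightarrow> 'b::real_normed_vector"
  assumes der: "\<And>s. s \<in> {0..1} \<Longrightarrow> (g has_vector_derivative g' s) (at s within {0..1})"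
    and ends: "g 0 = g 1" "g' 0 = g' 1"
  shows "((\<lambda>s. g (frac s)) has_vector_derivative g' (frac s)) (at s)"
proof -
  let ?G = "\<lambda>s. g (frac s)"
  have G: "?G r = g (r - of_int k)" if "r \<in> {of_int k..of_int k + 1}" for r and k :: int
  proof (cases "r = of_int k + 1")
    case True
    then show ?thesis using ends by simp
  next
    case False
    then have "\<lfloor>r\<rfloor> = k" using that by (intro floor_unique) auto
    then show ?thesis by (simp add: frac_def)
  qed
  have piece: "(?G has_vector_derivative g' (r - of_int k)) (at r within {of_int k..of_int k + 1})"
    if r: "r \<in> {of_int k..of_int k + 1}" for r and k :: int
  proof (rule has_vector_derivative_transform[OF r G])
    have im: "(\<lambda>r. r - of_int k) ` {of_int k..of_int k + 1} \<subseteq> {0..1::real}" by auto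
    have "((\<lambda>r. r - of_int k) has_vector_derivative 1) (at r within {of_int k..of_int k + 1})"
      by (auto intro!: derivative_eq_intros)
    moreover have "(g has_vector_derivative g' (r - of_int k)) (at (r - of_int k) within (\<lambda>r. r - of_int k) ` {of_int k..of_int k + 1})"
      by (rule has_vector_derivative_within_subset[OF der im]) (use r in auto)
    ultimately have "((g \<circ> (\<lambda>r. r - of_int k)) has_vector_derivative 1 *\<^sub>R g' (r - of_int k)) (at r within {of_int k..of_int k + 1})"
      by (rule vector_diff_chain_within)
    then show "((\<lambda>r. g (r - of_int k)) has_vector_derivative g' (r - of_int k)) (at r within {of_int k..of_int k + 1})"
      by (simp add: o_def)
  qed
  define k where "k = \<lfloor>s\<rfloor>"
  have s: "of_int k \<le> s" "s < of_int k + 1" "frac s = s - of_int k" by (auto simp: k_def frac_def)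
  show ?thesis
  proof (cases "s = of_int k")
    case False
    then have "s \<in> interior {of_int k..of_int k + 1}" using s(1,2) by simp
    have "s \<in> {of_int k..of_int k + 1}" using s by simp
    from piece[OF this] show ?thesis unfolding s(3) at_within_interior[OF \<open>s \<in> interior _\<close>] .
  next
    case True
    have "(?G has_vector_derivative g' 0) (at s within {of_int k..of_int k + 1})"
      using piece[of s k] True by simp
    moreover have "(?G has_vector_derivative g' 0) (at s within {of_int k - 1..of_int k})"
      using piece[of s "k - 1"] True ends by simp
    ultimately have "(?G has_vector_derivative g' 0) (at s within {of_int k - 1..of_int k} \<union> {of_int k..of_int k + 1})"
      unfolding has_vector_derivative_def has_derivative_within by (auto intro: Lim_Un)
    moreover have "{of_int k - 1..of_int k} \<union> {of_int k..of_int k + 1} = {of_int k - 1..of_int k + 1::real}" by auto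
    moreover have "s \<in> interior {of_int k - 1..of_int k + 1}" using True by simp
    ultimately have "(?G has_vector_derivative g' 0) (at s)" by (metis at_within_interior)
    moreover have "frac s = 0" using s(3) True by linarith
    ultimately show ?thesis by metis
  qed
qed

context perturbation
begin

lemma inner_cm_real: "u \<bullet> cm (of_real a * \<i>) w = a * (u \<bullet> cm \<i> w)"
  by (simp add: cm_def inner_prod_def inner_complex_def algebra_simps)

lemma der_at: "der x x' \<Longrightarrow> s \<in> {0..1} \<Longrightarrow> (apply_bcontfun x has_vector_derivative apply_bcontfun x' s) (at s within {0..1})"
  by (simp add: der_def)

text \<open>Here \<open>v = x' - \<alpha> i x\<close> is the gauge covariant velocity and \<open>\<sigma>\<close> is, up to a factor, the Kepler energy;
  the last two clauses are the vanishing of the gauge momentum and the energy relation.\<close>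

definition regularized :: "real \<Rightarrow> (real \<Rightarrow> cc) \<Rightarrow> (real \<Rightarrow> cc) \<Rightarrow> (real \<Rightarrow> real) \<Rightarrow> (real \<Rightarrow> real) \<Rightarrow> real \<Rightarrow> real \<Rightarrow> real set \<Rightarrow> bool" where
  "regularized e x v \<sigma> \<tau> b \<alpha> S \<longleftrightarrow> (\<forall>s\<in>S.
     (x has_vector_derivative (v s + cm (of_real \<alpha> * \<i>) (x s))) (at s within S) \<and>
     (v has_vector_derivative (cm (of_real \<alpha> * \<i>) (v s) + \<sigma> s *\<^sub>R x s + (e / (2 * b\<^sup>2)) *\<^sub>R Px e (\<tau> s) (x s))) (at s within S) \<and>
     (\<tau> has_vector_derivative (norm (x s))\<^sup>2 / b) (at s within S) \<and>
     (\<sigma> has_vector_derivative (- (e / b ^ 3) * Pt e (\<tau> s) (x s))) (at s within S) \<and>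
     norm (x s) < 2 \<and> v s \<bullet> cm \<i> (x s) = 0 \<and>
     (norm (v s))\<^sup>2 = 2 * om\<^sup>2 / b\<^sup>2 + \<sigma> s * (norm (x s))\<^sup>2 + e * P e (\<tau> s) (x s) / b\<^sup>2)"

text \<open>\<open>GG e p = 0\<close> is a second order equation; subtracting the constant rotation
  \<alpha> = J/b from the velocity gives it the regularized form. Gauge momentum and energy defect
  are then constant along the orbit, and their values are found by averaging over [0,1], where the
  nonlocal quantities a, b, J, \<open>c1\<close>, \<open>c2\<close> enter again.\<close>

lemma regularized_unit:
  assumes e: "0 < e" "e < e1" and xi: "norm (xi p) < 2" and b: "1/2 \<le> bb p" and GG: "GG e p = 0"
  defines "\<alpha> \<equiv> JJ p / bb p"
  defines "\<sigma> \<equiv> \<lambda>s. (aa p - 2 * om\<^sup>2 / (bb p)\<^sup>2) / bb p - \<alpha>\<^sup>2 + (e / bb p ^ 3) * (apply_bcontfun (RR e p) s - c1 e p - c2 e p)"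
  defines "v \<equiv> \<lambda>s. apply_bcontfun (xd p) s - cm (of_real \<alpha> * \<i>) (apply_bcontfun (xi p) s)"
  shows "regularized e (apply_bcontfun (xi p)) v \<sigma> (apply_bcontfun (tt p)) (bb p) \<alpha> {0..1}"
proof -
  let ?x = "apply_bcontfun (xi p)" and ?x' = "apply_bcontfun (xd p)" and ?t = "apply_bcontfun (tt p)" and ?b = "bb p"
  define \<kappa> where "\<kappa> = (aa p - 2 * om\<^sup>2 / ?b\<^sup>2) / ?b"
  have b0: "?b > 0" using b by simp
  have xlt: "norm (?x s) < 2" for s using norm_bounded[of "xi p" s] xi by simp
  have gauge: "Px e (?t s) (?x s) \<bullet> cm \<i> (?x s) = 0" for s by (rule P_gauge[OF e xlt])
  have Pvs: "Pv e p s = P e (?t s) (?x s)" "Ptv e p s = Pt e (?t s) (?x s)" "Pxv e p s = Px e (?t s) (?x s)"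
    if "0 \<le> s" "s \<le> 1" for s
    unfolding Pv_def Ptv_def Pxv_def using that e by (simp_all add: bcont01_apply P_cont)
  have dx: "(?x has_vector_derivative (v s + cm (of_real \<alpha> * \<i>) (?x s))) (at s within {0..1})" if "s \<in> {0..1}" for s
    using der_at[OF der_xi that] by (simp add: v_def)
  have xdd: "xdd p s = \<kappa> *\<^sub>R ?x s + cm (2 * of_real \<alpha> * \<i>) (?x' s)
      + (e / (2 * ?b\<^sup>2)) *\<^sub>R Px e (?t s) (?x s) + ((e / ?b ^ 3) * (RR e p s - c1 e p - c2 e p)) *\<^sub>R ?x s"
    if s: "0 \<le> s" "s \<le> 1" for s
  proof -
    have "GG e p s = 0" using GG by simp
    then have "?b *\<^sub>R xdd p s = (aa p - 2 * om\<^sup>2 * (inverse ?b * inverse ?b)) *\<^sub>R ?x s + JJ p *\<^sub>R cm (2 * \<i>) (?x' s)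
        + (e/2) *\<^sub>R qq e p s"
      using s by (simp add: GG_def cmul_apply algebra_simps)
    then have "xdd p s = inverse ?b *\<^sub>R ((aa p - 2 * om\<^sup>2 * (inverse ?b * inverse ?b)) *\<^sub>R ?x s + JJ p *\<^sub>R cm (2 * \<i>) (?x' s)
        + (e/2) *\<^sub>R qq e p s)"
      using b0 by (metis inverse_eq_divide less_irrefl real_vector_eq_affinity add.right_neutral diff_zero scaleR_scaleR left_inverse scaleR_one)
    also have "qq e p s = inverse ?b *\<^sub>R Px e (?t s) (?x s) + (2 * (inverse ?b * inverse ?b) * (RR e p s - (c1 e p + c2 e p))) *\<^sub>R ?x s"
      using s by (simp add: qq_def lift2_apply[OF bounded_bilinear_scaleR] Pvs)
    finally show ?thesis
      using b0 by (simp add: \<kappa>_def \<alpha>_def cm_def prod_eq_iff scaleR_conv_of_real field_simps power2_eq_square power3_eq_cube)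
  qed
  have dv: "(v has_vector_derivative (cm (of_real \<alpha> * \<i>) (v s) + \<sigma> s *\<^sub>R ?x s + (e / (2 * ?b\<^sup>2)) *\<^sub>R Px e (?t s) (?x s))) (at s within {0..1})"
    if s: "s \<in> {0..1}" for s
  proof -
    have "(v has_vector_derivative (xdd p s - cm (of_real \<alpha> * \<i>) (?x' s))) (at s within {0..1})"
      unfolding v_def
      by (intro has_vector_derivative_diff der_at[OF der_xd s]
          bounded_linear.has_vector_derivative[OF cm.bounded_linear_right der_at[OF der_xi s]])
    moreover have "xdd p s - cm (of_real \<alpha> * \<i>) (?x' s) = cm (of_real \<alpha> * \<i>) (v s) + \<sigma> s *\<^sub>R ?x s + (e / (2 * ?b\<^sup>2)) *\<^sub>R Px e (?t s) (?x s)"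
      using s by (simp add: xdd v_def \<sigma>_def \<kappa>_def[symmetric] cm.diff_right)
        (simp add: cm_def prod_eq_iff scaleR_conv_of_real algebra_simps power2_eq_square)
    ultimately show ?thesis by simp
  qed
  have dt: "(?t has_vector_derivative (norm (?x s))\<^sup>2 / ?b) (at s within {0..1})" if s: "s \<in> {0..1}" for s
  proof -
    have "der (const_bcontfun (pt p)) 0" by (auto simp: der_def)
    from der_add[OF this der_scaleR[OF der_prim, of "inverse ?b"]]
    have "der (tt p) (inverse ?b *\<^sub>R lift2 inner (xi p) (xi p))" by (simp add: tt_def)
    from der_at[OF this s] show ?thesis
      using s by (simp add: lift2_apply[OF bounded_bilinear_inner] divide_inverse mult.commute flip: power2_norm_eq_inner)
  qed
  have ds: "(\<sigma> has_vector_derivative (- (e / ?b ^ 3) * Pt e (?t s) (?x s))) (at s within {0..1})" if s: "s \<in> {0..1}" for s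
  proof -
    have "der (const_bcontfun (unit_integral (Ptv e p))) 0" by (auto simp: der_def)
    from der_at[OF der_diff[OF this der_prim] s]
    have "(RR e p has_vector_derivative (- Ptv e p s)) (at s within {0..1})" by (simp add: RR_def)
    then have "(RR e p has_real_derivative (- Ptv e p s)) (at s within {0..1})"
      by (simp add: has_real_derivative_iff_has_vector_derivative)
    then have "((\<lambda>s. K + c * (RR e p s - c1 e p - c2 e p)) has_real_derivative c * (- Ptv e p s)) (at s within {0..1})" for K c
      by (auto intro!: derivative_eq_intros)
    from this[of "(aa p - 2 * om\<^sup>2 / ?b\<^sup>2) / ?b - \<alpha>\<^sup>2" "e / ?b ^ 3"] show ?thesis
      unfolding \<sigma>_def has_real_derivative_iff_has_vector_derivative[symmetric] using s
      by (simp add: Pvs)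
  qed
  have vinner: "v s \<bullet> cm \<i> (?x s) = ?x' s \<bullet> cm \<i> (?x s) - \<alpha> * (?x s \<bullet> ?x s)" for s
    by (simp add: v_def cm_def inner_prod_def inner_complex_def algebra_simps)
  have cont: "continuous_on {0..1} v" "continuous_on {0..1} \<sigma>"
    using dv ds has_vector_derivative_continuous unfolding continuous_on_eq_continuous_within by blast+
  have JJ: "JJ p = integral {0..1} (\<lambda>s. ?x' s \<bullet> cm \<i> (?x s))"
    unfolding JJ_def l2_inner_eq by (rule integral_cong) (simp add: cmul_apply)
  have bI: "?b = integral {0..1} (\<lambda>s. ?x s \<bullet> ?x s)" by (simp add: bb_def l2_inner_eq)
  note I = integrable_continuous_real[where 'a = real]
  have cm_cont: "continuous_on {0..1} (\<lambda>s. cm c (?x s))" for c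
    by (intro bounded_linear.continuous_on[OF cm.bounded_linear_right] continuous_on_apply_bcontfun)
  \<comment> \<open>Constant by gauge invariance of \<open>P\<close>; the mean is J - \<alpha> b,
    which vanishes by the choice of \<alpha>.\<close>
  have j: "v s \<bullet> cm \<i> (?x s) = 0" if s: "s \<in> {0..1}" for s
  proof -
    have d0: "((\<lambda>s. v s \<bullet> cm \<i> (?x s)) has_vector_derivative 0) (at s within {0..1})" if s: "s \<in> {0..1}" for s
    proof -
      have "((\<lambda>s. v s \<bullet> cm \<i> (?x s)) has_vector_derivative
        (v s \<bullet> cm \<i> (v s + cm (of_real \<alpha> * \<i>) (?x s)) + (cm (of_real \<alpha> * \<i>) (v s) + \<sigma> s *\<^sub>R ?x s + (e / (2 * ?b\<^sup>2)) *\<^sub>R Px e (?t s) (?x s)) \<bullet> cm \<i> (?x s))) (at s within {0..1})"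
        by (intro bounded_bilinear.has_vector_derivative[OF bounded_bilinear_inner] dv s
          bounded_linear.has_vector_derivative[OF cm.bounded_linear_right dx])
      moreover have "v s \<bullet> cm \<i> (v s + cm (of_real \<alpha> * \<i>) (?x s)) + (cm (of_real \<alpha> * \<i>) (v s) + \<sigma> s *\<^sub>R ?x s + (e / (2 * ?b\<^sup>2)) *\<^sub>R Px e (?t s) (?x s)) \<bullet> cm \<i> (?x s) = 0"
        using gauge[of s] by (simp add: cm.add_right inner_add_left inner_add_right)
          (simp add: cm_def inner_prod_def inner_complex_def algebra_simps)
      ultimately show ?thesis by simp
    qed
    obtain c where c: "\<And>s. s \<in> {0..1} \<Longrightarrow> v s \<bullet> cm \<i> (?x s) = c"
      using has_vector_derivative_zero_constant[OF convex_real_interval(5) d0] by metis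
    have "c = integral {0..1} (\<lambda>s::real. c)" by simp
    also have "\<dots> = integral {0..1} (\<lambda>s. ?x' s \<bullet> cm \<i> (?x s) - \<alpha> * (?x s \<bullet> ?x s))"
      by (rule integral_cong) (simp add: c[symmetric] vinner)
    also have "\<dots> = JJ p - \<alpha> * ?b"
      unfolding JJ bI
      by (subst Henstock_Kurzweil_Integration.integral_diff; (intro I continuous_intros continuous_on_apply_bcontfun cm_cont)?) simp
    also have "\<dots> = 0" using b0 by (simp add: \<alpha>_def)
    finally show ?thesis using c[OF s] by simp
  qed
  \<comment> \<open>Constant because the drift of \<sigma> compensates the explicit time dependence
    of \<open>P\<close>. In the mean the contributions of \<open>c1\<close>, \<open>c2\<close> and
    \<alpha> cancel, leaving \<open>aa p - \<kappa> * bb p\<close>, which is 2 om^2 / b^2.\<close>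
  have N: "(norm (v s))\<^sup>2 - \<sigma> s * (norm (?x s))\<^sup>2 - e * P e (?t s) (?x s) / ?b\<^sup>2 = 2 * om\<^sup>2 / ?b\<^sup>2" if s: "s \<in> {0..1}" for s
  proof -
    let ?N = "\<lambda>s. v s \<bullet> v s - \<sigma> s * (?x s \<bullet> ?x s) - e / ?b\<^sup>2 * P e (?t s) (?x s)"
    have d0: "(?N has_vector_derivative 0) (at s within {0..1})" if s: "s \<in> {0..1}" for s
    proof -
      define vd where "vd = cm (of_real \<alpha> * \<i>) (v s) + \<sigma> s *\<^sub>R ?x s + (e / (2 * ?b\<^sup>2)) *\<^sub>R Px e (?t s) (?x s)"
      define xx where "xx = v s + cm (of_real \<alpha> * \<i>) (?x s)"
      have "((\<lambda>s. (?t s, ?x s)) has_vector_derivative ((norm (?x s))\<^sup>2 / ?b, xx)) (at s within {0..1})"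
        unfolding xx_def using dt[OF s] dx[OF s] unfolding has_vector_derivative_def
        by (auto intro!: derivative_eq_intros)
      from has_derivative_compose[OF this[unfolded has_vector_derivative_def] P_derivative[OF e xlt]]
      have 1: "((\<lambda>s. P e (?t s) (?x s)) has_vector_derivative (Pt e (?t s) (?x s) * ((norm (?x s))\<^sup>2 / ?b) + Px e (?t s) (?x s) \<bullet> xx)) (at s within {0..1})"
        unfolding has_vector_derivative_def by (simp add: algebra_simps)
      have "(?N has_vector_derivative ((v s \<bullet> vd + vd \<bullet> v s) - (\<sigma> s * (?x s \<bullet> xx + xx \<bullet> ?x s) + (- (e / ?b ^ 3) * Pt e (?t s) (?x s)) * (?x s \<bullet> ?x s))
        - e / ?b\<^sup>2 * (Pt e (?t s) (?x s) * ((norm (?x s))\<^sup>2 / ?b) + Px e (?t s) (?x s) \<bullet> xx))) (at s within {0..1})"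
        unfolding vd_def xx_def
        by (intro has_vector_derivative_diff has_vector_derivative_mult
            bounded_bilinear.has_vector_derivative[OF bounded_bilinear_inner] dv dx ds s
            bounded_linear.has_vector_derivative[OF bounded_linear_mult_right 1[unfolded xx_def]])
      moreover have "?x s \<bullet> xx = ?x s \<bullet> v s" "xx \<bullet> ?x s = ?x s \<bullet> v s" "Px e (?t s) (?x s) \<bullet> xx = Px e (?t s) (?x s) \<bullet> v s"
        "v s \<bullet> vd = \<sigma> s * (?x s \<bullet> v s) + (e / (2 * ?b\<^sup>2)) * (Px e (?t s) (?x s) \<bullet> v s)"
        "vd \<bullet> v s = \<sigma> s * (?x s \<bullet> v s) + (e / (2 * ?b\<^sup>2)) * (Px e (?t s) (?x s) \<bullet> v s)"
        using gauge[of s]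
        by (simp_all add: xx_def vd_def inner_add_left inner_add_right inner_cm_real inner_commute[of "v s" "Px e (?t s) (?x s)"])
          (simp_all add: cm_def inner_prod_def inner_complex_def algebra_simps)
      then have "(v s \<bullet> vd + vd \<bullet> v s) - (\<sigma> s * (?x s \<bullet> xx + xx \<bullet> ?x s) + (- (e / ?b ^ 3) * Pt e (?t s) (?x s)) * (?x s \<bullet> ?x s))
        - e / ?b\<^sup>2 * (Pt e (?t s) (?x s) * ((norm (?x s))\<^sup>2 / ?b) + Px e (?t s) (?x s) \<bullet> xx) = 0"
        using b0 by (simp only: power2_norm_eq_inner) (simp add: power2_eq_square power3_eq_cube field_simps)
      ultimately show ?thesis by (simp only:)
    qed
    obtain c where c: "\<And>s. s \<in> {0..1} \<Longrightarrow> ?N s = c"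
      using has_vector_derivative_zero_constant[OF convex_real_interval(5) d0] by metis
    let ?R = "\<lambda>s. RR e p s * (?x s \<bullet> ?x s)"
    have Rx: "integral {0..1} ?R = c1 e p * ?b"
    proof -
      have "integral {0..1} ?R = l2_inner (lift2 scaleR (RR e p) (xi p)) (xi p)"
        unfolding l2_inner_eq by (rule integral_cong) (simp add: lift2_apply[OF bounded_bilinear_scaleR])
      then show ?thesis using b0 by (simp add: RR_by_parts[symmetric] c1_eq)
    qed
    have "c = integral {0..1} (\<lambda>s::real. c)" by simp
    also have "\<dots> = integral {0..1} (\<lambda>s. (?x' s \<bullet> ?x' s - (2 * \<alpha>) * (?x' s \<bullet> cm \<i> (?x s)) + \<alpha>\<^sup>2 * (?x s \<bullet> ?x s))
        - ((\<kappa> - \<alpha>\<^sup>2 - (e / ?b ^ 3) * (c1 e p + c2 e p)) * (?x s \<bullet> ?x s) + (e / ?b ^ 3) * ?R s) - e / ?b\<^sup>2 * P e (?t s) (?x s))"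
    proof (rule integral_cong)
      fix s :: real assume "s \<in> {0..1}"
      have "v s \<bullet> v s = ?x' s \<bullet> ?x' s - (2 * \<alpha>) * (?x' s \<bullet> cm \<i> (?x s)) + \<alpha>\<^sup>2 * (?x s \<bullet> ?x s)"
        by (simp add: v_def cm_def inner_prod_def inner_complex_def algebra_simps power2_eq_square)
      then show "c = (?x' s \<bullet> ?x' s - (2 * \<alpha>) * (?x' s \<bullet> cm \<i> (?x s)) + \<alpha>\<^sup>2 * (?x s \<bullet> ?x s))
        - ((\<kappa> - \<alpha>\<^sup>2 - (e / ?b ^ 3) * (c1 e p + c2 e p)) * (?x s \<bullet> ?x s) + (e / ?b ^ 3) * ?R s) - e / ?b\<^sup>2 * P e (?t s) (?x s)"
        using c[OF \<open>s \<in> {0..1}\<close>] by (simp add: \<sigma>_def \<kappa>_def[symmetric] algebra_simps)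
    qed
    also have "\<dots> = (aa p - (2 * \<alpha>) * JJ p + \<alpha>\<^sup>2 * ?b) - ((\<kappa> - \<alpha>\<^sup>2 - (e / ?b ^ 3) * (c1 e p + c2 e p)) * ?b + (e / ?b ^ 3) * (c1 e p * ?b))
       - e / ?b\<^sup>2 * c2 e p"
    proof -
      note ii = integrable_integral[OF I] continuous_intros continuous_on_apply_bcontfun cm_cont P_cont e
      have "integral {0..1} (\<lambda>s. P e (?t s) (?x s)) = c2 e p"
        unfolding c2_def unit_integral_def by (rule integral_cong) (simp add: Pvs)
      then have 1: "((\<lambda>s. P e (?t s) (?x s)) has_integral c2 e p) {0..1}"
        by (metis integrable_integral I P_cont(1)[OF e])
      have 2: "((\<lambda>s. ?x' s \<bullet> ?x' s) has_integral aa p) {0..1}"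
        unfolding aa_def l2_inner_eq by (intro ii)
      have 3: "((\<lambda>s. ?x s \<bullet> ?x s) has_integral ?b) {0..1}"
        unfolding bb_def l2_inner_eq by (intro ii)
      have 4: "((\<lambda>s. ?x' s \<bullet> cm \<i> (?x s)) has_integral JJ p) {0..1}"
        unfolding JJ by (intro ii)
      have 5: "(?R has_integral c1 e p * ?b) {0..1}"
        unfolding Rx[symmetric] by (intro ii)
      show ?thesis
        by (intro integral_unique has_integral_diff has_integral_add has_integral_mult_right 1 2 3 4 5)
    qed
    also have "\<dots> = 2 * om\<^sup>2 / ?b\<^sup>2"
      using b0 by (simp add: \<kappa>_def \<alpha>_def field_simps power2_eq_square power3_eq_cube)
    finally show ?thesis using c[OF s] by (simp add: power2_norm_eq_inner)
  qed
  show ?thesis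
    unfolding regularized_def
  proof (intro ballI conjI)
    fix s :: real assume s: "s \<in> {0..1}"
    show "(norm (v s))\<^sup>2 = 2 * om\<^sup>2 / ?b\<^sup>2 + \<sigma> s * (norm (?x s))\<^sup>2 + e * P e (?t s) (?x s) / ?b\<^sup>2"
      using N[OF s] by simp
  qed (use dx dv dt ds j xlt in auto)
qed

lemma P_periodic_int:
  assumes e: "0 < e" "e < e1"
  shows "P e (t + of_int k) x = P e t x" "Pt e (t + of_int k) x = Pt e t x" "Px e (t + of_int k) x = Px e t x"
proof -
  have "P e (t + of_int k) x = P e t x \<and> Pt e (t + of_int k) x = Pt e t x \<and> Px e (t + of_int k) x = Px e t x"
  proof (induction k rule: int_induct[where k = 0])
    case (step1 i)
    then show ?case using P_periodic[OF e, of "t + of_int i" x] by (simp add: algebra_simps)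
  next
    case (step2 i)
    then show ?case using P_periodic[OF e, of "t + of_int (i - 1)" x] by (simp add: algebra_simps)
  qed simp
  then show "P e (t + of_int k) x = P e t x" "Pt e (t + of_int k) x = Pt e t x" "Px e (t + of_int k) x = Px e t x" by auto
qed

lemma regularized_extension:
  assumes e: "0 < e" "e < e1" and r: "regularized e x v \<sigma> \<tau> b \<alpha> {0..1}" and b: "b > 0"
    and ends: "x 0 = x 1" "v 0 = v 1" "\<sigma> 0 = \<sigma> 1" "\<tau> 1 = \<tau> 0 + 1"
  shows "regularized e (\<lambda>s. x (frac s)) (\<lambda>s. v (frac s)) (\<lambda>s. \<sigma> (frac s)) (\<lambda>s. \<tau> (frac s) + of_int \<lfloor>s\<rfloor>) b \<alpha> UNIV"
proof -
  have R: "(x has_vector_derivative (v s + cm (of_real \<alpha> * \<i>) (x s))) (at s within {0..1})"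
     "(v has_vector_derivative (cm (of_real \<alpha> * \<i>) (v s) + \<sigma> s *\<^sub>R x s + (e / (2 * b\<^sup>2)) *\<^sub>R Px e (\<tau> s) (x s))) (at s within {0..1})"
     "(\<tau> has_vector_derivative (norm (x s))\<^sup>2 / b) (at s within {0..1})"
     "(\<sigma> has_vector_derivative (- (e / b ^ 3) * Pt e (\<tau> s) (x s))) (at s within {0..1})"
     "norm (x s) < 2" "v s \<bullet> cm \<i> (x s) = 0"
     "(norm (v s))\<^sup>2 = 2 * om\<^sup>2 / b\<^sup>2 + \<sigma> s * (norm (x s))\<^sup>2 + e * P e (\<tau> s) (x s) / b\<^sup>2"
    if "s \<in> {0..1}" for s
    using r that unfolding regularized_def by auto
  have fr: "frac s \<in> {0..1}" for s :: real using frac_ge_0[of s] frac_lt_1[of s] by simp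
  have P0: "P e (\<tau> 1) u = P e (\<tau> 0) u" "Pt e (\<tau> 1) u = Pt e (\<tau> 0) u" "Px e (\<tau> 1) u = Px e (\<tau> 0) u" for u
    using P_periodic[OF e, of "\<tau> 0" u] ends(4) by auto
  have d1: "((\<lambda>s. x (frac s)) has_vector_derivative (v (frac s) + cm (of_real \<alpha> * \<i>) (x (frac s)))) (at s)" for s
    by (rule periodic_extension_derivative[OF R(1)]) (use ends in auto)
  have d2: "((\<lambda>s. v (frac s)) has_vector_derivative (cm (of_real \<alpha> * \<i>) (v (frac s)) + \<sigma> (frac s) *\<^sub>R x (frac s)
      + (e / (2 * b\<^sup>2)) *\<^sub>R Px e (\<tau> (frac s)) (x (frac s)))) (at s)" for s
    by (rule periodic_extension_derivative[OF R(2)]) (use ends P0 in auto)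
  have d4: "((\<lambda>s. \<sigma> (frac s)) has_vector_derivative (- (e / b ^ 3) * Pt e (\<tau> (frac s)) (x (frac s)))) (at s)" for s
    by (rule periodic_extension_derivative[OF R(4)]) (use ends P0 in auto)
  have d3: "((\<lambda>s. \<tau> (frac s) + of_int \<lfloor>s\<rfloor>) has_vector_derivative (norm (x (frac s)))\<^sup>2 / b) (at s)" for s
  proof -
    \<comment> \<open>The clock advances by 1 per period, so gluing applies to \<tau> minus the
      identity.\<close>
    have "((\<lambda>s. \<tau> s - s) has_vector_derivative ((norm (x s))\<^sup>2 / b - 1)) (at s within {0..1})" if "s \<in> {0..1}" for s
      using R(3)[OF that] by (auto intro!: derivative_eq_intros)
    from periodic_extension_derivative[OF this, of s]
    have "((\<lambda>s. (\<tau> (frac s) - frac s) + s) has_vector_derivative ((norm (x (frac s)))\<^sup>2 / b - 1) + 1) (at s)"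
      using ends by (intro has_vector_derivative_add has_vector_derivative_id) auto
    then show ?thesis by (simp add: frac_def algebra_simps)
  qed
  show ?thesis
    unfolding regularized_def P_periodic_int[OF e]
    using d1 d2 d3 d4 R(5-7)[OF fr] by blast
qed

lemma regularized_orbit:
  "\<exists>e2>0. e2 \<le> e1 \<and> (\<forall>e. 0 < e \<and> e < e2 \<longrightarrow> (\<exists>x v \<sigma> \<tau> b \<alpha>. regularized e x v \<sigma> \<tau> b \<alpha> UNIV \<and> b > 0 \<and>
     (\<forall>s. x (s + 1) = x s) \<and> (\<forall>s. \<tau> (s + 1) = \<tau> s + 1) \<and> (\<exists>s. 1/2 \<le> norm (x s))))"
proof -
  obtain e2 where e2: "e2 > 0" "e2 \<le> e1" and orb: "\<And>e. 0 < e \<Longrightarrow> e < e2 \<Longrightarrow> \<exists>p. norm (xi p) < 2 \<and> 1/2 \<le> bb p \<and>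
    xi p 0 = xi p 1 \<and> xd p 0 = xd p 1 \<and> unit_integral (Ptv e p) = 0 \<and> GG e p = 0"
    using periodic_orbit by blast
  have key: "\<exists>x v \<sigma> \<tau> b \<alpha>. regularized e x v \<sigma> \<tau> b \<alpha> UNIV \<and> b > 0 \<and>
     (\<forall>s. x (s + 1) = x s) \<and> (\<forall>s. \<tau> (s + 1) = \<tau> s + 1) \<and> (\<exists>s. 1/2 \<le> norm (x s))" if e: "0 < e" "e < e2" for e
  proof -
    have ee: "0 < e" "e < e1" using e e2 by auto
    obtain p where p: "norm (xi p) < 2" "1/2 \<le> bb p" "GG e p = 0"
      and ends: "xi p 0 = xi p 1" "xd p 0 = xd p 1" "unit_integral (Ptv e p) = 0"
      using orb[OF e] by auto
    note reg = regularized_unit[OF ee p]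
    \<comment> \<open>The vanishing mean of \<open>Ptv\<close>, that is, criticality in the initial
      time, is exactly what makes \<open>RR\<close> and with it \<sigma> return after one
      period.\<close>
    have R01: "RR e p 0 = RR e p 1" using ends(3) by (simp add: RR_def prim_apply unit_integral_def)
    have b0: "bb p > 0" using p(2) by simp
    have "tt p 1 = tt p 0 + 1"
    proof -
      have "prim (lift2 inner (xi p) (xi p)) 1 = bb p" by (simp add: prim_apply bb_def l2_inner_def unit_integral_def)
      then show ?thesis using b0 by (simp add: tt_def prim_apply)
    qed
    define X where "X s = xi p (frac s)" for s
    define V where "V s = xd p (frac s) - cm (of_real (JJ p / bb p) * \<i>) (xi p (frac s))" for s
    define Z where "Z s = (aa p - 2 * om\<^sup>2 / (bb p)\<^sup>2) / bb p - (JJ p / bb p)\<^sup>2 + (e / bb p ^ 3) * (RR e p (frac s) - c1 e p - c2 e p)" for s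
    define T where "T s = tt p (frac s) + of_int \<lfloor>s\<rfloor>" for s
    have "regularized e X V Z T (bb p) (JJ p / bb p) UNIV"
      unfolding X_def[abs_def] V_def[abs_def] Z_def[abs_def] T_def[abs_def]
      by (rule regularized_extension[OF ee reg b0 ends(1) _ _ \<open>tt p 1 = tt p 0 + 1\<close>]) (use ends R01 in simp_all)
    \<comment> \<open>If |x| stayed below 1/2, its mean square b would be at most 1/4. As
      \<open>frac\<close> never takes the value 1, that end point is treated through
      periodicity.\<close>
    moreover obtain s0 where "1/2 \<le> norm (xi p (frac s0))"
    proof (rule ccontr)
      assume "\<not> thesis"
      then have no: "\<And>s. \<not> 1/2 \<le> norm (xi p (frac s))" using that by blast
      have "norm (xi p s) \<le> 1/2" if "s \<in> {0..1}" for s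
      proof (cases "s = 1")
        case True
        then show ?thesis using no ends(1) by (metis frac_of_int of_int_0 linear not_le order.strict_implies_order)
      next
        case False
        then have "frac s = s" using that by (simp add: frac_eq)
        then show ?thesis using no by (metis less_imp_le not_le)
      qed
      then have sq: "xi p s \<bullet> xi p s \<le> (1/2)\<^sup>2" if "s \<in> {0..1}" for s
        using that by (subst power2_norm_eq_inner[symmetric]) (intro power_mono, auto)
      have "bb p \<le> integral {0..1} (\<lambda>s::real. (1/2)\<^sup>2)"
        unfolding bb_def l2_inner_eq by (intro integral_le integrable_continuous_real continuous_intros continuous_on_apply_bcontfun sq)
      then show False using p(2) by (simp add: power2_eq_square)
    qed
    then have "\<exists>s. 1/2 \<le> norm (X s)" by (auto simp: X_def)
    moreover have "T (s + 1) = T s + 1" "X (s + 1) = X s" for s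
      by (simp_all add: frac_def T_def X_def)
    ultimately show ?thesis using b0
      by (intro exI[of _ X] exI[of _ V] exI[of _ Z] exI[of _ T] exI[of _ "bb p"] exI[of _ "JJ p / bb p"]) auto
  qed
  show ?thesis
    by (intro exI[of _ e2] conjI allI impI e2 key; elim conjE)
qed

end

section \<open>The Hopf map and return to physical time\<close>

text \<open>Polarization of the Hopf (Kustaanheimo--Stiefel) map.\<close>

definition hpol :: "cc \<Rightarrow> cc \<Rightarrow> real^3" where
  "hpol x y = vector [Re (fst x * cnj (fst y)) - Re (snd x * cnj (snd y)),
     Re (fst x * cnj (snd y) + fst y * cnj (snd x)), Im (fst x * cnj (snd y) + fst y * cnj (snd x))]"

text \<open>Transpose of \<open>hpol x\<close>, so that \<open>2 *\<^sub>R hadj x g\<close> is the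
  gradient of \<open>g \<bullet> hopf x\<close> in x.\<close>

definition hadj :: "cc \<Rightarrow> real^3 \<Rightarrow> cc" where
  "hadj x g = (of_real (g$1) * fst x + Complex (g$2) (g$3) * snd x, Complex (g$2) (- (g$3)) * fst x - of_real (g$1) * snd x)"

abbreviation "hopf x \<equiv> hpol x x"

lemmas hopf_simps = hpol_def hadj_def cm_def vec_eq_iff forall_3 vector_3 inner_vec_def sum_3 inner_prod_def inner_complex_def

lemma inner_hpol: "g \<bullet> hpol x y = hadj x g \<bullet> y"
  by (simp add: hopf_simps algebra_simps)

lemma hopf_inner: "hopf x \<bullet> hopf x = (x \<bullet> x)\<^sup>2"
  by (simp add: hopf_simps power2_eq_square algebra_simps)

lemma norm_hopf: "norm (hopf x) = (norm x)\<^sup>2"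
proof -
  have "(norm (hopf x))\<^sup>2 = ((norm x)\<^sup>2)\<^sup>2"
    unfolding power2_norm_eq_inner by (rule hopf_inner)
  then show ?thesis by (simp add: power2_eq_imp_eq)
qed

lemma hpol_i [simp]: "hpol x (cm \<i> x) = 0" "hpol (cm \<i> x) y + hpol x (cm \<i> y) = 0"
  by (auto simp: hopf_simps algebra_simps)

text \<open>Conformality of the Hopf map: up to a factor, its derivative times the transpose is a
  multiple of the identity. Hence the gradient of the lifted potential projects to the gradient in
  space.\<close>

lemma hpol_hadj: "hpol x (hadj x g) = (x \<bullet> x) *\<^sub>R g"
  by (simp add: hopf_simps algebra_simps)

lemma hpol_comm: "hpol x y = hpol y x"
  by (simp add: hopf_simps algebra_simps)

text \<open>Both rest on the vanishing gauge momentum of \<open>v\<close>. The first expresses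
  \<open>hpol v v\<close> by position and velocity; the second says that the Hopf map stretches
  horizontal vectors uniformly and yields the kinetic energy.\<close>

lemma hpol_kepler:
  assumes "v \<bullet> cm \<i> x = 0"
  shows "(x \<bullet> x) *\<^sub>R hpol v v + (v \<bullet> v) *\<^sub>R hpol x x = (2 * (x \<bullet> v)) *\<^sub>R hpol x v"
    and "hpol x v \<bullet> hpol x v = (x \<bullet> x) * (v \<bullet> v)"
proof -
  obtain a b c d where x: "x = (Complex a b, Complex c d)" by (metis complex.exhaust prod.exhaust)
  obtain p q r s where v: "v = (Complex p q, Complex r s)" by (metis complex.exhaust prod.exhaust)
  have 0: "a * q - b * p + c * s - d * r = 0"
    using assms by (simp add: x v hopf_simps algebra_simps)
  show "(x \<bullet> x) *\<^sub>R hpol v v + (v \<bullet> v) *\<^sub>R hpol x x = (2 * (x \<bullet> v)) *\<^sub>R hpol x v"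
    using 0 by (simp add: x v hopf_simps) (intro conjI; algebra)
  show "hpol x v \<bullet> hpol x v = (x \<bullet> x) * (v \<bullet> v)"
    using 0 by (simp add: x v hopf_simps) algebra
qed

lemma bounded_bilinear_hpol: "bounded_bilinear hpol"
  unfolding bilinear_conv_bounded_bilinear[symmetric] bilinear_def linear_iff
  by (auto simp: hopf_simps algebra_simps)

interpretation hpol: bounded_bilinear hpol by (rule bounded_bilinear_hpol)

lemma has_vector_derivative_slope:
  assumes "(f has_vector_derivative D) (at s)"
  shows "((\<lambda>r. (f r - f s) /\<^sub>R (r - s)) \<longlongrightarrow> D) (at s)"
proof (rule LIM_zero_cancel, rule tendsto_norm_zero_cancel)
  have "((\<lambda>r. norm (f r - f s - (r - s) *\<^sub>R D) / norm (r - s)) \<longlongrightarrow> 0) (at s)"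
    using assms by (simp add: has_vector_derivative_def has_derivative_iff_norm)
  moreover have "norm (f r - f s - (r - s) *\<^sub>R D) / norm (r - s) = norm ((f r - f s) /\<^sub>R (r - s) - D)" if "r \<noteq> s" for r
  proof -
    have "(f r - f s) /\<^sub>R (r - s) - D = (f r - f s - (r - s) *\<^sub>R D) /\<^sub>R (r - s)"
      using that by (simp add: scaleR_diff_right)
    then show ?thesis by (simp add: divide_inverse mult.commute abs_inverse)
  qed
  then have "\<forall>\<^sub>F r in at s. norm (f r - f s - (r - s) *\<^sub>R D) / norm (r - s) = norm ((f r - f s) /\<^sub>R (r - s) - D)"
    by (simp add: eventually_at_filter)
  ultimately show "((\<lambda>r. norm ((f r - f s) /\<^sub>R (r - s) - D)) \<longlongrightarrow> 0) (at s)"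
    using tendsto_cong by fast
qed

lemma cm_real_i: "cm (of_real a * \<i>) y = a *\<^sub>R cm \<i> y"
  by (simp flip: cm_of_real)

text \<open>The factor |y|^2 in \<open>P_V\<close> is the density of physical time with respect to
  s, and \<open>Px_V\<close> is the gradient of the product. The ball of radius 4 is the Hopf image
  of |x| < 2.\<close>

locale regular_orbit = perturbation +
  fixes e :: real and x v :: "real \<Rightarrow> cc" and \<sigma> \<tau> :: "real \<Rightarrow> real" and b \<alpha> :: real
    and V :: "real \<Rightarrow> real^3 \<Rightarrow> real" and gV :: "real \<Rightarrow> real^3 \<Rightarrow> real^3"
  assumes e: "0 < e" "e < e1" and reg: "regularized e x v \<sigma> \<tau> b \<alpha> UNIV" and b: "b > 0"
    and x_per: "\<And>s. x (s + 1) = x s" and \<tau>_per: "\<And>s. \<tau> (s + 1) = \<tau> s + 1"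
    and P_V: "\<And>t y. norm y < 2 \<Longrightarrow> P e t y = V t (hopf y) * (norm y)\<^sup>2"
    and Px_V: "\<And>t y. norm y < 2 \<Longrightarrow> Px e t y = (2 * V t (hopf y)) *\<^sub>R y + (2 * (norm y)\<^sup>2) *\<^sub>R hadj y (gV t (hopf y))"
    and V_cont: "continuous_on (UNIV \<times> ball 0 4) (\<lambda>(t, y). V t y)"
begin

section \<open>Collisions and the physical clock\<close>

lemma orbit:
  "(x has_vector_derivative (v s + cm (of_real \<alpha> * \<i>) (x s))) (at s)"
  "(v has_vector_derivative (cm (of_real \<alpha> * \<i>) (v s) + \<sigma> s *\<^sub>R x s + (e / (2 * b\<^sup>2)) *\<^sub>R Px e (\<tau> s) (x s))) (at s)"
  "(\<tau> has_real_derivative (norm (x s))\<^sup>2 / b) (at s)"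
  "(\<sigma> has_vector_derivative (- (e / b ^ 3) * Pt e (\<tau> s) (x s))) (at s)"
  "norm (x s) < 2" "v s \<bullet> cm \<i> (x s) = 0"
  "(norm (v s))\<^sup>2 = 2 * om\<^sup>2 / b\<^sup>2 + \<sigma> s * (norm (x s))\<^sup>2 + e * P e (\<tau> s) (x s) / b\<^sup>2"
  using reg by (auto simp: regularized_def has_real_derivative_iff_has_vector_derivative)

text \<open>At a zero of \<open>x\<close> the energy relation reduces to
  \<open>(norm (v s))\<^sup>2 = 2 * om\<^sup>2 / b\<^sup>2\<close>. Collisions are therefore simple
  zeros, which makes them isolated and gives them a limiting direction.\<close>

lemma zero_velocity: "x s = 0 \<Longrightarrow> v s \<noteq> 0"
  using orbit(7)[of s] P_V[of 0 "\<tau> s"] om b by auto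

lemma zero_isolated:
  assumes "x s = 0"
  shows "\<forall>\<^sub>F r in at s. x r \<noteq> 0"
proof -
  have "((\<lambda>r. (x r - x s) /\<^sub>R (r - s)) \<longlongrightarrow> v s) (at s)"
    using has_vector_derivative_slope[OF orbit(1)[of s]] assms by simp
  from tendsto_imp_eventually_ne[OF this zero_velocity[OF assms]] show ?thesis
    by (rule eventually_mono) (use assms in auto)
qed

text \<open>The clock slows to speed zero only at collisions; were it constant on an interval, that
  interval would consist of collisions, which are isolated.\<close>

lemma \<tau>_strict_mono: "r < s \<Longrightarrow> \<tau> r < \<tau> s"
proof -
  assume rs: "r < s"
  have mono: "\<tau> p \<le> \<tau> q" if "p \<le> q" for p q
    using DERIV_nonneg_imp_nondecreasing[OF that, of \<tau>] orbit(3) b by (meson divide_nonneg_pos zero_le_power2)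
  show ?thesis
  proof (rule ccontr)
    assume "\<not> \<tau> r < \<tau> s"
    then have c: "\<tau> m = \<tau> r" if "m \<in> {r<..<s}" for m
      using mono[of r m] mono[of m s] that by auto
    have x0: "x m = 0" if "m \<in> {r<..<s}" for m
    proof -
      have "(\<tau> has_real_derivative 0) (at m)"
        by (rule DERIV_cong_ev[OF refl _ refl, THEN iffD2, OF _ DERIV_const[of "\<tau> r"]])
           (use c that in \<open>auto intro!: eventually_nhds_in_open[THEN eventually_mono, of "{r<..<s}"]\<close>)
      from DERIV_unique[OF this orbit(3)] show ?thesis using b by simp
    qed
    let ?m = "(r + s) / 2"
    have m: "?m \<in> {r<..<s}" using rs by auto
    have "\<forall>\<^sub>F q in at ?m. q \<in> {r<..<s}"
      using m by (intro eventually_at_in_open') auto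
    then have "\<forall>\<^sub>F q in at ?m. x q = 0" by (rule eventually_mono) (rule x0)
    with zero_isolated[OF x0[OF m]] have "\<forall>\<^sub>F q in at ?m. False" by eventually_elim auto
    then show False by simp
  qed
qed

lemma \<tau>_less_iff [simp]: "\<tau> r < \<tau> s \<longleftrightarrow> r < s" and \<tau>_le_iff [simp]: "\<tau> r \<le> \<tau> s \<longleftrightarrow> r \<le> s"
  and \<tau>_eq_iff [simp]: "\<tau> r = \<tau> s \<longleftrightarrow> r = s"
  using \<tau>_strict_mono by (metis linorder_cases order.asym order.irrefl not_le)+

lemma \<tau>_cont: "continuous_on A \<tau>"
  using orbit(3) DERIV_isCont continuous_at_imp_continuous_on by blast

lemma \<tau>_per_nat: "\<tau> (s + of_nat n) = \<tau> s + of_nat n" "\<tau> (s - of_nat n) = \<tau> s - of_nat n"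
proof -
  show 1: "\<tau> (s + of_nat n) = \<tau> s + of_nat n" for s
    by (induction n) (use \<tau>_per in \<open>auto simp: add.assoc[symmetric] add.commute[of 1]\<close>)
  show "\<tau> (s - of_nat n) = \<tau> s - of_nat n" using 1[of "s - of_nat n"] by simp
qed

lemma \<tau>_surj: "\<exists>s. \<tau> s = t"
proof -
  obtain n :: nat where n: "\<bar>t - \<tau> 0\<bar> \<le> of_nat n" using real_arch_simple by blast
  then have "\<tau> (0 - of_nat n) \<le> t" "t \<le> \<tau> (0 + of_nat n)" unfolding \<tau>_per_nat by auto
  then obtain s where "\<tau> s = t" using IVT'[OF _ _ _ \<tau>_cont, of "0 - of_nat n" t "0 + of_nat n"] by auto
  then show ?thesis by blast
qed

definition clock :: "real \<Rightarrow> real" where "clock t = inv \<tau> t"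

lemma \<tau>_clock [simp]: "\<tau> (clock t) = t"
  unfolding clock_def by (rule f_inv_into_f) (use \<tau>_surj in \<open>auto simp: image_def, metis\<close>)

lemma clock_\<tau> [simp]: "clock (\<tau> s) = s"
  by (metis \<tau>_clock \<tau>_eq_iff)

lemma clock_le_iff [simp]: "clock r \<le> clock s \<longleftrightarrow> r \<le> s"
  using \<tau>_le_iff[of "clock r" "clock s"] by simp

lemma clock_eq_iff [simp]: "clock r = clock s \<longleftrightarrow> r = s"
  by (metis \<tau>_clock)

lemma clock_per: "clock (t + 1) = clock t + 1"
  using \<tau>_per[of "clock t"] by (metis \<tau>_clock \<tau>_eq_iff)

lemma clock_cont: "continuous_on UNIV clock"
proof (rule continuous_onI_mono)
  have "range clock = UNIV" by (metis clock_\<tau> surjI)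
  then show "open (range clock)" by simp
qed simp

lemma clock_isCont: "isCont clock t"
  using clock_cont by (simp add: continuous_on_eq_continuous_at)

lemma x_isCont: "isCont x s" and \<sigma>_isCont: "isCont \<sigma> s"
  using orbit(1,4) has_vector_derivative_continuous by blast+

lemma filterlim_clock: "filterlim clock (at (clock t)) (at t)"
  unfolding filterlim_at using clock_isCont[of t]
  by (auto simp: isCont_def eventually_at intro!: exI[of _ 1])

lemma clock_derivative:
  assumes "x (clock t) \<noteq> 0"
  shows "(clock has_vector_derivative b / (norm (x (clock t)))\<^sup>2) (at t)"
proof -
  have "DERIV clock t :> inverse ((norm (x (clock t)))\<^sup>2 / b)"
    by (rule DERIV_inverse_function[where f = \<tau> and a = "t - 1" and b = "t + 1"])
       (use assms b orbit(3) clock_isCont in auto)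
  then show ?thesis by (simp add: has_real_derivative_iff_has_vector_derivative)
qed

section \<open>Position, velocity and energy in physical time\<close>

definition u0 :: "real \<Rightarrow> real^3" where "u0 t = hopf (x (clock t))"
text \<open>Written with the covariant velocity \<open>v\<close>, because \<open>hpol x\<close>
  annihilates the gauge part of x'.\<close>

definition u1 :: "real \<Rightarrow> real^3" where
  "u1 t = (2 * b / (norm (x (clock t)))\<^sup>2) *\<^sub>R hpol (x (clock t)) (v (clock t))"

lemma hopf_eq_0 [simp]: "hopf y = 0 \<longleftrightarrow> y = 0"
  by (metis norm_hopf norm_eq_zero power2_eq_square mult_eq_0_iff)

lemma u0_eq_0: "u0 t = 0 \<longleftrightarrow> x (clock t) = 0"
  by (simp add: u0_def)

lemma norm_u0: "norm (u0 t) = (norm (x (clock t)))\<^sup>2"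
  by (simp add: u0_def norm_hopf)

lemma u0_isCont: "isCont u0 t"
  unfolding u0_def
  by (intro hpol.continuous isCont_o2[OF clock_isCont x_isCont])

lemma u0_per: "u0 (t + 1) = u0 t"
  by (simp add: u0_def clock_per x_per)

lemma norm_u0_less: "norm (u0 t) < 4"
proof -
  have "(norm (x (clock t)))\<^sup>2 < 2\<^sup>2" by (rule power_strict_mono) (use orbit(5) in auto)
  then show ?thesis by (simp add: norm_u0)
qed

lemma u0_zero_isolated:
  assumes "u0 t = 0"
  shows "\<forall>\<^sub>F r in at t. u0 r \<noteq> 0"
proof -
  have "\<forall>\<^sub>F r in at t. x (clock r) \<noteq> 0"
    using eventually_compose_filterlim[OF zero_isolated filterlim_clock] assms by (simp add: u0_eq_0)
  then show ?thesis by (simp add: u0_eq_0)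
qed

lemma u0_derivative:
  assumes "u0 t \<noteq> 0"
  shows "(u0 has_vector_derivative u1 t) (at t)"
proof -
  let ?s = "clock t"
  have x0: "x ?s \<noteq> 0" using assms by (simp add: u0_eq_0)
  have "((\<lambda>s. hopf (x s)) has_vector_derivative
      (hpol (x ?s) (v ?s + cm (of_real \<alpha> * \<i>) (x ?s)) + hpol (v ?s + cm (of_real \<alpha> * \<i>) (x ?s)) (x ?s))) (at ?s)"
    by (intro hpol.has_vector_derivative orbit)
  moreover have "hpol (x ?s) (v ?s + cm (of_real \<alpha> * \<i>) (x ?s)) + hpol (v ?s + cm (of_real \<alpha> * \<i>) (x ?s)) (x ?s)
      = 2 *\<^sub>R hpol (x ?s) (v ?s)"
    by (simp add: hpol_comm[of _ "x ?s"] hpol.add_right cm_real_i hpol.scaleR_right scaleR_2)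
  ultimately have "((\<lambda>s. hopf (x s)) has_vector_derivative 2 *\<^sub>R hpol (x ?s) (v ?s)) (at ?s)" by simp
  from vector_diff_chain_at[OF clock_derivative[OF x0] this]
  show ?thesis by (simp add: u0_def[abs_def] u1_def o_def mult.commute)
qed

text \<open>Eliminate \<open>hpol v v\<close> by \<open>hpol_kepler\<close> and |v|^2 by the energy
  relation: the coefficient of the velocity vanishes, \<sigma> and \<open>V\<close> drop out of the
  coefficient of the position, and the Kepler force remains.\<close>

lemma u1_derivative:
  assumes "u0 t \<noteq> 0"
  shows "(u1 has_vector_derivative (- (4 * om\<^sup>2 / norm (u0 t) ^ 3) *\<^sub>R u0 t + (2 * e) *\<^sub>R gV t (u0 t))) (at t)"
proof -
  let ?s = "clock t"
  let ?x = "x ?s" and ?v = "v ?s" and ?k = "e / (2 * b\<^sup>2)" and ?p = "Px e t (x ?s)"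
  have x0: "?x \<noteq> 0" using assms by (simp add: u0_eq_0)
  define N where "N = ?x \<bullet> ?x"
  have N: "N > 0" using x0 by (simp add: N_def)
  have N2: "(norm ?x)\<^sup>2 = N" by (simp add: N_def power2_norm_eq_inner)
  have 1: "((\<lambda>s. hpol (x s) (v s)) has_vector_derivative (hpol ?v ?v + \<sigma> ?s *\<^sub>R hopf ?x + ?k *\<^sub>R hpol ?x ?p)) (at ?s)"
  proof -
    have "((\<lambda>s. hpol (x s) (v s)) has_vector_derivative (hpol ?x (cm (of_real \<alpha> * \<i>) ?v + \<sigma> ?s *\<^sub>R ?x + ?k *\<^sub>R Px e (\<tau> ?s) ?x)
        + hpol (?v + cm (of_real \<alpha> * \<i>) ?x) ?v)) (at ?s)"
      by (intro hpol.has_vector_derivative orbit)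
    moreover have "hpol ?x (cm (of_real \<alpha> * \<i>) ?v) + hpol (cm (of_real \<alpha> * \<i>) ?x) ?v = \<alpha> *\<^sub>R (hpol (cm \<i> ?x) ?v + hpol ?x (cm \<i> ?v))"
      by (simp only: cm_real_i hpol.scaleR_right hpol.scaleR_left scaleR_add_right add.commute)
    then have "hpol ?x (cm (of_real \<alpha> * \<i>) ?v) = - hpol (cm (of_real \<alpha> * \<i>) ?x) ?v"
      by (simp add: eq_neg_iff_add_eq_0)
    ultimately show ?thesis
      by (simp add: hpol.add_left hpol.add_right hpol.scaleR_right algebra_simps)
  qed
  have 2: "((\<lambda>s. inverse ((x s) \<bullet> (x s))) has_vector_derivative - (2 * (?x \<bullet> ?v)) / N\<^sup>2) (at ?s)"
  proof -
    have "((\<lambda>s. x s \<bullet> x s) has_vector_derivative (?x \<bullet> (?v + cm (of_real \<alpha> * \<i>) ?x) + (?v + cm (of_real \<alpha> * \<i>) ?x) \<bullet> ?x)) (at ?s)"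
      by (intro bounded_bilinear.has_vector_derivative[OF bounded_bilinear_inner] orbit)
    moreover have "?x \<bullet> (?v + cm (of_real \<alpha> * \<i>) ?x) + (?v + cm (of_real \<alpha> * \<i>) ?x) \<bullet> ?x = 2 * (?x \<bullet> ?v)"
      by (simp add: inner_add_left inner_add_right inner_cm_real inner_commute[of "cm _ _"] inner_commute[of ?v])
    ultimately have "((\<lambda>s. x s \<bullet> x s) has_real_derivative 2 * (?x \<bullet> ?v)) (at ?s)"
      by (simp add: has_real_derivative_iff_has_vector_derivative)
    from DERIV_inverse_fun[OF this] x0 show ?thesis
      by (simp add: has_real_derivative_iff_has_vector_derivative[symmetric] N_def power2_eq_square divide_inverse mult_ac)
  qed
  have "((\<lambda>s. (2 * b * inverse (x s \<bullet> x s)) *\<^sub>R hpol (x s) (v s)) has_vector_derivative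
      ((2 * b * inverse N) *\<^sub>R (hpol ?v ?v + \<sigma> ?s *\<^sub>R hopf ?x + ?k *\<^sub>R hpol ?x ?p) + (2 * b * (- (2 * (?x \<bullet> ?v)) / N\<^sup>2)) *\<^sub>R hpol ?x ?v)) (at ?s)"
    unfolding N_def
    by (intro bounded_bilinear.has_vector_derivative[OF bounded_bilinear_scaleR] 1 2[unfolded N_def]
        bounded_linear.has_vector_derivative[OF bounded_linear_mult_right])
  note w = vector_diff_chain_at[OF clock_derivative[OF x0] this]
  have "u1 = (\<lambda>s. (2 * b * inverse (x s \<bullet> x s)) *\<^sub>R hpol (x s) (v s)) \<circ> clock"
    by (rule ext) (simp only: u1_def o_def power2_norm_eq_inner divide_inverse)
  with w have d: "(u1 has_vector_derivative (b / N) *\<^sub>R ((2 * b * inverse N) *\<^sub>R (hpol ?v ?v + \<sigma> ?s *\<^sub>R hopf ?x + ?k *\<^sub>R hpol ?x ?p)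
      + (2 * b * (- (2 * (?x \<bullet> ?v)) / N\<^sup>2)) *\<^sub>R hpol ?x ?v)) (at t)"
    unfolding N2 by simp
  have K: "N *\<^sub>R hpol ?v ?v = (2 * (?x \<bullet> ?v)) *\<^sub>R hpol ?x ?v - (?v \<bullet> ?v) *\<^sub>R hopf ?x"
    using hpol_kepler(1)[OF orbit(6)[of ?s]] by (simp add: N_def eq_diff_eq)
  have Q: "hpol ?x ?p = (2 * V t (hopf ?x)) *\<^sub>R hopf ?x + (2 * N\<^sup>2) *\<^sub>R gV t (hopf ?x)"
    by (simp add: Px_V[OF orbit(5)] hpol.add_right hpol.scaleR_right hpol_hadj N2 N2[unfolded power2_eq_square] power2_eq_square flip: N_def)
  have E: "?v \<bullet> ?v = 2 * om\<^sup>2 / b\<^sup>2 + \<sigma> ?s * N + e * V t (hopf ?x) * N / b\<^sup>2"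
    using orbit(7)[of ?s] by (simp add: P_V[OF orbit(5)] N2 flip: power2_norm_eq_inner)
  have H: "norm (u0 t) = N" by (simp add: norm_u0 N2)
  have vv: "hpol ?v ?v = inverse N *\<^sub>R ((2 * (?x \<bullet> ?v)) *\<^sub>R hpol ?x ?v - (?v \<bullet> ?v) *\<^sub>R hopf ?x)"
    unfolding K[symmetric] using N by simp
  \<comment> \<open>Collects the coefficients of \<open>hpol x v\<close>, \<open>hopf x\<close> and
    \<open>gV\<close>, in the roles of \<open>C\<close>, \<open>h\<close> and \<open>g\<close>; they
    are evaluated one by one below.\<close>
  have lin: "p *\<^sub>R (q *\<^sub>R (m *\<^sub>R (c *\<^sub>R C - w *\<^sub>R h) + z *\<^sub>R h + k *\<^sub>R (y *\<^sub>R h + n *\<^sub>R g)) + r *\<^sub>R C) =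
      (p * q * (m * c) + p * r) *\<^sub>R C + (p * q * (z - m * w + k * y)) *\<^sub>R h + (p * q * (k * n)) *\<^sub>R g"
    for p q m c w z k y n r and C h g :: "real^3"
    by (simp add: algebra_simps)
  have "(b / N) * (2 * b * inverse N) * (inverse N * (2 * c)) + (b / N) * (2 * b * (- (2 * c) / N\<^sup>2)) = 0" for c
    using N by (simp add: field_simps power2_eq_square)
  moreover have "(b / N) * (2 * b * inverse N) * (?k * (2 * N\<^sup>2)) = 2 * e"
    using N b by (simp add: field_simps power2_eq_square)
  moreover have "(b / N) * (2 * b * inverse N) * (z - inverse N * (2 * om\<^sup>2 / b\<^sup>2 + z * N + e * y * N / b\<^sup>2) + ?k * (2 * y)) = - (4 * om\<^sup>2 / N ^ 3)" for z y
  proof -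
    have "z - inverse N * (2 * om\<^sup>2 / b\<^sup>2 + z * N + e * y * N / b\<^sup>2) + ?k * (2 * y) = - (2 * om\<^sup>2 / (b\<^sup>2 * N))"
      using N b by (simp add: field_simps)
    then show ?thesis using N b by (simp add: field_simps power2_eq_square power3_eq_cube)
  qed
  ultimately have "(b / N) *\<^sub>R ((2 * b * inverse N) *\<^sub>R (hpol ?v ?v + \<sigma> ?s *\<^sub>R hopf ?x + ?k *\<^sub>R hpol ?x ?p)
      + (2 * b * (- (2 * (?x \<bullet> ?v)) / N\<^sup>2)) *\<^sub>R hpol ?x ?v) = - (4 * om\<^sup>2 / N ^ 3) *\<^sub>R hopf ?x + (2 * e) *\<^sub>R gV t (hopf ?x)"
    unfolding vv Q lin E by (simp only: scaleR_zero_left add_0_left)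
  with d show ?thesis unfolding H by (simp add: u0_def)
qed

text \<open>By the energy relation the two singular terms cancel. What remains is continuous through
  collisions, whence the limit required there.\<close>

lemma u1_energy:
  assumes "u0 t \<noteq> 0"
  shows "(norm (u1 t))\<^sup>2 / 2 - 4 * om\<^sup>2 / norm (u0 t) = 2 * b\<^sup>2 * \<sigma> (clock t) + 2 * e * V t (u0 t)"
proof -
  let ?s = "clock t"
  define N where "N = x ?s \<bullet> x ?s"
  have N2: "(norm (x ?s))\<^sup>2 = N" by (simp add: N_def power2_norm_eq_inner)
  have N: "N > 0" using assms by (simp add: N_def u0_eq_0)
  have E: "v ?s \<bullet> v ?s = 2 * om\<^sup>2 / b\<^sup>2 + \<sigma> ?s * N + e * V t (u0 t) * N / b\<^sup>2"
    using orbit(7)[of ?s] by (simp add: P_V[OF orbit(5)] N2 u0_def flip: power2_norm_eq_inner)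
  have "(norm (u1 t))\<^sup>2 = (2 * b / N)\<^sup>2 * (N * (v ?s \<bullet> v ?s))"
  proof -
    have "(norm (hpol (x ?s) (v ?s)))\<^sup>2 = N * (v ?s \<bullet> v ?s)"
      using hpol_kepler(2)[OF orbit(6)[of ?s]] by (simp add: power2_norm_eq_inner N_def)
    then show ?thesis by (simp add: u1_def power_mult_distrib power_divide N2)
  qed
  also have "\<dots> = 8 * om\<^sup>2 / N + 4 * b\<^sup>2 * \<sigma> ?s + 4 * e * V t (u0 t)"
    unfolding E using N b by (simp add: field_simps power2_eq_square)
  finally show ?thesis
    unfolding norm_u0 N2 by (simp add: add_divide_distrib)
qed

text \<open>Near a collision x(r) / (r - s) tends to the nonzero vector v(s). The Hopf map is
  quadratic and forgets the sign of r - s, so the direction has the same limit from both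
  sides.\<close>

lemma u0_direction:
  assumes "u0 t = 0"
  shows "\<exists>d. ((\<lambda>r. u0 r /\<^sub>R norm (u0 r)) \<longlongrightarrow> d) (at t)"
proof -
  let ?s = "clock t"
  have x0: "x ?s = 0" using assms by (simp add: u0_eq_0)
  note v0 = zero_velocity[OF x0]
  have "((\<lambda>r. (x r - x ?s) /\<^sub>R (r - ?s)) \<longlongrightarrow> v ?s) (at ?s)"
    using has_vector_derivative_slope[OF orbit(1)[of ?s]] x0 by simp
  then have y: "((\<lambda>r. x r /\<^sub>R (r - ?s)) \<longlongrightarrow> v ?s) (at ?s)" by (simp add: x0)
  have scale: "hopf (y /\<^sub>R c) /\<^sub>R norm (hopf (y /\<^sub>R c)) = hopf y /\<^sub>R norm (hopf y)" if "c \<noteq> 0" for y and c :: real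
  proof -
    have "hopf (y /\<^sub>R c) = (inverse c * inverse c) *\<^sub>R hopf y" by (simp add: hpol.scaleR_left hpol.scaleR_right)
    moreover have "norm (inverse c * inverse c) = inverse c * inverse c" by simp
    ultimately show ?thesis using that by (simp add: field_simps)
  qed
  have "((\<lambda>r. hopf (x r /\<^sub>R (r - ?s)) /\<^sub>R norm (hopf (x r /\<^sub>R (r - ?s)))) \<longlongrightarrow> hopf (v ?s) /\<^sub>R norm (hopf (v ?s))) (at ?s)"
    using v0 by (intro tendsto_intros hpol.tendsto y) auto
  moreover have "\<forall>\<^sub>F r in at ?s. hopf (x r /\<^sub>R (r - ?s)) /\<^sub>R norm (hopf (x r /\<^sub>R (r - ?s))) = hopf (x r) /\<^sub>R norm (hopf (x r))"
    unfolding eventually_at_filter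
    by (rule always_eventually) (auto intro!: scale)
  ultimately have "((\<lambda>r. hopf (x r) /\<^sub>R norm (hopf (x r))) \<longlongrightarrow> hopf (v ?s) /\<^sub>R norm (hopf (v ?s))) (at ?s)"
    using tendsto_cong by fast
  from filterlim_compose[OF this filterlim_clock]
  show ?thesis unfolding u0_def by blast
qed

lemma u0_energy:
  assumes "u0 t = 0"
  shows "((\<lambda>r. (norm (u1 r))\<^sup>2 / 2 - 4 * om\<^sup>2 / norm (u0 r)) \<longlongrightarrow> 2 * b\<^sup>2 * \<sigma> (clock t) + 2 * e * V t (u0 t)) (at t)"
proof -
  have "((\<lambda>r. 2 * b\<^sup>2 * \<sigma> (clock r) + 2 * e * V r (u0 r)) \<longlongrightarrow> 2 * b\<^sup>2 * \<sigma> (clock t) + 2 * e * V t (u0 t)) (at t)"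
  proof (intro tendsto_intros)
    show "((\<lambda>r. \<sigma> (clock r)) \<longlongrightarrow> \<sigma> (clock t)) (at t)"
      using isCont_o2[OF clock_isCont \<sigma>_isCont] by (simp add: isCont_def)
    have "continuous_on UNIV (\<lambda>r. (\<lambda>(t, y). V t y) (r, u0 r))"
      using u0_isCont norm_u0_less
      by (intro continuous_on_compose2[OF V_cont] continuous_on_Pair continuous_on_id continuous_at_imp_continuous_on) auto
    then show "((\<lambda>r. V r (u0 r)) \<longlongrightarrow> V t (u0 t)) (at t)"
      by (simp add: continuous_on_def)
  qed
  then show ?thesis
    by (rule Lim_transform_eventually)
       (use u0_zero_isolated[OF assms] in \<open>auto elim!: eventually_mono simp: u1_energy\<close>)
qed

end

section \<open>Uniform bounds for the perturbation\<close>

locale forced_kepler =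
  fixes T \<epsilon>\<^sub>s :: real and \<U> :: "(real^3) set" and U :: "real \<Rightarrow> real^3 \<Rightarrow> real \<Rightarrow> real"
  assumes T: "T > 0" and eps: "\<epsilon>\<^sub>s > 0" and open_U: "open \<U>"
    and smooth: "Cinfinity_on (\<lambda>(t, u, \<epsilon>). U t u \<epsilon>) (UNIV \<times> \<U> \<times> {0..\<epsilon>\<^sub>s})"
    and periodic: "\<forall>t. \<forall>u\<in>\<U>. \<forall>\<epsilon>\<in>{0..\<epsilon>\<^sub>s}. U (t + T) u \<epsilon> = U t u \<epsilon>"
begin

abbreviation "tube \<equiv> (UNIV :: real set) \<times> \<U> \<times> {0..\<epsilon>\<^sub>s}"
abbreviation "Uf \<equiv> (\<lambda>(t :: real, u :: real^3, \<epsilon> :: real). U t u \<epsilon>)"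

lemma at_within_tube: "y \<in> \<U> \<Longrightarrow> 0 < e \<Longrightarrow> e < \<epsilon>\<^sub>s \<Longrightarrow> at (t, y, e) within tube = at (t, y, e)"
proof (rule at_within_interior)
  assume "y \<in> \<U>" "0 < e" "e < \<epsilon>\<^sub>s"
  then have "(t, y, e) \<in> UNIV \<times> \<U> \<times> {0<..<\<epsilon>\<^sub>s}" by auto
  moreover have "open (UNIV \<times> \<U> \<times> {0<..<\<epsilon>\<^sub>s})" by (intro open_Times open_UNIV open_U open_greaterThanLessThan)
  moreover have "UNIV \<times> \<U> \<times> {0<..<\<epsilon>\<^sub>s} \<subseteq> tube" by auto
  ultimately show "(t, y, e) \<in> interior tube" by (intro interiorI)
qed

text \<open>Compactness is applied on a convex set spanning two periods: two times at distance at
  most T are brought into it by a common shift. For larger distances the sup bound already is a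
  Lipschitz bound, with constant 2 C0 / T.\<close>

lemma C1_lipschitz:
  fixes g :: "real \<times> (real^3) \<times> real \<Rightarrow> real"
  assumes g: "Ck_on 1 g tube" and r: "cball 0 r \<subseteq> \<U>"
    and per: "\<And>t y e. y \<in> \<U> \<Longrightarrow> 0 < e \<Longrightarrow> e < \<epsilon>\<^sub>s \<Longrightarrow> g (t + T, y, e) = g (t, y, e)"
  shows "\<exists>C\<ge>0. \<forall>t t' y y' e. norm y \<le> r \<and> norm y' \<le> r \<and> 0 < e \<and> e < \<epsilon>\<^sub>s \<longrightarrow>
    \<bar>g (t, y, e)\<bar> \<le> C \<and> \<bar>g (t, y, e) - g (t', y', e)\<bar> \<le> C * (\<bar>t - t'\<bar> + norm (y - y'))"
proof -
  define B where "B = {0..2 * T} \<times> cball (0::real^3) r \<times> {0..\<epsilon>\<^sub>s}"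
  have B: "compact B" "convex B" "B \<subseteq> tube"
    using r unfolding B_def by (auto intro!: compact_Times convex_Times)
  obtain g' where g': "\<And>z. z \<in> tube \<Longrightarrow> (g has_derivative g' z) (at z within tube)" and g'c: "\<And>v. continuous_on tube (\<lambda>z. g' z v)"
    using g by auto
  have gc: "continuous_on tube g" using g' by (rule has_derivative_continuous_on)
  have bounded_on_B: "\<exists>C\<ge>0. \<forall>z\<in>B. norm (h z) \<le> C" if "continuous_on tube h" for h :: "real \<times> (real^3) \<times> real \<Rightarrow> real"
  proof -
    have "bounded (h ` B)"
      using compact_imp_bounded[OF compact_continuous_image[OF continuous_on_subset[OF that B(3)] B(1)]] .
    then obtain C where "\<forall>z\<in>B. norm (h z) \<le> C" by (auto simp: bounded_iff)
    then show ?thesis by (intro exI[of _ "max C 0"]) auto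
  qed
  obtain C0 where C0: "C0 \<ge> 0" "\<And>z. z \<in> B \<Longrightarrow> norm (g z) \<le> C0" using bounded_on_B[OF gc] by blast
  obtain Cb where Cb: "\<And>v. Cb v \<ge> 0" "\<And>v z. z \<in> B \<Longrightarrow> norm (g' z v) \<le> Cb v"
    using bounded_on_B[OF g'c] by metis
  \<comment> \<open>Only derivatives in fixed directions are known to be continuous, so the operator
    norm is bounded through the basis.\<close>
  define L where "L = (\<Sum>b\<in>Basis. Cb b)"
  have L: "L \<ge> 0" unfolding L_def using Cb(1) by (intro sum_nonneg)
  have on: "onorm (g' z) \<le> L" if z: "z \<in> B" for z
  proof (rule onorm_le)
    fix v
    have "linear (g' z)" using g' z B(3) has_derivative_linear by blast
    then have "g' z v = (\<Sum>b\<in>Basis. (v \<bullet> b) * g' z b)"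
      by (subst euclidean_representation[of v, symmetric]) (simp add: linear_sum linear_scale)
    also have "norm \<dots> \<le> (\<Sum>b\<in>Basis. norm v * Cb b)"
    proof (rule order_trans[OF norm_sum sum_mono])
      fix b :: "real \<times> (real^3) \<times> real" assume "b \<in> Basis"
      then show "norm ((v \<bullet> b) * g' z b) \<le> norm v * Cb b"
        using Cb(2)[OF z] Basis_le_norm[of b v] unfolding norm_mult by (intro mult_mono) auto
    qed
    finally show "norm (g' z v) \<le> L * norm v" by (simp add: L_def sum_distrib_left mult.commute)
  qed
  have lipB: "norm (g z - g z') \<le> L * norm (z - z')" if "z \<in> B" "z' \<in> B" for z z'
  proof (rule differentiable_bound[OF B(2)])
    show "(g has_derivative g' w) (at w within B)" if "w \<in> B" for w
      using has_derivative_subset[OF g' B(3)] B(3) that by blast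
  qed (use on that in auto)
  have perk: "g (t + of_int k * T, y, e) = g (t, y, e)" if "y \<in> \<U>" "0 < e" "e < \<epsilon>\<^sub>s" for k t y e
  proof (induction k rule: int_induct[where k = 0])
    case (step1 i)
    then show ?case using per[OF that, of "t + of_int i * T"] by (simp add: algebra_simps)
  next
    case (step2 i)
    then show ?case using per[OF that, of "t + of_int (i - 1) * T"] by (simp add: algebra_simps)
  qed simp
  have shift: "\<exists>k::int. t + of_int k * T \<in> {0..T}" for t
  proof (intro exI[of _ "- \<lfloor>t / T\<rfloor>"])
    show "t + of_int (- \<lfloor>t / T\<rfloor>) * T \<in> {0..T}"
      using floor_divide_lower[OF T, of t] floor_divide_upper[OF T, of t] by (simp add: algebra_simps)
  qed
  have bd: "\<bar>g (t, y, e)\<bar> \<le> C0" if "norm y \<le> r" "0 < e" "e < \<epsilon>\<^sub>s" for t y e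
  proof -
    obtain k :: int where k: "t + of_int k * T \<in> {0..T}" using shift by blast
    have "norm (g (t + of_int k * T, y, e)) \<le> C0"
      by (rule C0(2)) (use k that T in \<open>auto simp: B_def\<close>)
    then show ?thesis using perk[of y e t k] that r by (auto simp: subset_iff)
  qed
  let ?C = "C0 + L + 2 * C0 / T"
  have lip: "\<bar>g (t, y, e) - g (t', y', e)\<bar> \<le> ?C * (\<bar>t - t'\<bar> + norm (y - y'))"
    if y: "norm y \<le> r" "norm y' \<le> r" and e: "0 < e" "e < \<epsilon>\<^sub>s" and tt: "t \<le> t'" for t t' y y' e
  proof (cases "t' - t \<le> T")
    case True
    obtain k :: int where k: "t + of_int k * T \<in> {0..T}" using shift by blast
    have yU: "y \<in> \<U>" "y' \<in> \<U>" using y r by (auto simp: subset_iff)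
    have "\<bar>g (t, y, e) - g (t', y', e)\<bar> = norm (g (t + of_int k * T, y, e) - g (t' + of_int k * T, y', e))"
      using perk yU e by simp
    also have "\<dots> \<le> L * norm ((t + of_int k * T, y, e) - (t' + of_int k * T, y', e))"
      by (rule lipB) (use k True tt y e T in \<open>auto simp: B_def\<close>)
    also have "\<dots> \<le> L * (\<bar>t - t'\<bar> + norm (y - y'))"
    proof (rule mult_left_mono[OF _ L])
      have "norm (t - t', y - y', 0::real) \<le> norm (t - t') + norm (y - y', 0::real)" by (rule norm_Pair_le)
      also have "norm (y - y', 0::real) \<le> norm (y - y') + norm (0::real)" by (rule norm_Pair_le)
      finally show "norm ((t + of_int k * T, y, e) - (t' + of_int k * T, y', e)) \<le> \<bar>t - t'\<bar> + norm (y - y')" by simp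
    qed
    also have "\<dots> \<le> ?C * (\<bar>t - t'\<bar> + norm (y - y'))"
      using C0(1) T by (intro mult_right_mono) auto
    finally show ?thesis .
  next
    case False
    have "\<bar>g (t, y, e) - g (t', y', e)\<bar> \<le> C0 + C0" using bd[OF y(1) e, of t] bd[OF y(2) e, of t'] by linarith
    also have "\<dots> \<le> (2 * C0 / T) * \<bar>t - t'\<bar>"
    proof -
      have "2 * C0 * T \<le> 2 * C0 * \<bar>t - t'\<bar>" using False C0(1) by (intro mult_left_mono) auto
      then show ?thesis using T by (simp add: field_simps)
    qed
    also have "\<dots> \<le> ?C * (\<bar>t - t'\<bar> + norm (y - y'))"
      using C0(1) L T by (intro mult_mono) auto
    finally show ?thesis .
  qed
  show ?thesis
  proof (intro exI[of _ ?C] conjI allI impI)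
    show "?C \<ge> 0" using C0(1) L T by simp
    fix t t' e :: real and y y' :: "real^3" assume *: "norm y \<le> r \<and> norm y' \<le> r \<and> 0 < e \<and> e < \<epsilon>\<^sub>s"
    have "0 \<le> 2 * C0 / T" using C0(1) T by simp
    then show "\<bar>g (t, y, e)\<bar> \<le> ?C" using bd[of y e t] * L by linarith
    show "\<bar>g (t, y, e) - g (t', y', e)\<bar> \<le> ?C * (\<bar>t - t'\<bar> + norm (y - y'))"
      using lip[of y y' e t t'] lip[of y' y e t' t] * by (cases "t \<le> t'") (auto simp: abs_minus_commute norm_minus_commute)
  qed
qed

text \<open>One derivative is fixed by choice so that partial derivatives can be named. Each order
  of \<open>Ck_on\<close> comes with a witness of its own; for parameters strictly between 0 and
  \<open>\<epsilon>\<^sub>s\<close>, uniqueness of derivatives identifies them.\<close>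

definition dU :: "real \<times> (real^3) \<times> real \<Rightarrow> real \<times> (real^3) \<times> real \<Rightarrow> real" where
  "dU = (SOME f'. (\<forall>z\<in>tube. (Uf has_derivative f' z) (at z within tube)) \<and> (\<forall>v. Ck_on 1 (\<lambda>z. f' z v) tube))"

lemma dU: "z \<in> tube \<Longrightarrow> (Uf has_derivative dU z) (at z within tube)" "Ck_on 1 (\<lambda>z. dU z v) tube"
proof -
  have "Ck_on (Suc 1) Uf tube" using smooth unfolding Cinfinity_on_def by blast
  then have "\<exists>f'. (\<forall>z\<in>tube. (Uf has_derivative f' z) (at z within tube)) \<and> (\<forall>v. Ck_on 1 (\<lambda>z. f' z v) tube)"
    unfolding Ck_on.simps(2)[of 1] .
  from someI_ex[OF this] show "z \<in> tube \<Longrightarrow> (Uf has_derivative dU z) (at z within tube)" "Ck_on 1 (\<lambda>z. dU z v) tube"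
    unfolding dU_def by blast+
qed

lemma dU_at: "y \<in> \<U> \<Longrightarrow> 0 < e \<Longrightarrow> e < \<epsilon>\<^sub>s \<Longrightarrow> (Uf has_derivative dU (t, y, e)) (at (t, y, e))"
  using dU(1)[of "(t, y, e)"] at_within_tube[of y e t] by auto

lemma dU_periodic:
  assumes y: "y \<in> \<U>" "0 < e" "e < \<epsilon>\<^sub>s"
  shows "dU (t + T, y, e) = dU (t, y, e)"
proof -
  have "((\<lambda>z. Uf (z + (T, 0, 0))) has_derivative dU (t + T, y, e)) (at (t, y, e))"
  proof -
    have "((\<lambda>z. z + (T, 0, 0)) has_derivative (\<lambda>h. h)) (at (t, y, e))"
      by (auto intro!: derivative_eq_intros)
    from has_derivative_compose[OF this, of Uf] dU_at[OF y, of "t + T"] show ?thesis by simp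
  qed
  moreover have "open (UNIV \<times> \<U> \<times> {0<..<\<epsilon>\<^sub>s})" by (intro open_Times open_UNIV open_U open_greaterThanLessThan)
  ultimately have "(Uf has_derivative dU (t + T, y, e)) (at (t, y, e))"
    by (rule has_derivative_transform_within_open) (use y periodic in auto)
  then show ?thesis using dU_at[OF y] by (rule has_derivative_unique)
qed

definition gU :: "real \<Rightarrow> real^3 \<Rightarrow> real \<Rightarrow> real^3" where
  "gU t y e = (\<Sum>b\<in>Basis. dU (t, y, e) (0, b, 0) *\<^sub>R b)"

lemma linear_dU: "y \<in> \<U> \<Longrightarrow> 0 < e \<Longrightarrow> e < \<epsilon>\<^sub>s \<Longrightarrow> linear (dU (t, y, e))"
  using dU_at has_derivative_linear by blast

lemma dU_eq:
  assumes y: "y \<in> \<U>" "0 < e" "e < \<epsilon>\<^sub>s"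
  shows "dU (t, y, e) (s, w, 0) = s * dU (t, y, e) (1, 0, 0) + gU t y e \<bullet> w"
proof -
  note l = linear_dU[OF y, of t]
  have "(s, w, 0) = s *\<^sub>R (1, 0, 0) + (\<Sum>b\<in>Basis. (w \<bullet> b) *\<^sub>R (0::real, b, 0::real))"
  proof -
    have "(\<Sum>b\<in>Basis. (w \<bullet> b) *\<^sub>R (0::real, b, 0::real)) = (0, \<Sum>b\<in>Basis. (w \<bullet> b) *\<^sub>R b, 0)"
      by (simp add: prod_eq_iff fst_sum snd_sum)
    then show ?thesis by (simp add: euclidean_representation)
  qed
  then have "dU (t, y, e) (s, w, 0) = s * dU (t, y, e) (1, 0, 0) + (\<Sum>b\<in>Basis. (w \<bullet> b) * dU (t, y, e) (0, b, 0))"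
    by (simp only: linear_add[OF l] linear_scale[OF l] linear_sum[OF l] real_scaleR_def)
  then show ?thesis by (simp add: gU_def inner_sum_left inner_commute[of w] mult.commute)
qed

lemma gU_gradient:
  assumes y: "y \<in> \<U>" "0 < e" "e < \<epsilon>\<^sub>s"
  shows "gradient (\<lambda>v. U t v e) y = gU t y e"
proof (rule gradient_eq)
  have "((\<lambda>v. (t, v, e)) has_derivative (\<lambda>w. (0, w, 0))) (at y)"
    by (auto intro!: derivative_eq_intros)
  from has_derivative_compose[OF this, of Uf] dU_at[OF y, of t]
  have "((\<lambda>v. U t v e) has_derivative (\<lambda>w. dU (t, y, e) (0, w, 0))) (at y)" by simp
  then show "GDERIV (\<lambda>v. U t v e) y :> gU t y e"
    unfolding gderiv_def using dU_eq[OF y, of t 0] by (simp add: inner_commute)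
qed

lemma force_smooth:
  assumes e: "0 < e" "e < \<epsilon>\<^sub>s"
  shows "Cinfinity_on (\<lambda>(t, y). - (y /\<^sub>R norm y ^ 3) + e *\<^sub>R gU t y e) (UNIV \<times> (\<U> - {0}))"
  unfolding Cinfinity_on_def
proof
  fix k
  let ?S = "(UNIV :: real set) \<times> (\<U> - {0})"
  have sndk: "Ck_on k (\<lambda>z :: real \<times> (real^3). snd z) ?S" by (intro Ck_on_bounded_linear bounded_linear_snd)
  \<comment> \<open>The cubed norm enters as a power of the inner product, which is polynomial and
    positive off the origin.\<close>
  have "Ck_on k (\<lambda>z. (\<lambda>s. s powr (-3/2)) (snd z \<bullet> snd z)) ?S"
  proof (rule Ck_on_compose[OF Ck_on_powr])
    show "Ck_on k (\<lambda>z :: real \<times> (real^3). snd z \<bullet> snd z) ?S"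
      by (intro Ck_on_bilinear[OF bounded_bilinear_inner] sndk)
  qed auto
  then have 1: "Ck_on k (\<lambda>z. (- 1) *\<^sub>R ((snd z \<bullet> snd z) powr (-3/2) *\<^sub>R snd z)) ?S"
    by (intro Ck_on_bilinear[OF bounded_bilinear_scaleR] Ck_on_const sndk)
  have pw: "(y \<bullet> y) powr (-3/2) = inverse (norm y ^ 3)" if "y \<noteq> 0" for y :: "real^3"
  proof -
    have "(y \<bullet> y) powr (-3/2) = (norm y powr 2) powr (-3/2)"
      using that by (simp add: powr_numeral power2_norm_eq_inner)
    also have "\<dots> = norm y powr (2 * (-3/2))" by (rule powr_powr)
    also have "\<dots> = norm y powr (- 3)" by simp
    also have "\<dots> = inverse (norm y ^ 3)" using that by (simp add: powr_minus powr_numeral)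
    finally show ?thesis .
  qed
  have "Ck_on (Suc k) Uf tube" using smooth unfolding Cinfinity_on_def by blast
  then obtain f' where f': "\<And>z. z \<in> tube \<Longrightarrow> (Uf has_derivative f' z) (at z within tube)" and f'k: "\<And>v. Ck_on k (\<lambda>z. f' z v) tube"
    by auto
  have eq: "f' (t, y, e) = dU (t, y, e)" if y: "y \<in> \<U>" for t y
  proof -
    have "(t, y, e) \<in> tube" using y e by simp
    from f'[OF this] have "(Uf has_derivative f' (t, y, e)) (at (t, y, e))"
      unfolding at_within_tube[OF y e] .
    then show ?thesis using dU_at[OF y e] by (rule has_derivative_unique)
  qed
  have "Ck_on k (\<lambda>z. f' ((\<lambda>z. (fst z, snd z, e)) z) v) ?S" for v
  proof (rule Ck_on_compose[OF f'k])
    show "Ck_on k (\<lambda>z :: real \<times> (real^3). (fst z, snd z, e)) ?S"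
      by (intro Ck_on_Pair sndk Ck_on_const Ck_on_bounded_linear bounded_linear_fst)
  qed (use e in auto)
  then have 2: "Ck_on k (\<lambda>z. e *\<^sub>R (\<Sum>b\<in>Basis. f' (fst z, snd z, e) (0, b, 0) *\<^sub>R b)) ?S"
    by (intro Ck_on_bilinear[OF bounded_bilinear_scaleR] Ck_on_const Ck_on_sum)
  have same: "(- 1) *\<^sub>R ((snd z \<bullet> snd z) powr (-3/2) *\<^sub>R snd z) + e *\<^sub>R (\<Sum>b\<in>Basis. f' (fst z, snd z, e) (0, b, 0) *\<^sub>R b) =
      (case z of (t, y) \<Rightarrow> - (y /\<^sub>R norm y ^ 3) + e *\<^sub>R gU t y e)" if "z \<in> ?S" for z
  proof -
    obtain t y where z: "z = (t, y)" by force
    have "y \<in> \<U>" "y \<noteq> 0" using that by (auto simp: z)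
    then show ?thesis by (simp only: z fst_conv snd_conv prod.case pw[OF \<open>y \<noteq> 0\<close>] eq[OF \<open>y \<in> \<U>\<close>] gU_def scaleR_minus1_left)
  qed
  show "Ck_on k (\<lambda>(t, y). - (y /\<^sub>R norm y ^ 3) + e *\<^sub>R gU t y e) ?S"
    by (rule Ck_on_cong[OF same, THEN iffD1, OF _ Ck_on_add[OF 1 2]])
qed

end

section \<open>Generalized periodic solutions\<close>

lemma (in lip_family) bl_sum: "(\<And>i. i \<in> A \<Longrightarrow> bl (F i)) \<Longrightarrow> bl (\<lambda>e p. \<Sum>i\<in>A. F i e p)"
  by (induction A rule: infinite_finite_induct) (auto intro: bl_const ol_add)

lemma bounded_bilinear_hadj: "bounded_bilinear hadj"
  unfolding bilinear_conv_bounded_bilinear[symmetric] bilinear_def linear_iff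
  by (auto simp: hopf_simps prod_eq_iff complex_eq_iff algebra_simps)

text \<open>The nearest-point map of the ball of radius 2 is a bounded Lipschitz cut-off: it extends
  the perturbation to all of \<open>cc\<close> and leaves it unchanged where its derivative is
  taken.\<close>

definition ball_proj :: "cc \<Rightarrow> cc" where "ball_proj = closest_point (cball 0 2)"

lemma ball_proj_id: "norm y \<le> 2 \<Longrightarrow> ball_proj y = y"
  unfolding ball_proj_def by (rule closest_point_self) simp

lemma norm_ball_proj: "norm (ball_proj y) \<le> 2"
  using closest_point_in_set[of "cball (0::cc) 2" y] by (simp add: ball_proj_def)

lemma ball_proj_lipschitz: "dist (ball_proj y) (ball_proj z) \<le> dist y z"
  unfolding ball_proj_def by (rule closest_point_lipschitz) auto

context forced_kepler
begin

section \<open>The rescaled perturbation and its bounds\<close>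

context
  fixes r om \<beta> c :: real
  assumes r: "cball 0 r \<subseteq> \<U>" and om: "om > 0" "cis om = 1" and \<beta>: "\<beta> > 0" "4 * \<beta> \<le> r"
    and scale: "\<beta> ^ 3 * (4 * om\<^sup>2) = T\<^sup>2" and c: "c = T\<^sup>2 / (2 * \<beta>\<^sup>2)"
begin

text \<open>Put u = \<beta> w and t = T \<tau>. Then w'' = -(T^2/\<beta>^3) w/|w|^3 + (T^2/\<beta>)
  e grad U. By \<open>scale\<close> the first factor is 4 om^2, and \<open>c\<close> turns the
  second term into 2 e times the gradient of
  \<open>c * U (T * \<tau>) (\<beta> *\<^sub>R w) e\<close> in w. Since |w| <= 4 on the range of the
  cut-off, \<open>4 * \<beta> \<le> r\<close> keeps the argument of \<open>U\<close> in its
  domain.\<close>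

definition Pf :: "real \<Rightarrow> real \<Rightarrow> cc \<Rightarrow> real" where
  "Pf e t y = c * (U (T * t) (\<beta> *\<^sub>R hopf (ball_proj y)) e * (ball_proj y \<bullet> ball_proj y))"
definition Ptf :: "real \<Rightarrow> real \<Rightarrow> cc \<Rightarrow> real" where
  "Ptf e t y = (c * T) * (dU (T * t, \<beta> *\<^sub>R hopf (ball_proj y), e) (1, 0, 0) * (ball_proj y \<bullet> ball_proj y))"
definition Pxf :: "real \<Rightarrow> real \<Rightarrow> cc \<Rightarrow> cc" where
  "Pxf e t y = ((2 * c) * U (T * t) (\<beta> *\<^sub>R hopf (ball_proj y)) e) *\<^sub>R ball_proj y +
     (2 * (ball_proj y \<bullet> ball_proj y)) *\<^sub>R hadj (ball_proj y) ((c * \<beta>) *\<^sub>R gU (T * t) (\<beta> *\<^sub>R hopf (ball_proj y)) e)"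

lemma arg_le: "norm (\<beta> *\<^sub>R hopf (ball_proj y)) \<le> r"
proof -
  have "(norm (ball_proj y))\<^sup>2 \<le> 2\<^sup>2" by (rule power_mono[OF norm_ball_proj]) simp
  then have "\<beta> * (norm (ball_proj y))\<^sup>2 \<le> \<beta> * 4" using \<beta>(1) by (intro mult_left_mono) auto
  moreover have "norm (\<beta> *\<^sub>R hopf (ball_proj y)) = \<beta> * (norm (ball_proj y))\<^sup>2"
    using \<beta>(1) by (simp add: norm_hopf)
  ultimately show ?thesis using \<beta>(2) by linarith
qed

lemma arg_in: "\<beta> *\<^sub>R hopf (ball_proj y) \<in> \<U>"
  using arg_le[of y] r by (auto simp: subset_iff)

lemma family: "lip_family (min \<epsilon>\<^sub>s 1) 1"
  by standard (use eps in auto)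

text \<open>With constant domains the order \<open>bl\<close> just means bounded and Lipschitz,
  uniformly in e.\<close>

interpretation lf: lip_family "min \<epsilon>\<^sub>s 1" 1 "\<lambda>d. UNIV :: (real \<times> cc) set"
  by (rule family)

lemma ball_proj_bl: "lf.bl (\<lambda>e p. ball_proj (snd p))"
proof (rule lf.olI[of 2])
  fix p q :: "real \<times> cc"
  have "dist (ball_proj (snd p)) (ball_proj (snd q)) \<le> dist p q"
    by (rule order_trans[OF ball_proj_lipschitz dist_snd_le])
  then show "norm (ball_proj (snd p) - ball_proj (snd q)) \<le> 2 * 1 * dist p q"
    unfolding dist_norm[of "ball_proj _", symmetric] using zero_le_dist[of p q] by linarith
qed (auto simp: norm_ball_proj)

lemma arg_bl: "lf.bl (\<lambda>e p. \<beta> *\<^sub>R hopf (ball_proj (snd p)))"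
  by (intro lf.ol_linear[OF bounded_linear_scaleR_right] lf.bl_bilinear[OF bounded_bilinear_hpol] ball_proj_bl)

lemma comp_bl:
  fixes g :: "real \<times> (real^3) \<times> real \<Rightarrow> real"
  assumes g: "Ck_on 1 g tube"
    and per: "\<And>t y e. y \<in> \<U> \<Longrightarrow> 0 < e \<Longrightarrow> e < \<epsilon>\<^sub>s \<Longrightarrow> g (t + T, y, e) = g (t, y, e)"
  shows "lf.bl (\<lambda>e p. g (T * fst p, \<beta> *\<^sub>R hopf (ball_proj (snd p)), e))"
proof -
  obtain C where C: "C \<ge> 0" "\<And>t t' y y' e. norm y \<le> r \<and> norm y' \<le> r \<and> 0 < e \<and> e < \<epsilon>\<^sub>s \<Longrightarrow>
    \<bar>g (t, y, e)\<bar> \<le> C \<and> \<bar>g (t, y, e) - g (t', y', e)\<bar> \<le> C * (\<bar>t - t'\<bar> + norm (y - y'))"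
    using C1_lipschitz[OF g r per] by blast
  have "\<exists>D\<ge>0. \<forall>e\<in>{0<..<min \<epsilon>\<^sub>s 1}. \<forall>d\<in>{0<..1::real}. \<forall>p\<in>UNIV. norm (\<beta> *\<^sub>R hopf (ball_proj (snd p))) \<le> D * 1 \<and>
      (\<forall>q\<in>(UNIV :: (real \<times> cc) set). norm (\<beta> *\<^sub>R hopf (ball_proj (snd p)) - \<beta> *\<^sub>R hopf (ball_proj (snd q))) \<le> D * 1 * dist p q)"
    using arg_bl unfolding lf.ol_def .
  then obtain D where D0: "D \<ge> 0" and Dle: "\<forall>e\<in>{0<..<min \<epsilon>\<^sub>s 1}. \<forall>d\<in>{0<..1::real}. \<forall>p\<in>UNIV. norm (\<beta> *\<^sub>R hopf (ball_proj (snd p))) \<le> D * 1 \<and>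
      (\<forall>q\<in>(UNIV :: (real \<times> cc) set). norm (\<beta> *\<^sub>R hopf (ball_proj (snd p)) - \<beta> *\<^sub>R hopf (ball_proj (snd q))) \<le> D * 1 * dist p q)"
    by (elim exE conjE)
  have "norm (\<beta> *\<^sub>R hopf (ball_proj (snd p)) - \<beta> *\<^sub>R hopf (ball_proj (snd q))) \<le> D * 1 * dist p q" for p q :: "real \<times> cc"
    by (rule Dle[THEN bspec, THEN bspec, THEN bspec, THEN conjunct2, THEN bspec, of "min \<epsilon>\<^sub>s 1 / 2" 1 p q]) (use eps in auto)
  note D = D0 this
  show ?thesis
  proof (rule lf.olI[of "C + C * (T + D)"])
    fix e d and p q :: "real \<times> cc" assume *: "0 < e" "e < min \<epsilon>\<^sub>s 1" "0 < d" "d \<le> (1::real)"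
    note cc = C(2)[of "\<beta> *\<^sub>R hopf (ball_proj (snd p))" "\<beta> *\<^sub>R hopf (ball_proj (snd q))" e "T * fst p" "T * fst q"]
    have nn: "0 \<le> C * (T + D)" using C(1) D(1) T by simp
    have c1: "\<bar>g (T * fst p, \<beta> *\<^sub>R hopf (ball_proj (snd p)), e)\<bar> \<le> C" and
      c2: "\<bar>g (T * fst p, \<beta> *\<^sub>R hopf (ball_proj (snd p)), e) - g (T * fst q, \<beta> *\<^sub>R hopf (ball_proj (snd q)), e)\<bar> \<le>
        C * (\<bar>T * fst p - T * fst q\<bar> + norm (\<beta> *\<^sub>R hopf (ball_proj (snd p)) - \<beta> *\<^sub>R hopf (ball_proj (snd q))))"
      using cc arg_le * by auto
    show "norm (g (T * fst p, \<beta> *\<^sub>R hopf (ball_proj (snd p)), e)) \<le> (C + C * (T + D)) * 1"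
      using c1 nn by simp
    have "\<bar>T * fst p - T * fst q\<bar> \<le> T * dist p q"
      using T dist_fst_le[of p q] by (simp add: dist_real_def abs_mult flip: right_diff_distrib)
    then have "\<bar>T * fst p - T * fst q\<bar> + norm (\<beta> *\<^sub>R hopf (ball_proj (snd p)) - \<beta> *\<^sub>R hopf (ball_proj (snd q))) \<le> T * dist p q + D * 1 * dist p q"
      by (intro add_mono D(2))
    from mult_left_mono[OF this C(1)] c2
    have "\<bar>g (T * fst p, \<beta> *\<^sub>R hopf (ball_proj (snd p)), e) - g (T * fst q, \<beta> *\<^sub>R hopf (ball_proj (snd q)), e)\<bar> \<le> C * (T + D) * dist p q"
      by (simp add: algebra_simps)
    also have "\<dots> \<le> (C + C * (T + D)) * 1 * dist p q" using C(1) by (intro mult_right_mono) auto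
    finally show "norm (g (T * fst p, \<beta> *\<^sub>R hopf (ball_proj (snd p)), e) - g (T * fst q, \<beta> *\<^sub>R hopf (ball_proj (snd q)), e)) \<le> (C + C * (T + D)) * 1 * dist p q"
      by simp
  qed (use C(1) D(1) T in auto)
qed

lemma U_bl: "lf.bl (\<lambda>e p. U (T * fst p) (\<beta> *\<^sub>R hopf (ball_proj (snd p))) e)"
proof -
  have "Ck_on 1 Uf tube" using smooth by (simp only: Cinfinity_on_def)
  from comp_bl[OF this] show ?thesis using periodic by auto
qed

lemma dU_bl: "lf.bl (\<lambda>e p. dU (T * fst p, \<beta> *\<^sub>R hopf (ball_proj (snd p)), e) v)"
  by (rule comp_bl[OF dU(2)]) (simp add: dU_periodic)

lemma gU_bl: "lf.bl (\<lambda>e p. gU (T * fst p) (\<beta> *\<^sub>R hopf (ball_proj (snd p))) e)"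
  unfolding gU_def by (intro lf.bl_sum lf.bl_bilinear[OF bounded_bilinear_scaleR] dU_bl lf.bl_const)

lemma P_bl: "lf.bl (\<lambda>e p. Pf e (fst p) (snd p))" "lf.bl (\<lambda>e p. Ptf e (fst p) (snd p))" "lf.bl (\<lambda>e p. Pxf e (fst p) (snd p))"
  unfolding Pf_def Ptf_def Pxf_def
  by (intro lf.ol_add lf.ol_linear[OF bounded_linear_mult_right] lf.ol_linear[OF bounded_linear_scaleR_right]
      lf.bl_bilinear[OF bounded_bilinear_mult] lf.bl_bilinear[OF bounded_bilinear_inner]
      lf.bl_bilinear[OF bounded_bilinear_scaleR] lf.bl_bilinear[OF bounded_bilinear_hadj] ball_proj_bl U_bl dU_bl gU_bl)+

lemma bl_bound:
  fixes F :: "real \<Rightarrow> real \<Rightarrow> cc \<Rightarrow> 'b::real_normed_vector"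
  assumes "lf.bl (\<lambda>e p. F e (fst p) (snd p))"
  shows "\<exists>M. \<forall>e t y t' y'. 0 < e \<and> e < min \<epsilon>\<^sub>s 1 \<longrightarrow> norm (F e t y) \<le> M \<and>
    norm (F e t y - F e t' y') \<le> M * (norm (t - t') + norm (y - y'))"
proof -
  have "\<exists>C\<ge>0. \<forall>e\<in>{0<..<min \<epsilon>\<^sub>s 1}. \<forall>d\<in>{0<..1::real}. \<forall>p\<in>UNIV. norm (F e (fst p) (snd p)) \<le> C * 1 \<and>
      (\<forall>q\<in>UNIV. norm (F e (fst p) (snd p) - F e (fst q) (snd q)) \<le> C * 1 * dist p q)"
    using assms unfolding lf.ol_def .
  then obtain C where C: "C \<ge> 0" and Cle: "\<forall>e\<in>{0<..<min \<epsilon>\<^sub>s 1}. \<forall>d\<in>{0<..1::real}. \<forall>p\<in>UNIV. norm (F e (fst p) (snd p)) \<le> C * 1 \<and>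
      (\<forall>q\<in>UNIV. norm (F e (fst p) (snd p) - F e (fst q) (snd q)) \<le> C * 1 * dist p q)"
    by (elim exE conjE)
  have *: "norm (F e (fst p) (snd p)) \<le> C * 1 \<and>
      (\<forall>q\<in>UNIV. norm (F e (fst p) (snd p) - F e (fst q) (snd q)) \<le> C * 1 * dist p q)" if "0 < e" "e < min \<epsilon>\<^sub>s 1" for e p
    by (rule Cle[THEN bspec, THEN bspec, THEN bspec, of e 1 p]) (use that in simp_all)
  have **: "norm (F e (fst p) (snd p) - F e (fst q) (snd q)) \<le> C * dist p q" if "0 < e" "e < min \<epsilon>\<^sub>s 1" for e p q
    using bspec[OF conjunct2[OF *[OF that, of p]], of q] by simp
  show ?thesis
  proof (intro exI[of _ C] allI impI conjI)
    fix e t t' :: real and y y' :: cc assume e: "0 < e \<and> e < min \<epsilon>\<^sub>s 1"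
    show "norm (F e t y) \<le> C" using *[of e "(t, y)"] e by simp
    have "norm (F e t y - F e t' y') \<le> C * dist (t, y) (t', y')"
      using **[of e "(t, y)" "(t', y')"] e by simp
    also have "\<dots> \<le> C * (norm (t - t') + norm (y - y'))"
      using dist_Pair_le[of t y t' y'] C by (intro mult_left_mono) (auto simp: dist_norm)
    finally show "norm (F e t y - F e t' y') \<le> C * (norm (t - t') + norm (y - y'))" .
  qed
qed

lemma P_at:
  assumes "norm y \<le> 2"
  shows "Pf e t y = c * (U (T * t) (\<beta> *\<^sub>R hopf y) e * (y \<bullet> y))"
    "Ptf e t y = (c * T) * (dU (T * t, \<beta> *\<^sub>R hopf y, e) (1, 0, 0) * (y \<bullet> y))"
    "Pxf e t y = ((2 * c) * U (T * t) (\<beta> *\<^sub>R hopf y) e) *\<^sub>R y + (2 * (y \<bullet> y)) *\<^sub>R hadj y ((c * \<beta>) *\<^sub>R gU (T * t) (\<beta> *\<^sub>R hopf y) e)"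
  using assms by (simp_all add: Pf_def Ptf_def Pxf_def ball_proj_id)

lemma P_has_derivative:
  assumes e: "0 < e" "e < \<epsilon>\<^sub>s" and y: "norm y < 2"
  shows "((\<lambda>(t, y). Pf e t y) has_derivative (\<lambda>(s, h). Ptf e t y * s + inner (Pxf e t y) h)) (at (t, y))"
proof -
  let ?A = "\<lambda>z :: real \<times> cc. (T * fst z, \<beta> *\<^sub>R hopf (snd z), e)"
  have y2: "norm y \<le> 2" using y by simp
  have in_U: "\<beta> *\<^sub>R hopf y \<in> \<U>" using arg_in[of y] y2 by (simp add: ball_proj_id)
  have two: "\<beta> *\<^sub>R (hpol y h + hpol h y) = (2 * \<beta>) *\<^sub>R hpol y h" for h
    by (simp only: hpol_comm[of h y] scaleR_2[symmetric] scaleR_scaleR mult.commute)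
  have A: "(?A has_derivative (\<lambda>h. (T * fst h, (2 * \<beta>) *\<^sub>R hpol y (snd h), 0))) (at (t, y))"
    by (rule has_derivative_eq_rhs[OF has_derivative_Pair[OF _ has_derivative_Pair[OF bounded_linear.has_derivative[OF bounded_linear_scaleR_right
           hpol.FDERIV[OF has_derivative_snd[OF has_derivative_ident] has_derivative_snd[OF has_derivative_ident]]] has_derivative_const]]],
         rule bounded_linear.has_derivative[OF bounded_linear_mult_right has_derivative_fst[OF has_derivative_ident]])
       (simp add: two)
  have U': "((\<lambda>z. Uf (?A z)) has_derivative (\<lambda>h. T * fst h * dU (?A (t, y)) (1, 0, 0) + (2 * \<beta>) * (gU (T * t) (\<beta> *\<^sub>R hopf y) e \<bullet> hpol y (snd h)))) (at (t, y))"
  proof -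
    define f where "f = Uf"
    have "(f has_derivative dU (T * t, \<beta> *\<^sub>R hopf y, e)) (at (?A (t, y)))"
      using dU_at[OF in_U e, of "T * t"] by (simp only: f_def fst_conv snd_conv)
    from has_derivative_compose[OF A this]
    have "((\<lambda>z. f (?A z)) has_derivative (\<lambda>h. dU (T * t, \<beta> *\<^sub>R hopf y, e) (T * fst h, (2 * \<beta>) *\<^sub>R hpol y (snd h), 0))) (at (t, y))" .
    moreover have "(\<lambda>h. dU (T * t, \<beta> *\<^sub>R hopf y, e) (T * fst h, (2 * \<beta>) *\<^sub>R hpol y (snd h), 0)) =
        (\<lambda>h. T * fst h * dU (?A (t, y)) (1, 0, 0) + (2 * \<beta>) * (gU (T * t) (\<beta> *\<^sub>R hopf y) e \<bullet> hpol y (snd h)))"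
      by (rule ext, subst dU_eq[OF in_U e]) simp
    ultimately show ?thesis by (simp only: f_def)
  qed
  have n: "((\<lambda>z :: real \<times> cc. snd z \<bullet> snd z) has_derivative (\<lambda>h. 2 * (y \<bullet> snd h))) (at (t, y))"
    by (rule has_derivative_eq_rhs[OF has_derivative_inner[OF has_derivative_snd[OF has_derivative_ident] has_derivative_snd[OF has_derivative_ident]]])
       (simp add: inner_commute)
  have "((\<lambda>z. c * (Uf (?A z) * (snd z \<bullet> snd z))) has_derivative (\<lambda>(s, h). Ptf e t y * s + inner (Pxf e t y) h)) (at (t, y))"
    by (rule has_derivative_eq_rhs[OF has_derivative_mult_right[OF has_derivative_mult[OF U' n]]])
       (simp add: fun_eq_iff P_at[OF y2] inner_add_left inner_hpol bounded_bilinear.scaleR_right[OF bounded_bilinear_hadj] algebra_simps)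
  moreover have "open (UNIV \<times> ball (0::cc) 2 :: (real \<times> cc) set)" by (intro open_Times open_UNIV open_ball)
  ultimately show ?thesis
    by (rule has_derivative_transform_within_open) (use y in \<open>auto simp: P_at\<close>)
qed

lemma perturbation_data: "\<exists>M. perturbation om (min \<epsilon>\<^sub>s 1) M Pf Ptf Pxf"
proof -
  obtain M1 where M1: "\<And>e t y t' y'. 0 < e \<and> e < min \<epsilon>\<^sub>s 1 \<Longrightarrow> norm (Pf e t y) \<le> M1 \<and>
    norm (Pf e t y - Pf e t' y') \<le> M1 * (norm (t - t') + norm (y - y'))" using bl_bound[OF P_bl(1)] by blast
  obtain M2 where M2: "\<And>e t y t' y'. 0 < e \<and> e < min \<epsilon>\<^sub>s 1 \<Longrightarrow> norm (Ptf e t y) \<le> M2 \<and>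
    norm (Ptf e t y - Ptf e t' y') \<le> M2 * (norm (t - t') + norm (y - y'))" using bl_bound[OF P_bl(2)] by blast
  obtain M3 where M3: "\<And>e t y t' y'. 0 < e \<and> e < min \<epsilon>\<^sub>s 1 \<Longrightarrow> norm (Pxf e t y) \<le> M3 \<and>
    norm (Pxf e t y - Pxf e t' y') \<le> M3 * (norm (t - t') + norm (y - y'))" using bl_bound[OF P_bl(3)] by blast
  define M where "M = max M1 (max M2 M3)"
  have le: "M1 \<le> M" "M2 \<le> M" "M3 \<le> M" by (auto simp: M_def)
  have up: "N * (norm (t - t') + norm (y - y')) \<le> M * (norm (t - t') + norm (y - y'))" if "N \<le> M" for N t t' and y y' :: cc
    using that by (intro mult_right_mono) auto
  have "perturbation om (min \<epsilon>\<^sub>s 1) M Pf Ptf Pxf"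
  proof
    show "0 < om" "cis om = 1" by (fact om)+
    show "0 < min \<epsilon>\<^sub>s 1" "min \<epsilon>\<^sub>s 1 \<le> 1" using eps by auto
    fix e t and y :: cc assume e: "0 < e" "e < min \<epsilon>\<^sub>s 1"
    show "norm (Pf e t y) \<le> M" "norm (Ptf e t y) \<le> M" "norm (Pxf e t y) \<le> M"
      using M1[of e t y] M2[of e t y] M3[of e t y] e le by (meson order_trans)+
    show "norm (Pf e t y - Pf e t' y') \<le> M * (norm (t - t') + norm (y - y'))"
      "norm (Ptf e t y - Ptf e t' y') \<le> M * (norm (t - t') + norm (y - y'))"
      "norm (Pxf e t y - Pxf e t' y') \<le> M * (norm (t - t') + norm (y - y'))" for t' y'
      using M1[of e t y t' y'] M2[of e t y t' y'] M3[of e t y t' y'] e up[OF le(1)] up[OF le(2)] up[OF le(3)] by (meson order_trans)+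
    have es: "0 < e" "e < \<epsilon>\<^sub>s" "e \<in> {0..\<epsilon>\<^sub>s}" using e by auto
    have Tt: "T * (t + 1) = T * t + T" by (simp add: distrib_left)
    have "gU (T * t + T) (\<beta> *\<^sub>R hopf (ball_proj y)) e = gU (T * t) (\<beta> *\<^sub>R hopf (ball_proj y)) e"
      by (simp add: gU_def dU_periodic[OF arg_in es(1,2)])
    then show "Pf e (t + 1) y = Pf e t y" "Ptf e (t + 1) y = Ptf e t y" "Pxf e (t + 1) y = Pxf e t y"
      using arg_in[of y] es periodic by (simp_all add: Pf_def Ptf_def Pxf_def Tt dU_periodic)
    assume y: "norm y < 2"
    show "((\<lambda>(t, x). Pf e t x) has_derivative (\<lambda>(s, h). Ptf e t y * s + inner (Pxf e t y) h)) (at (t, y))"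
      by (rule P_has_derivative[OF es(1,2) y])
    show "inner (Pxf e t y) (cm \<i> y) = 0"
      \<comment> \<open>The Hopf map is constant on gauge orbits:
        \<open>hpol y (cm \<i> y) = 0\<close>.\<close>
      using y by (simp add: P_at inner_add_left flip: inner_hpol)
  qed
  then show ?thesis by blast
qed

lemma solution_from_orbit:
  assumes ro: "regular_orbit om (min \<epsilon>\<^sub>s 1) M Pf Ptf Pxf e x v \<sigma> \<tau> b \<alpha>
      (\<lambda>t y. c * U (T * t) (\<beta> *\<^sub>R y) e) (\<lambda>t y. (c * \<beta>) *\<^sub>R gU (T * t) (\<beta> *\<^sub>R y) e)"
    and large: "1/2 \<le> norm (x s)"
  shows "\<exists>u. generalized_periodic_solution T \<U> U e u \<and> (\<forall>t. norm (u t) < r) \<and> (\<exists>t. \<beta> / 4 \<le> norm (u t))"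
proof -
  interpret ro: regular_orbit om "min \<epsilon>\<^sub>s 1" M Pf Ptf Pxf e x v \<sigma> \<tau> b \<alpha>
      "\<lambda>t y. c * U (T * t) (\<beta> *\<^sub>R y) e" "\<lambda>t y. (c * \<beta>) *\<^sub>R gU (T * t) (\<beta> *\<^sub>R y) e"
    by (rule ro)
  have e: "0 < e" "e < \<epsilon>\<^sub>s" using ro.e by auto
  define u where "u t = \<beta> *\<^sub>R ro.u0 (t / T)" for t
  define ud where "ud t = (\<beta> / T) *\<^sub>R ro.u1 (t / T)" for t
  have u_less: "norm (u t) < r" for t
  proof -
    have "norm (u t) = \<beta> * norm (ro.u0 (t / T))" using \<beta> by (simp add: u_def)
    also have "\<dots> < \<beta> * 4" using \<beta>(1) ro.norm_u0_less by (intro mult_strict_left_mono) auto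
    finally show ?thesis using \<beta> by simp
  qed
  have u_in: "u t \<in> \<U>" for t using u_less[of t] r by (auto simp: subset_iff)
  have u0: "u t = 0 \<longleftrightarrow> ro.u0 (t / T) = 0" for t using \<beta> by (simp add: u_def)
  have tT: "filterlim (\<lambda>t. t / T) (at (t0 / T)) (at t0)" for t0
  proof -
    have "((\<lambda>t. t / T) \<longlongrightarrow> t0 / T) (at t0)" by (intro tendsto_intros) (use T in auto)
    then show ?thesis unfolding filterlim_at using T by (auto simp: eventually_at intro!: exI[of _ 1])
  qed
  have dtT: "((\<lambda>t. t / T) has_vector_derivative 1 / T) (at t)" for t
    using T by (auto intro!: derivative_eq_intros simp: has_vector_derivative_def)
  have u_isCont: "isCont u t" for t
    unfolding u_def using T by (intro continuous_intros isCont_o2[where g = ro.u0 and f = "\<lambda>t. t / T"] ro.u0_isCont) auto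
  have u_der: "(u has_vector_derivative ud t) (at t)" if "u t \<noteq> 0" for t
  proof -
    have "((ro.u0 \<circ> (\<lambda>t. t / T)) has_vector_derivative (1 / T) *\<^sub>R ro.u1 (t / T)) (at t)"
      using that by (intro vector_diff_chain_at dtT ro.u0_derivative) (simp add: u0)
    from bounded_linear.has_vector_derivative[OF bounded_linear_scaleR_right this, of \<beta>]
    show ?thesis by (simp add: u_def[abs_def] ud_def o_def)
  qed
  define F where "F = (\<lambda>(t, y). - (y /\<^sub>R norm y ^ 3) + e *\<^sub>R gU t y e)"
  have ud_der: "(ud has_vector_derivative F (t, u t)) (at t)" if nz: "u t \<noteq> 0" for t
  proof -
    let ?z = "ro.u0 (t / T)"
    have "((ro.u1 \<circ> (\<lambda>t. t / T)) has_vector_derivative (1 / T) *\<^sub>R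
        (- (4 * om\<^sup>2 / norm ?z ^ 3) *\<^sub>R ?z + (2 * e) *\<^sub>R ((c * \<beta>) *\<^sub>R gU (T * (t / T)) (\<beta> *\<^sub>R ?z) e))) (at t)"
      using nz by (intro vector_diff_chain_at dtT ro.u1_derivative) (simp add: u0)
    from bounded_linear.has_vector_derivative[OF bounded_linear_scaleR_right this, of "\<beta> / T"]
    have 1: "(ud has_vector_derivative (\<beta> / T) *\<^sub>R ((1 / T) *\<^sub>R
        (- (4 * om\<^sup>2 / norm ?z ^ 3) *\<^sub>R ?z + (2 * e) *\<^sub>R ((c * \<beta>) *\<^sub>R gU t (u t) e)))) (at t)"
      using T by (simp add: ud_def[abs_def] o_def u_def)
    have n: "norm ?z > 0" using nz by (simp add: u0)
    \<comment> \<open>Undoing the rescaling turns the Kepler constant 4 om^2 back into 1, by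
      \<open>scale\<close>.\<close>
    have "(\<beta> / T) * ((1 / T) * (4 * om\<^sup>2 / norm ?z ^ 3)) = \<beta> / (norm (u t)) ^ 3"
    proof -
      have "(\<beta> / T) * ((1 / T) * (4 * om\<^sup>2 / norm ?z ^ 3)) = \<beta> * (4 * om\<^sup>2) / (T\<^sup>2 * norm ?z ^ 3)"
        by (simp add: power2_eq_square)
      also have "\<dots> = \<beta> / (norm (u t)) ^ 3"
        unfolding scale[symmetric] using \<beta> n om(1) by (simp add: u_def power_mult_distrib)
      finally show ?thesis .
    qed
    moreover have "(\<beta> / T) * ((1 / T) * ((2 * e) * (c * \<beta>))) = e"
      using \<beta> T by (simp add: c field_simps power2_eq_square)
    moreover have "(\<beta> / T) *\<^sub>R ((1 / T) *\<^sub>R (- (4 * om\<^sup>2 / norm ?z ^ 3) *\<^sub>R ?z + (2 * e) *\<^sub>R ((c * \<beta>) *\<^sub>R gU t (u t) e))) =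
       - (((\<beta> / T) * ((1 / T) * (4 * om\<^sup>2 / norm ?z ^ 3))) *\<^sub>R ?z) + ((\<beta> / T) * ((1 / T) * ((2 * e) * (c * \<beta>)))) *\<^sub>R gU t (u t) e"
      by (simp add: scaleR_add_right scaleR_diff_right)
    moreover have "(\<beta> / (norm (u t)) ^ 3) *\<^sub>R ?z = u t /\<^sub>R norm (u t) ^ 3"
      by (simp add: u_def divide_inverse mult.commute)
    ultimately have "(\<beta> / T) *\<^sub>R ((1 / T) *\<^sub>R (- (4 * om\<^sup>2 / norm ?z ^ 3) *\<^sub>R ?z + (2 * e) *\<^sub>R ((c * \<beta>) *\<^sub>R gU t (u t) e))) = F (t, u t)"
      by (simp only: F_def prod.case)
    with 1 show ?thesis by simp
  qed
  have vd: "vector_derivative u (at t) = ud t" if "u t \<noteq> 0" for t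
    using u_der[OF that] by (rule vector_derivative_at)
  have iso: "\<forall>\<^sub>F t in at t0. u t \<noteq> 0" if "u t0 = 0" for t0
    using eventually_compose_filterlim[OF ro.u0_zero_isolated tT, of t0] that by (simp add: u0)
  have "generalized_periodic_solution T \<U> U e u"
    unfolding generalized_periodic_solution_def
  proof (intro conjI allI impI)
    show "continuous_on UNIV u" using u_isCont by (simp add: continuous_at_imp_continuous_on)
    show "u (t + T) = u t" for t
      using T ro.u0_per[of "t / T"] by (simp add: u_def add_divide_distrib)
    show "range u \<subseteq> \<U>" using u_in by auto
    show "discrete {t. u t = 0}"
    proof (rule discreteI)
      fix t0 assume t0: "t0 \<in> {t. u t = 0}"
      then have "\<forall>\<^sub>F t in at t0. u t \<noteq> 0" using iso by simp
      then have "\<not> t0 islimpt {t. u t = 0}"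
        unfolding islimpt_iff_eventually by simp
      then show "t0 isolated_in {t. u t = 0}" using t0 by (simp add: isolated_in_islimpt_iff)
    qed
  next
    fix I :: "real set" assume I: "open I \<and> is_interval I \<and> I \<subseteq> - {t. u t = 0}"
    then have nz: "u t \<noteq> 0" if "t \<in> I" for t using that by auto
    show "Cinfinity_on u I"
    proof (rule Cinfinity_on_ode[OF _ _ force_smooth[OF e]])
      show "(u has_vector_derivative ud t) (at t within I)" if "t \<in> I" for t
        using u_der[OF nz[OF that]] by (rule has_vector_derivative_at_within)
      show "(ud has_vector_derivative (case (t, u t) of (t, y) \<Rightarrow> - (y /\<^sub>R norm y ^ 3) + e *\<^sub>R gU t y e)) (at t within I)" if "t \<in> I" for t
        using ud_der[OF nz[OF that]] unfolding F_def by (rule has_vector_derivative_at_within)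
      show "(t, u t) \<in> UNIV \<times> (\<U> - {0})" if "t \<in> I" for t using nz[OF that] u_in by simp
    qed
    show "\<forall>t\<in>I. vector_derivative (\<lambda>s. vector_derivative u (at s)) (at t) =
           - (u t /\<^sub>R norm (u t) ^ 3) + e *\<^sub>R gradient (\<lambda>v. U t v e) (u t)"
    proof
      fix t assume t: "t \<in> I"
      have "((\<lambda>s. vector_derivative u (at s)) has_vector_derivative F (t, u t)) (at t)"
        by (rule has_vector_derivative_transform_within_open[OF ud_der[OF nz[OF t]], of I])
           (use I t nz vd in auto)
      then show "vector_derivative (\<lambda>s. vector_derivative u (at s)) (at t) =
           - (u t /\<^sub>R norm (u t) ^ 3) + e *\<^sub>R gradient (\<lambda>v. U t v e) (u t)"
        using gU_gradient[OF u_in e] by (simp add: vector_derivative_at F_def)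
    qed
  next
    fix t0 assume t0: "u t0 = 0"
    then have z0: "ro.u0 (t0 / T) = 0" by (simp add: u0)
    obtain d where "((\<lambda>r. ro.u0 r /\<^sub>R norm (ro.u0 r)) \<longlongrightarrow> d) (at (t0 / T))"
      using ro.u0_direction[OF z0] by blast
    from filterlim_compose[OF this tT]
    show "\<exists>d. ((\<lambda>t. u t /\<^sub>R norm (u t)) \<longlongrightarrow> d) (at t0)"
    proof (intro exI[of _ d])
      have "inverse \<beta> * inverse k * \<beta> = inverse k" for k using \<beta>(1) by (cases "k = 0") (simp_all add: field_simps)
      then have "u t /\<^sub>R norm (u t) = ro.u0 (t / T) /\<^sub>R norm (ro.u0 (t / T))" for t
        using \<beta>(1) by (simp add: u_def)
      then show "((\<lambda>t. u t /\<^sub>R norm (u t)) \<longlongrightarrow> d) (at t0)"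
        using \<open>((\<lambda>t. ro.u0 (t / T) /\<^sub>R norm (ro.u0 (t / T))) \<longlongrightarrow> d) (at t0)\<close> by simp
    qed
    obtain h where "((\<lambda>r. (norm (ro.u1 r))\<^sup>2 / 2 - 4 * om\<^sup>2 / norm (ro.u0 r)) \<longlongrightarrow> h) (at (t0 / T))"
      using ro.u0_energy[OF z0] by blast
    from tendsto_mult_left[OF filterlim_compose[OF this tT], of "(\<beta> / T)\<^sup>2"]
    have "((\<lambda>t. (\<beta> / T)\<^sup>2 * ((norm (ro.u1 (t / T)))\<^sup>2 / 2 - 4 * om\<^sup>2 / norm (ro.u0 (t / T)))) \<longlongrightarrow> (\<beta> / T)\<^sup>2 * h) (at t0)" .
    moreover have "(\<beta> / T)\<^sup>2 * ((norm (ro.u1 (t / T)))\<^sup>2 / 2 - 4 * om\<^sup>2 / norm (ro.u0 (t / T))) =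
        (norm (vector_derivative u (at t)))\<^sup>2 / 2 - 1 / norm (u t)" if "u t \<noteq> 0" for t
    proof -
      have n: "norm (ro.u0 (t / T)) > 0" using that by (simp add: u0)
      have "(norm (ud t))\<^sup>2 = (\<beta> / T)\<^sup>2 * (norm (ro.u1 (t / T)))\<^sup>2"
        by (simp add: ud_def power_mult_distrib power_divide)
      moreover have "1 / norm (u t) = (\<beta> / T)\<^sup>2 * (4 * om\<^sup>2 / norm (ro.u0 (t / T)))"
      proof -
        have "(\<beta> / T)\<^sup>2 * (4 * om\<^sup>2 / norm (ro.u0 (t / T))) = \<beta>\<^sup>2 * (4 * om\<^sup>2) / (T\<^sup>2 * norm (ro.u0 (t / T)))"
          by (simp add: power_divide)
        also have "\<dots> = 1 / norm (u t)"
          unfolding scale[symmetric] using \<beta> n om(1) by (simp add: u_def power2_eq_square power3_eq_cube)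
        finally show ?thesis ..
      qed
      ultimately show ?thesis by (simp add: vd[OF that] right_diff_distrib)
    qed
    then have "\<forall>\<^sub>F t in at t0. (\<beta> / T)\<^sup>2 * ((norm (ro.u1 (t / T)))\<^sup>2 / 2 - 4 * om\<^sup>2 / norm (ro.u0 (t / T))) =
        (norm (vector_derivative u (at t)))\<^sup>2 / 2 - 1 / norm (u t)"
      by (rule eventually_mono[OF iso[OF t0]])
    ultimately show "\<exists>h. ((\<lambda>t. (norm (vector_derivative u (at t)))\<^sup>2 / 2 - 1 / norm (u t)) \<longlongrightarrow> h) (at t0)"
      by (intro exI) (rule Lim_transform_eventually)
  qed
  moreover have "\<beta> / 4 \<le> norm (u (T * \<tau> s))"
  proof -
    have "(1/2)\<^sup>2 \<le> (norm (x s))\<^sup>2" using large by (intro power_mono) auto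
    then have "1/4 \<le> norm (ro.u0 (\<tau> s))" by (simp add: ro.norm_u0 power2_eq_square)
    then have "\<beta> * (1/4) \<le> \<beta> * norm (ro.u0 (\<tau> s))" using \<beta>(1) by (intro mult_left_mono) auto
    then show ?thesis using T \<beta>(1) by (simp add: u_def)
  qed
  ultimately show ?thesis using u_less by blast
qed

lemma solution_scale:
  "\<exists>e0>0. e0 \<le> \<epsilon>\<^sub>s \<and> (\<forall>e. 0 < e \<and> e < e0 \<longrightarrow>
    (\<exists>u. generalized_periodic_solution T \<U> U e u \<and> (\<forall>t. norm (u t) < r) \<and> (\<exists>t. \<beta> / 4 \<le> norm (u t))))"
proof -
  obtain M where "perturbation om (min \<epsilon>\<^sub>s 1) M Pf Ptf Pxf" using perturbation_data by blast
  then interpret pe: perturbation om "min \<epsilon>\<^sub>s 1" M Pf Ptf Pxf .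
  obtain e2 where e2: "e2 > 0" "e2 \<le> min \<epsilon>\<^sub>s 1" and orb: "\<forall>e. 0 < e \<and> e < e2 \<longrightarrow> (\<exists>x v \<sigma> \<tau> b \<alpha>. pe.regularized e x v \<sigma> \<tau> b \<alpha> UNIV \<and> b > 0 \<and>
     (\<forall>s. x (s + 1) = x s) \<and> (\<forall>s. \<tau> (s + 1) = \<tau> s + 1) \<and> (\<exists>s. 1/2 \<le> norm (x s)))"
    using pe.regularized_orbit by (elim exE conjE)
  have "\<exists>u. generalized_periodic_solution T \<U> U e u \<and> (\<forall>t. norm (u t) < r) \<and> (\<exists>t. \<beta> / 4 \<le> norm (u t))"
    if e: "0 < e" "e < e2" for e
  proof -
    obtain x v \<sigma> \<tau> b \<alpha> s where o: "pe.regularized e x v \<sigma> \<tau> b \<alpha> UNIV" "b > 0"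
     "\<forall>s. x (s + 1) = x s" "\<forall>s. \<tau> (s + 1) = \<tau> s + 1" "1/2 \<le> norm (x s)"
      using orb[rule_format, OF conjI[OF e]] by (elim exE conjE)
    have ee: "0 < e" "e < min \<epsilon>\<^sub>s 1" using e e2 by auto
    have "regular_orbit om (min \<epsilon>\<^sub>s 1) M Pf Ptf Pxf e x v \<sigma> \<tau> b \<alpha>
      (\<lambda>t y. c * U (T * t) (\<beta> *\<^sub>R y) e) (\<lambda>t y. (c * \<beta>) *\<^sub>R gU (T * t) (\<beta> *\<^sub>R y) e)"
    proof
      show "0 < e" "e < min \<epsilon>\<^sub>s 1" by (fact ee)+
      show "pe.regularized e x v \<sigma> \<tau> b \<alpha> UNIV" "0 < b" by (fact o)+
      show "x (s + 1) = x s" "\<tau> (s + 1) = \<tau> s + 1" for s by (fact o[rule_format])+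
      show "Pf e t y = c * U (T * t) (\<beta> *\<^sub>R hopf y) e * (norm y)\<^sup>2"
        "Pxf e t y = (2 * (c * U (T * t) (\<beta> *\<^sub>R hopf y) e)) *\<^sub>R y + (2 * (norm y)\<^sup>2) *\<^sub>R hadj y ((c * \<beta>) *\<^sub>R gU (T * t) (\<beta> *\<^sub>R hopf y) e)"
        if "norm y < 2" for t y
        using that by (simp_all add: P_at power2_norm_eq_inner mult.assoc)
      have "Ck_on 0 Uf tube" using smooth unfolding Cinfinity_on_def by blast
      then have "continuous_on tube Uf" by simp
      moreover have "continuous_on (UNIV \<times> ball 0 4) (\<lambda>z :: real \<times> (real^3). (T * fst z, \<beta> *\<^sub>R snd z, e))"
        by (intro continuous_intros)
      moreover have "(\<lambda>z :: real \<times> (real^3). (T * fst z, \<beta> *\<^sub>R snd z, e)) ` (UNIV \<times> ball 0 4) \<subseteq> tube"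
      proof -
        have "\<beta> *\<^sub>R y \<in> \<U>" if "norm y < 4" for y
        proof -
          have "\<beta> * norm y \<le> \<beta> * 4" using that \<beta>(1) by (intro mult_left_mono) auto
          moreover have "norm (\<beta> *\<^sub>R y) = \<beta> * norm y" using \<beta>(1) by simp
          ultimately have "norm (\<beta> *\<^sub>R y) \<le> r" using \<beta>(2) by linarith
          then have "\<beta> *\<^sub>R y \<in> cball 0 r" by simp
          then show ?thesis using r by blast
        qed
        then show ?thesis using ee by auto
      qed
      ultimately have "continuous_on (UNIV \<times> ball 0 4) (\<lambda>z. Uf (T * fst z, \<beta> *\<^sub>R snd z, e))"
        by (rule continuous_on_compose2)
      from continuous_on_mult_left[OF this, of c]
      show "continuous_on (UNIV \<times> ball 0 4) (\<lambda>(t, y). c * U (T * t) (\<beta> *\<^sub>R y) e)"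
        by (simp add: case_prod_beta)
    qed
    then show ?thesis using o(5) by (rule solution_from_orbit)
  qed
  then show ?thesis using e2 by (intro exI[of _ e2]) auto
qed

end

lemma solution_in_ball:
  assumes r: "r > 0" "cball 0 r \<subseteq> \<U>"
  shows "\<exists>\<rho>>0. \<rho> \<le> r \<and> (\<exists>e0>0. e0 \<le> \<epsilon>\<^sub>s \<and> (\<forall>e. 0 < e \<and> e < e0 \<longrightarrow>
    (\<exists>u. generalized_periodic_solution T \<U> U e u \<and> (\<forall>t. norm (u t) < r) \<and> (\<exists>t. \<rho> \<le> norm (u t)))))"
proof -
  \<comment> \<open>\<open>\<beta> ^ 3 = T\<^sup>2 / (4 * om\<^sup>2)\<close> is at most (r/4)^3 iff
    \<open>16 * T\<^sup>2 / r ^ 3 \<le> om\<^sup>2\<close>. The added 1 gives n >= 1, hence om >= 1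
    and om <= om^2.\<close>
  obtain n :: nat where n: "16 * T\<^sup>2 / r ^ 3 + 1 \<le> of_nat n" using real_arch_simple by blast
  define om where "om = 2 * of_nat n * pi"
  have q: "0 \<le> 16 * T\<^sup>2 / r ^ 3" using r by simp
  have n1: "1 \<le> real n" using n q by linarith
  have "real n * 1 \<le> real n * (2 * pi)" using pi_ge_two by (intro mult_left_mono) auto
  then have "real n \<le> om" by (simp add: om_def mult_ac)
  then have om: "real n \<le> om" "om > 0" using n1 by auto
  have "om * 1 \<le> om * om" using om n1 by (intro mult_left_mono) auto
  then have "om \<le> om\<^sup>2" by (simp add: power2_eq_square)
  then have om2: "16 * T\<^sup>2 / r ^ 3 \<le> om\<^sup>2" using om n by linarith
  have c: "cis om = 1"
    unfolding om_def by (simp add: complex_eq_iff)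
  define \<beta> where "\<beta> = root 3 (T\<^sup>2 / (4 * om\<^sup>2))"
  have p: "T\<^sup>2 / (4 * om\<^sup>2) > 0" using T om by simp
  have b: "\<beta> > 0" "\<beta> ^ 3 = T\<^sup>2 / (4 * om\<^sup>2)" using p by (simp_all add: \<beta>_def)
  have "\<beta> ^ 3 \<le> (r / 4) ^ 3"
    unfolding b(2) using om om2 r(1) by (simp add: field_simps power_divide)
  then have "\<beta> \<le> r / 4" using power_mono_iff[of \<beta> "r / 4" 3] b(1) r(1) by simp
  then have br: "4 * \<beta> \<le> r" by simp
  have s: "\<beta> ^ 3 * (4 * om\<^sup>2) = T\<^sup>2" using b om by simp
  from solution_scale[OF r(2) om(2) c b(1) br s refl]
  show ?thesis using b(1) br by (intro exI[of _ "\<beta> / 4"]) auto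
qed

text \<open>Induction over shrinking balls: the new solution reaches norm \<rho> somewhere, while
  the earlier ones are taken inside the open ball of radius \<rho>, so it differs from all of
  them.\<close>

lemma many_solutions:
  assumes "r > 0" "cball 0 r \<subseteq> \<U>"
  shows "\<exists>e0>0. e0 \<le> \<epsilon>\<^sub>s \<and> (\<forall>e. 0 < e \<and> e < e0 \<longrightarrow>
    (\<exists>S. finite S \<and> card S = l \<and> (\<forall>u\<in>S. generalized_periodic_solution T \<U> U e u \<and> (\<forall>t. norm (u t) < r))))"
  using assms
proof (induction l arbitrary: r)
  case 0
  then show ?case using eps by (intro exI[of _ \<epsilon>\<^sub>s]) (auto intro!: exI[of _ "{}"])
next
  case (Suc l)
  obtain \<rho> e1 where \<rho>: "\<rho> > 0" "\<rho> \<le> r" and e1: "e1 > 0" "e1 \<le> \<epsilon>\<^sub>s" and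
    new: "\<And>e. 0 < e \<Longrightarrow> e < e1 \<Longrightarrow> \<exists>u. generalized_periodic_solution T \<U> U e u \<and> (\<forall>t. norm (u t) < r) \<and> (\<exists>t. \<rho> \<le> norm (u t))"
    using solution_in_ball[OF Suc.prems] by blast
  have "cball 0 \<rho> \<subseteq> \<U>" using \<rho>(2) Suc.prems(2) by auto
  from Suc.IH[OF \<rho>(1) this] obtain e2 where e2: "e2 > 0" "e2 \<le> \<epsilon>\<^sub>s" and
    old: "\<And>e. 0 < e \<Longrightarrow> e < e2 \<Longrightarrow> \<exists>S. finite S \<and> card S = l \<and> (\<forall>u\<in>S. generalized_periodic_solution T \<U> U e u \<and> (\<forall>t. norm (u t) < \<rho>))"
    by blast
  have "\<exists>S. finite S \<and> card S = Suc l \<and> (\<forall>u\<in>S. generalized_periodic_solution T \<U> U e u \<and> (\<forall>t. norm (u t) < r))"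
    if e: "0 < e" "e < min e1 e2" for e
  proof -
    obtain u t where u: "generalized_periodic_solution T \<U> U e u" "\<And>t. norm (u t) < r" "\<rho> \<le> norm (u t)"
      using new[of e] e by auto
    obtain S where S: "finite S" "card S = l" "\<And>w. w \<in> S \<Longrightarrow> generalized_periodic_solution T \<U> U e w \<and> (\<forall>t. norm (w t) < \<rho>)"
      using old[of e] e by auto
    have "u \<notin> S" using u(3) S(3)[of u] by (meson not_le)
    then show ?thesis
      using S u \<rho>(2) by (intro exI[of _ "insert u S"]) (auto intro: less_le_trans)
  qed
  then show ?case using e1 e2 by (intro exI[of _ "min e1 e2"]) auto
qed

end

theorem theorem2p1:
  fixes T \<epsilon>\<^sub>s :: real
    and \<U> :: "(real^3) set"
    and U :: "real \<Rightarrow> real^3 \<Rightarrow> real \<Rightarrow> real"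
    and l :: nat
  assumes "T > 0" and "\<epsilon>\<^sub>s > 0"
    and "open \<U>" and "0 \<in> \<U>"
    and "Cinfinity_on (\<lambda>(t, u, \<epsilon>). U t u \<epsilon>) (UNIV \<times> \<U> \<times> {0..\<epsilon>\<^sub>s})"
    and "\<forall>t. \<forall>u\<in>\<U>. \<forall>\<epsilon>\<in>{0..\<epsilon>\<^sub>s}. U (t + T) u \<epsilon> = U t u \<epsilon>"
    and "l \<ge> 1"
  shows "\<exists>\<epsilon>\<^sub>l. 0 < \<epsilon>\<^sub>l \<and> \<epsilon>\<^sub>l \<le> \<epsilon>\<^sub>s \<and>
    (\<forall>\<epsilon>. 0 < \<epsilon> \<and> \<epsilon> < \<epsilon>\<^sub>l \<longrightarrow>
      (\<exists>S. finite S \<and> card S = l \<and> (\<forall>u\<in>S. generalized_periodic_solution T \<U> U \<epsilon> u)))"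
proof -
  interpret forced_kepler T \<epsilon>\<^sub>s \<U> U
    by unfold_locales (use assms in auto)
  obtain r where r: "r > 0" "cball 0 r \<subseteq> \<U>"
    using assms(3,4) open_contains_cball by blast
  obtain e0 where e0: "e0 > 0" "e0 \<le> \<epsilon>\<^sub>s" and sol: "\<forall>e. 0 < e \<and> e < e0 \<longrightarrow>
    (\<exists>S. finite S \<and> card S = l \<and> (\<forall>u\<in>S. generalized_periodic_solution T \<U> U e u \<and> (\<forall>t. norm (u t) < r)))"
    using many_solutions[OF r, of l] by (elim exE conjE)
  show ?thesis
  proof (intro exI[of _ e0] conjI allI impI e0)
    fix e assume "0 < e \<and> e < e0"
    from sol[rule_format, OF this] obtain S where "finite S" "card S = l"
      "\<forall>u\<in>S. generalized_periodic_solution T \<U> U e u \<and> (\<forall>t. norm (u t) < r)"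
      by (elim exE conjE)
    then show "\<exists>S. finite S \<and> card S = l \<and> (\<forall>u\<in>S. generalized_periodic_solution T \<U> U e u)"
      by (intro exI[of _ S]) simp
  qed
qed

end
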